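(* Let $f:\mathbb{R}^2\to\mathbb{R}$ be a polynomial function with a strict local minimum at the origin such that $f(0,0)=0$, and suppose that its polar curve $\Gamma(f,x)$ is reduced. Let $\varepsilon>0$ be sufficiently small and suppose that the vertical direction of projection is generic with respect to $\mathcal{C}_\varepsilon$. Then there exists a snake $\sigma:\{1,2,\ldots,n\}\to\{1,2,\ldots,n\}$, with $$\sigma(1)<\sigma(2)>\sigma(3)<\ldots>\sigma(n),$$ that encodes the shape of $\mathcal{C}_\varepsilon$ in the half-plane $x>0$, where $n$ denotes the number of right polar half-branches. Here "encodes" means that $\sigma$ is the permutation associated to the two total orders $<_1$ and $<_2$ on the set of right crests and right valleys of $\mathcal{C}_\varepsilon$ described in the context.
   Context: For $\varepsilon>0$, $\mathcal{D}_\varepsilon$ is the connected component containing the origin $O$ of $f^{-1}([0,\varepsilon])$, and $\mathcal{C}_\varepsilon:=\mathcal{D}_\varepsilon\setminus\mathrm{Int}\,\mathcal{D}_\varepsilon$. For all sufficiently small $\varepsilon>0$, $\mathcal{C}_\varepsilon$ is a smooth Jordan curve. "Sufficiently small $\varepsilon$" means: there exists $\varepsilon_0>0$ such that the assertion holds for every $0<\varepsilon<\varepsilon_0$. The vertical direction is generic with respect to $\mathcal{C}_\varepsilon$ if $\mathcal{C}_\varepsilon$ has no vertical bitangent (vertical line tangent to $\mathcal{C}_\varepsilon$ at two distinct points) and no inflection point with vertical tangent line. The polar curve is $\Gamma=\Gamma(f,x):=\{(x,y)\in\mathbb{R}^2\mid\frac{\partial f}{\partial y}(x,y)=0\}$;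 it is reduced if its equation $\frac{\partial f}{\partial y}$ has no factor of multiplicity greater than one. Polar half-branches: in a sufficiently small neighbourhood $V$ of $O$, $(\Gamma\cap V)\setminus\{O\}$ is a finite disjoint union of half-branches issuing from $O$, called polar half-branches; those in $\{x>0\}$ are called right polar half-branches. In $V$, distinct polar half-branches meet only at $O$, and for sufficiently small $\varepsilon>0$ each of them meets $\mathcal{C}_\varepsilon$ in exactly one point. The right polar half-branches are totally ordered by the trigonometric (counterclockwise) order in the half-plane $x>0$: $\gamma_1^+<\dots<\gamma_n^+$. Put $P_i=(x_i,y_i):=\mathcal{C}_\varepsilon\cap\gamma_i^+$. The point $P_i$ is a right crest (respectively right valley) of $\mathcal{C}_\varepsilon$ if, in a small enough neighbourhood of $P_i$, $\mathcal{C}_\varepsilon$ is situated to the right (respectively to the left) of the vertical line $x=x_i$. The two orders on the set $\{P_1,\dots,P_n\}$ of right crests and right valleys: $<_1$ is the order of the right polar half-branches, $P_1<_1P_2<_1\dots<_1P_n$; $<_2$ is the order given by the $x$-coordinate read from right to left, i.e. $P_i<_2P_j$ if and only if $x_i>x_j$. The permutation associated to $(<_1,<_2)$ is $\sigma$, where $\sigma(i)$ is the position in the order $<_2$ of the element which is in position $i$ in the order $<_1$. A snake is a permutation $\sigma$ of $\{1,\dots,n\}$ that is alternating: $\sigma(1)>\sigma(2)<\sigma(3)>\dots$ or $\sigma(1)<\sigma(2)>\sigma(3)<\dots$. *)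

theory Defs
  imports
    "HOL-Analysis.Analysis"
    "HOL-Computational_Algebra.Computational_Algebra"
    "HOL-Combinatorics.Permutations"
begin

text \<open>
  A polynomial in \<open>\<real>[x][y]\<close> is a \<^typ>\<open>real poly poly\<close>: the outer variable is \<open>y\<close>, the
  coefficients are polynomials in \<open>x\<close>.  Hence \<^const>\<open>pderiv\<close> on \<^typ>\<open>real poly poly\<close> is
  the partial derivative with respect to \<open>y\<close> (see \<open>plane_poly_partial_y\<close>).
\<close>

definition plane_poly :: "real poly poly \<Rightarrow> real \<times> real \<Rightarrow> real" where
  "plane_poly F = (\<lambda>(x, y). poly (poly F [:y:]) x)"

lemma plane_poly_partial_y:
  "((\<lambda>t. plane_poly F (x, t)) has_real_derivative plane_poly (pderiv F) (x, y)) (at y)"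
proof (induction F)
  case 0
  then show ?case by (simp add: plane_poly_def)
next
  case (pCons a p)
  then show ?case
    by (auto simp: plane_poly_def pderiv_pCons intro!: derivative_eq_intros)
qed

definition strict_local_min :: "(real \<times> real \<Rightarrow> real) \<Rightarrow> real \<times> real \<Rightarrow> bool" where
  "strict_local_min f a \<longleftrightarrow> (\<forall>\<^sub>F p in at a. f a < f p)"

definition level_region :: "(real \<times> real \<Rightarrow> real) \<Rightarrow> real \<Rightarrow> (real \<times> real) set" where
  "level_region f \<epsilon> = connected_component_set (f -` {0..\<epsilon>}) (0, 0)"

definition level_curve :: "(real \<times> real \<Rightarrow> real) \<Rightarrow> real \<Rightarrow> (real \<times> real) set" where
  "level_curve f \<epsilon> = level_region f \<epsilon> - interior (level_region f \<epsilon>)"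

text \<open>
  A regular embedded parametrization of the plane curve \<open>C\<close> near its point \<open>p\<close>, with
  parameter value \<open>0\<close> at \<open>p\<close>.
\<close>

definition local_parametrization ::
    "(real \<times> real) set \<Rightarrow> real \<times> real \<Rightarrow> real \<Rightarrow> (real \<Rightarrow> real \<times> real) \<Rightarrow> bool" where
  "local_parametrization C p \<delta> c \<longleftrightarrow>
     0 < \<delta> \<and> c 0 = p \<and>
     c C1_differentiable_on {-\<delta><..<\<delta>} \<and>
     (\<forall>t\<in>{-\<delta><..<\<delta>}. vector_derivative c (at t) \<noteq> 0) \<and>
     (\<exists>U k. open U \<and> p \<in> U \<and> homeomorphism {-\<delta><..<\<delta>} (C \<inter> U) c k)"

definition vertical_tangent :: "(real \<times> real) set \<Rightarrow> real \<times> real \<Rightarrow> bool" where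
  "vertical_tangent C p \<longleftrightarrow>
     (\<exists>\<delta> c. local_parametrization C p \<delta> c \<and> fst (vector_derivative c (at 0)) = 0)"

definition signed_curvature :: "(real \<Rightarrow> real \<times> real) \<Rightarrow> real \<Rightarrow> real" where
  "signed_curvature c t =
     (let v = vector_derivative c (at t);
          a = vector_derivative (\<lambda>s. vector_derivative c (at s)) (at t)
      in (fst v * snd a - snd v * fst a) / norm v ^ 3)"

text \<open>
  An inflection point is a point at which the curvature changes sign; the factor \<open>s\<close> selects
  the direction of the change.
\<close>

definition inflection_point :: "(real \<times> real) set \<Rightarrow> real \<times> real \<Rightarrow> bool" where
  "inflection_point C p \<longleftrightarrow>
     (\<exists>\<delta> c s. local_parametrization C p \<delta> c \<and>
        (\<lambda>t. vector_derivative c (at t)) C1_differentiable_on {-\<delta><..<\<delta>} \<and>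
        (\<forall>t\<in>{0<..<\<delta>}. 0 < s * signed_curvature c t \<and> s * signed_curvature c (- t) < 0))"

definition vertical_generic :: "(real \<times> real) set \<Rightarrow> bool" where
  "vertical_generic C \<longleftrightarrow>
     \<not> (\<exists>p q. p \<noteq> q \<and> fst p = fst q \<and> vertical_tangent C p \<and> vertical_tangent C q) \<and>
     \<not> (\<exists>p. vertical_tangent C p \<and> inflection_point C p)"

definition polar_curve :: "real poly poly \<Rightarrow> (real \<times> real) set" where
  "polar_curve F = {p. plane_poly (pderiv F) p = 0}"

text \<open>
  A half-branch issuing from the origin is a half-open arc starting at the origin, deprived
  of the origin.  The homeomorphism on \<open>[0, 1)\<close> prevents the free end from coming back to
  the origin.
\<close>

definition half_branch :: "(real \<times> real) set \<Rightarrow> bool" where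
  "half_branch B \<longleftrightarrow>
     (0, 0) \<notin> B \<and>
     (\<exists>h k. homeomorphism {0..<1::real} (insert (0, 0) B) h k \<and> h 0 = (0, 0))"

definition polar_half_branches ::
    "real poly poly \<Rightarrow> (real \<times> real) set \<Rightarrow> (real \<times> real) set set \<Rightarrow> bool" where
  "polar_half_branches F V H \<longleftrightarrow>
     finite H \<and> disjoint H \<and> (\<forall>B\<in>H. half_branch B) \<and>
     \<Union>H = polar_curve F \<inter> V - {(0, 0)}"

definition right_half_branches :: "(real \<times> real) set set \<Rightarrow> (real \<times> real) set set" where
  "right_half_branches H = {B \<in> H. \<forall>p\<in>B. 0 < fst p}"

text \<open>
  Counterclockwise order of half-branches in \<open>x > 0\<close>, read off on all small circles around
  the origin.  In this half-plane \<^const>\<open>Arg\<close> takes values in \<open>(-\<pi>/2, \<pi>/2)\<close>.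
\<close>

definition trig_less :: "(real \<times> real) set \<Rightarrow> (real \<times> real) set \<Rightarrow> bool" where
  "trig_less A B \<longleftrightarrow>
     (\<exists>\<rho>0>0. \<forall>\<rho>\<in>{0<..<\<rho>0}. \<forall>p \<in> A \<inter> sphere (0, 0) \<rho>. \<forall>q \<in> B \<inter> sphere (0, 0) \<rho>.
        Arg (Complex (fst p) (snd p)) < Arg (Complex (fst q) (snd q)))"

definition right_crest :: "(real \<times> real) set \<Rightarrow> real \<times> real \<Rightarrow> bool" where
  "right_crest C p \<longleftrightarrow> p \<in> C \<and> 0 < fst p \<and>
     (\<exists>U. open U \<and> p \<in> U \<and> (\<forall>q \<in> C \<inter> U - {p}. fst p < fst q))"

definition right_valley :: "(real \<times> real) set \<Rightarrow> real \<times> real \<Rightarrow> bool" where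
  "right_valley C p \<longleftrightarrow> p \<in> C \<and> 0 < fst p \<and>
     (\<exists>U. open U \<and> p \<in> U \<and> (\<forall>q \<in> C \<inter> U - {p}. fst q < fst p))"

definition position :: "('a \<times> 'a) set \<Rightarrow> 'a set \<Rightarrow> 'a \<Rightarrow> nat" where
  "position r S a = card {b \<in> S. (b, a) \<in> r} + 1"

definition associated_permutation ::
    "'a set \<Rightarrow> ('a \<times> 'a) set \<Rightarrow> ('a \<times> 'a) set \<Rightarrow> (nat \<Rightarrow> nat) \<Rightarrow> bool" where
  "associated_permutation S r1 r2 \<sigma> \<longleftrightarrow>
     finite S \<and> strict_linear_order_on S r1 \<and> strict_linear_order_on S r2 \<and>
     \<sigma> permutes {1..card S} \<and>
     (\<forall>a\<in>S. \<sigma> (position r1 S a) = position r2 S a)"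

definition right_to_left :: "(real \<times> real) set \<Rightarrow> ((real \<times> real) \<times> (real \<times> real)) set" where
  "right_to_left S = {(p, q). p \<in> S \<and> q \<in> S \<and> fst p > fst q}"

definition up_down :: "nat \<Rightarrow> (nat \<Rightarrow> nat) \<Rightarrow> bool" where
  "up_down n \<sigma> \<longleftrightarrow>
     (\<forall>i. 1 \<le> i \<and> i < n \<longrightarrow> (if odd i then \<sigma> i < \<sigma> (i + 1) else \<sigma> i > \<sigma> (i + 1)))"

definition down_up :: "nat \<Rightarrow> (nat \<Rightarrow> nat) \<Rightarrow> bool" where
  "down_up n \<sigma> \<longleftrightarrow>
     (\<forall>i. 1 \<le> i \<and> i < n \<longrightarrow> (if odd i then \<sigma> i > \<sigma> (i + 1) else \<sigma> i < \<sigma> (i + 1)))"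

definition snake :: "nat \<Rightarrow> (nat \<Rightarrow> nat) \<Rightarrow> bool" where
  "snake n \<sigma> \<longleftrightarrow> \<sigma> permutes {1..n} \<and> (up_down n \<sigma> \<or> down_up n \<sigma>)"

end

theory Submission
  imports Defs "HOL-Computational_Algebra.Field_as_Ring"
begin

text \<open>
  Subscripts denote partial derivatives.  Over a short interval \<open>0 < x \<le> a\<close> the polar curve
  \<open>f\<^sub>y = 0\<close> consists of the graphs of finitely many continuous functions
  \<open>\<phi>\<^sub>1 < \<dots> < \<phi>\<^sub>n\<close> that tend to \<open>0\<close> with \<open>x\<close>, and likewise over \<open>-a \<le> x < 0\<close>.  Two facts
  about a squarefree \<open>f\<^sub>y\<close> replace the use of Puiseux series.  Bezout's identity over the field of
  rational functions in \<open>x\<close>, cleared of denominators (\<open>bezout_up_to_x\<close>), shows that \<open>f\<^sub>y\<close> and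
  \<open>f\<^sub>y\<^sub>y\<close> have no common zero with small \<open>x \<noteq> 0\<close>; so the roots of \<open>f\<^sub>y(x, \<cdot>)\<close> are simple and
  move continuously with \<open>x\<close> (\<open>root_branches\<close>).  And any further polynomial either vanishes
  identically along a branch or has no zero on it near the origin
  (\<open>squarefree_branch_dichotomy\<close>).  For \<open>f\<^sub>x\<close> the first alternative would make \<open>f\<close> constant
  along the branch, so \<open>f\<close> is strictly increasing along every branch; for \<open>x f\<^sub>y\<^sub>y - y f\<^sub>x\<^sub>y\<close> the
  same argument shows that the distance to the origin is strictly increasing
  (\<open>polar_side_exists\<close>).

  The second monotonicity describes the polar curve in small discs: every branch enters as one
  arc, and on each circle the arcs follow the order of the \<open>\<phi>\<^sub>i\<close> (\<open>trig_less_arc\<close>).  The first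
  one describes the small levels of \<open>f\<close>.  The origin is the only critical point nearby, and from
  a point with \<open>f \<le> \<epsilon>\<close> one reaches the origin inside \<open>f \<le> \<epsilon>\<close> by moving vertically to the polar
  curve and then along a branch.  So in a small box the level region is \<open>f \<le> \<epsilon>\<close>, the level
  curve \<open>C\<close> is \<open>f = \<epsilon>\<close>, and \<open>C\<close> meets the \<open>i\<close>-th right branch in one point
  \<open>P\<^sub>i = (x\<^sub>i, \<phi>\<^sub>i(x\<^sub>i))\<close>.  These points are the right crests and valleys because there \<open>f\<^sub>y = 0\<close>,
  \<open>f\<^sub>x > 0\<close> and \<open>f\<^sub>y\<^sub>y \<noteq> 0\<close> (\<open>extremal_points\<close>).

  The snake comes from alternating signs.  On the lower side of the box \<open>f\<^sub>y < 0\<close>, on the upper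
  side \<open>f\<^sub>y > 0\<close>, and \<open>f\<^sub>y\<close> changes sign at each of its simple roots in between.  Hence \<open>n\<close> is odd,
  and \<open>f\<^sub>y\<close> is positive between \<open>\<phi>\<^sub>i\<close> and \<open>\<phi>\<^sub>i\<^sub>+\<^sub>1\<close> for odd \<open>i\<close> and negative for even \<open>i\<close>.  For odd \<open>i\<close>
  the value of \<open>f\<close> on the branch \<open>i + 1\<close> at \<open>x = x\<^sub>i\<close> thus exceeds \<open>\<epsilon>\<close>, and monotonicity along
  that branch gives \<open>x\<^sub>i\<^sub>+\<^sub>1 < x\<^sub>i\<close>; for even \<open>i\<close> the inequality is reversed
  (\<open>neighbouring_abscissae\<close>).  Reading abscissae from right to left turns this into
  \<open>\<sigma>(1) < \<sigma>(2) > \<sigma>(3) < \<dots>\<close>.  Genericity makes the abscissae of all the \<open>P\<^sub>i\<close> distinct, since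
  \<open>C\<close> has a vertical tangent at each of them.
\<close>

section \<open>Polynomials as functions on the plane\<close>

lemma plane_poly_0 [simp]: "plane_poly 0 p = 0"
  by (cases p) (simp add: plane_poly_def)

lemma plane_poly_pCons: "plane_poly (pCons c P) (x, y) = poly c x + y * plane_poly P (x, y)"
  by (simp add: plane_poly_def)

lemma plane_poly_const: "plane_poly [:c:] (x, y) = poly c x"
  by (simp add: plane_poly_def)

lemma plane_poly_add: "plane_poly (P + Q) p = plane_poly P p + plane_poly Q p"
  by (cases p) (simp add: plane_poly_def)

lemma plane_poly_diff: "plane_poly (P - Q) p = plane_poly P p - plane_poly Q p"
  by (cases p) (simp add: plane_poly_def)

lemma plane_poly_mult: "plane_poly (P * Q) p = plane_poly P p * plane_poly Q p"
  by (cases p) (simp add: plane_poly_def)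

lemma plane_poly_smult: "plane_poly (smult c P) (x, y) = poly c x * plane_poly P (x, y)"
  by (simp add: plane_poly_def)

lemma continuous_on_plane_poly: "continuous_on S (plane_poly P)"
proof (induction P)
  case 0
  then show ?case by (simp add: plane_poly_def case_prod_unfold)
next
  case (pCons c P)
  have "plane_poly (pCons c P) = (\<lambda>p. poly c (fst p) + snd p * plane_poly P p)"
    by (auto simp: plane_poly_pCons)
  with pCons show ?case
    by (auto intro!: continuous_intros)
qed

lemma continuous_on_plane_poly_compose [continuous_intros]:
  assumes "continuous_on S X" "continuous_on S Y"
  shows "continuous_on S (\<lambda>t. plane_poly P (X t, Y t))"
  by (rule continuous_on_compose2[OF continuous_on_plane_poly[of UNIV]])
    (auto intro!: continuous_intros assms)

abbreviation pderiv_x :: "real poly poly \<Rightarrow> real poly poly" where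
  "pderiv_x \<equiv> map_poly pderiv"

text \<open>
  With \<open>Y\<close> constant this is the partial derivative in \<open>x\<close>; in general it differentiates along a
  branch of the polar curve.
\<close>
lemma plane_poly_chain:
  assumes X: "(X has_real_derivative X') (at t)" and Y: "(Y has_real_derivative Y') (at t)"
  shows "((\<lambda>t. plane_poly P (X t, Y t)) has_real_derivative
           plane_poly (pderiv_x P) (X t, Y t) * X' + plane_poly (pderiv P) (X t, Y t) * Y') (at t)"
proof (induction P)
  case 0
  then show ?case by simp
next
  case (pCons c P)
  have c: "((\<lambda>t. poly c (X t)) has_real_derivative poly (pderiv c) (X t) * X') (at t)"
    by (rule DERIV_chain2[OF poly_DERIV X])
  have "((\<lambda>t. poly c (X t) + Y t * plane_poly P (X t, Y t)) has_real_derivative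
     poly (pderiv c) (X t) * X' + (Y' * plane_poly P (X t, Y t) +
     (plane_poly (pderiv_x P) (X t, Y t) * X' + plane_poly (pderiv P) (X t, Y t) * Y') * Y t)) (at t)"
    by (intro DERIV_add DERIV_mult c Y pCons.IH)
  moreover have "map_poly pderiv (pCons c P) = pCons (pderiv c) (map_poly pderiv P)"
    by (simp add: map_poly_pCons)
  ultimately show ?case
    by (simp add: plane_poly_pCons pderiv_pCons plane_poly_add algebra_simps)
qed

lemma plane_poly_partial_x:
  "((\<lambda>t. plane_poly P (t, y)) has_real_derivative plane_poly (pderiv_x P) (x, y)) (at x)"
  using plane_poly_chain[of "\<lambda>t. t" 1 x "\<lambda>_. y" 0 P] by simp

lemma finite_vertical_roots:
  assumes "plane_poly P (x, y0) \<noteq> 0"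
  shows "finite {y. plane_poly P (x, y) = 0}"
proof -
  define q where "q = map_poly (\<lambda>c. poly c x) P"
  have q: "poly q y = plane_poly P (x, y)" for y
    unfolding q_def by (induction P) (auto simp: map_poly_pCons plane_poly_pCons)
  then have "q \<noteq> 0" using assms by (metis poly_0)
  with poly_roots_finite[OF this] show ?thesis by (simp add: q)
qed

lemma finite_avoided_near_0:
  assumes "finite (S :: real set)"
  shows "\<exists>\<delta>>0. \<forall>x. 0 < \<bar>x\<bar> \<and> \<bar>x\<bar> < \<delta> \<longrightarrow> x \<notin> S"
proof -
  have "\<not> 0 islimpt S" using assms by (simp add: islimpt_finite)
  then obtain \<delta> where "\<delta> > 0" "\<And>x. x \<in> S \<Longrightarrow> x \<noteq> 0 \<Longrightarrow> \<not> \<bar>x\<bar> < \<delta>"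
    unfolding islimpt_approachable by (auto simp: dist_real_def)
  then show ?thesis by (intro exI[of _ \<delta>]) auto
qed

section \<open>Common zeros near the vertical axis\<close>

text \<open>
  A prime factor of the primitive part of \<open>d\<close> has positive degree in \<open>y\<close>: one of degree \<open>0\<close> would
  divide the content, which is \<open>1\<close>.
\<close>
lemma prime_factor_of_positive_degree:
  fixes d :: "real poly poly"
  assumes "degree d > 0"
  obtains \<pi> where "prime_elem \<pi>" "degree \<pi> > 0" "\<pi> dvd d"
proof -
  let ?h = "primitive_part d"
  have d0: "d \<noteq> 0" using assms by auto
  have deg: "degree ?h > 0" using assms by simp
  then have "?h \<noteq> 0" "\<not> is_unit ?h"
    by (force, metis degree_pCons_0 is_unit_poly_iff less_irrefl)
  then obtain \<pi> where \<pi>: "\<pi> dvd ?h" "prime \<pi>" using prime_divisor_exists by blast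
  have "degree \<pi> > 0"
  proof (rule ccontr)
    assume "\<not> ?thesis"
    then obtain c where c: "\<pi> = [:c:]" by (metis gr0I degree_eq_zeroE)
    with \<pi> have "c dvd content ?h" by (simp add: const_poly_dvd_iff_dvd_content)
    then have "is_unit c" using d0 by simp
    with c have "is_unit \<pi>" using is_unit_poly_iff by blast
    with \<pi>(2) show False using not_prime_unit by blast
  qed
  moreover have "?h dvd d" by (metis content_times_primitive_part dvd_smult dvd_refl)
  ultimately show ?thesis using that \<pi> by (meson dvd_trans prime_imp_prime_elem)
qed

text \<open>
  Primes of degree \<open>0\<close> in \<open>y\<close> are excluded: their zeros form vertical lines, which avoid a strip
  \<open>0 < \<bar>x\<bar> < \<delta>\<close>.
\<close>
definition no_common_component :: "real poly poly \<Rightarrow> real poly poly \<Rightarrow> bool" where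
  "no_common_component p q \<longleftrightarrow>
     (\<forall>\<pi>. prime_elem \<pi> \<and> degree \<pi> > 0 \<and> \<pi> dvd p \<longrightarrow> \<not> \<pi> dvd q)"

text \<open>
  In the ideal generated by \<open>p\<close> and \<open>q\<close> take \<open>d \<noteq> 0\<close> of minimal degree in \<open>y\<close>.  By
  pseudo-division \<open>d\<close> divides \<open>p\<close> and \<open>q\<close> up to factors in \<open>x\<close> alone, so a prime factor of \<open>d\<close> of
  positive degree would be a common component.  Hence \<open>d\<close> has degree \<open>0\<close>.
\<close>
lemma bezout_up_to_x:
  fixes p q :: "real poly poly"
  assumes coprime: "no_common_component p q"
    and nz: "p \<noteq> 0 \<or> q \<noteq> 0"
  obtains A B c where "c \<noteq> 0" "A * p + B * q = [:c:]"
proof -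
  define I where "I = {d. d \<noteq> 0 \<and> (\<exists>A B. d = A * p + B * q)}"
  have "p = 1 * p + 0 * q" "q = 0 * p + 1 * q" by simp_all
  with nz have "\<exists>d. d \<in> I" unfolding I_def by blast
  then obtain d where d: "d \<in> I" and min: "\<And>e. e \<in> I \<Longrightarrow> degree d \<le> degree e"
    using ex_has_least_nat[of "\<lambda>d. d \<in> I" _ degree] by blast
  have d0: "d \<noteq> 0" using d by (simp add: I_def)
  obtain A B where AB: "d = A * p + B * q" using d by (auto simp: I_def)
  have dvd: "\<exists>c. c \<noteq> 0 \<and> d dvd [:c:] * (A' * p + B' * q)" for A' B'
  proof -
    let ?e = "A' * p + B' * q"
    obtain k r where kr: "pseudo_divmod ?e d = (k, r)" by fastforce
    define c where "c = lead_coeff d ^ (Suc (degree ?e) - degree d)"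
    have c0: "c \<noteq> 0" using d0 by (simp add: c_def)
    have eq: "smult c ?e = d * k + r" and r: "r = 0 \<or> degree r < degree d"
      using pseudo_divmod[OF d0 kr] by (auto simp: c_def)
    have "r = [:c:] * ?e - d * k" using eq by simp
    also have "\<dots> = ([:c:] * A' - A * k) * p + ([:c:] * B' - B * k) * q"
      by (subst AB) algebra
    finally have "r = 0 \<or> r \<in> I" by (auto simp: I_def)
    with r min[of r] have "r = 0" by force
    with eq have "[:c:] * ?e = d * k" by simp
    with c0 show ?thesis by (metis dvd_triv_left)
  qed
  have "degree d = 0"
  proof (rule ccontr)
    assume "degree d \<noteq> 0"
    then obtain \<pi> where \<pi>: "prime_elem \<pi>" "degree \<pi> > 0" "\<pi> dvd d"
      using prime_factor_of_positive_degree by blast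
    have "\<pi> dvd A' * p + B' * q" for A' B'
    proof -
      obtain c where c: "c \<noteq> 0" "d dvd [:c:] * (A' * p + B' * q)" using dvd by blast
      have "\<not> \<pi> dvd [:c:]" using c(1) \<pi>(2) dvd_imp_degree_le[of \<pi> "[:c:]"] by auto
      with c(2) \<pi> show ?thesis by (meson dvd_trans prime_elem_dvd_multD)
    qed
    from this[of 1 0] this[of 0 1] \<pi>(1,2) coprime show False
      by (simp add: no_common_component_def)
  qed
  then obtain c where "d = [:c:]" by (elim degree_eq_zeroE)
  with d0 AB show ?thesis by (intro that[of c A B]) auto
qed

text \<open>
  By Bezout's identity the abscissa of a common zero is a root of one fixed nonzero polynomial in
  \<open>x\<close>.
\<close>
lemma no_common_zeros_near_axis:
  assumes "no_common_component p q" and "p \<noteq> 0 \<or> q \<noteq> 0"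
  shows "\<exists>\<delta>>0. \<forall>x y. 0 < \<bar>x\<bar> \<and> \<bar>x\<bar> < \<delta> \<and> plane_poly p (x, y) = 0 \<longrightarrow> plane_poly q (x, y) \<noteq> 0"
proof -
  obtain A B c where c: "c \<noteq> 0" "A * p + B * q = [:c:]" by (rule bezout_up_to_x[OF assms])
  obtain \<delta> where \<delta>: "\<delta> > 0" "\<And>x. 0 < \<bar>x\<bar> \<Longrightarrow> \<bar>x\<bar> < \<delta> \<Longrightarrow> poly c x \<noteq> 0"
    using finite_avoided_near_0[OF poly_roots_finite[OF c(1)]] by auto
  have "poly c x = plane_poly A (x, y) * plane_poly p (x, y) + plane_poly B (x, y) * plane_poly q (x, y)"
    for x y
    using arg_cong[OF c(2), of "\<lambda>P. plane_poly P (x, y)"]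
    by (simp add: plane_poly_add plane_poly_mult plane_poly_const)
  with \<delta> show ?thesis by (intro exI[of _ \<delta>]) (metis add.right_neutral mult_zero_right)
qed

lemma squarefree_prime_sq:
  assumes "squarefree (G::real poly poly)" "prime_elem \<pi>" "\<pi> * \<pi> dvd G"
  shows False
proof -
  have "\<pi> ^ 2 dvd G" using assms(3) by (simp add: power2_eq_square)
  then have "\<pi> dvd 1" using assms(1) unfolding squarefree_def by blast
  with assms(2) show False by (simp add: prime_elem_def)
qed

text \<open>
  If a prime \<open>\<pi>\<close> divides \<open>G = \<pi> k\<close> and its derivative in \<open>y\<close>, then it divides \<open>\<pi>' k\<close> and,
  having larger degree than \<open>\<pi>'\<close>, it divides \<open>k\<close>; so \<open>\<pi>\<^sup>2\<close> divides \<open>G\<close>.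
\<close>
lemma squarefree_simple_roots_near_axis:
  assumes sf: "squarefree G"
  shows "\<exists>\<delta>>0. \<forall>x y. 0 < \<bar>x\<bar> \<and> \<bar>x\<bar> < \<delta> \<and> plane_poly G (x, y) = 0 \<longrightarrow> plane_poly (pderiv G) (x, y) \<noteq> 0"
proof -
  have "G \<noteq> 0" using sf by auto
  have False if \<pi>: "prime_elem \<pi>" "degree \<pi> > 0" "\<pi> dvd G" "\<pi> dvd pderiv G" for \<pi>
proof -
  obtain k where k: "G = \<pi> * k" using \<pi>(3) by blast
  have "\<pi> dvd \<pi> * pderiv k + pderiv \<pi> * k" using \<pi>(4) by (simp add: k pderiv_mult mult.commute)
  then have "\<pi> dvd pderiv \<pi> * k" by (simp add: dvd_add_right_iff)
  moreover have "\<not> \<pi> dvd pderiv \<pi>"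
    using \<pi>(2) dvd_imp_degree_le[of \<pi> "pderiv \<pi>"] by (auto simp: degree_pderiv pderiv_eq_0_iff)
  ultimately have "\<pi> dvd k" using \<pi>(1) prime_elem_dvd_multD by blast
  then have "\<pi> * \<pi> dvd G" unfolding k by (rule mult_dvd_mono[OF dvd_refl])
  with sf \<pi>(1) show False by (rule squarefree_prime_sq)
qed
  then have "no_common_component G (pderiv G)" by (auto simp: no_common_component_def)
  then show ?thesis using no_common_zeros_near_axis \<open>G \<noteq> 0\<close> by blast
qed

text \<open>
  Write \<open>G = d e\<close> with \<open>d = gcd G K\<close>.  As \<open>G\<close> is squarefree, neither \<open>d\<close> and \<open>e\<close> nor \<open>e\<close> and \<open>K\<close>
  have a common component, so off the axis \<open>x = 0\<close> neither pair has common zeros nearby.  A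
  connected branch of \<open>G = 0\<close> therefore lies in \<open>d = 0\<close>, where \<open>K\<close> vanishes, or in \<open>e = 0\<close>, where
  \<open>K\<close> has no zero.
\<close>
lemma squarefree_branch_dichotomy:
  assumes sf: "squarefree G"
  shows "\<exists>\<delta>>0. \<forall>X \<phi> (I :: real set).
     connected I \<and> continuous_on I X \<and> continuous_on I \<phi> \<and>
     (\<forall>t\<in>I. 0 < \<bar>X t\<bar> \<and> \<bar>X t\<bar> < \<delta> \<and> plane_poly G (X t, \<phi> t) = 0) \<longrightarrow>
     (\<forall>t\<in>I. plane_poly K (X t, \<phi> t) = 0) \<or> (\<forall>t\<in>I. plane_poly K (X t, \<phi> t) \<noteq> 0)"
proof -
  define d where "d = gcd G K"
  obtain e where e: "G = d * e" by (metis d_def gcd_dvd1 dvdE)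
  obtain k where k: "K = d * k" by (metis d_def gcd_dvd2 dvdE)
  have "G \<noteq> 0" using sf by auto
  then have nz: "d \<noteq> 0" "e \<noteq> 0" using e by auto
  have de: False if "prime_elem \<pi>" "\<pi> dvd d" "\<pi> dvd e" for \<pi>
    using squarefree_prime_sq[OF sf that(1)] mult_dvd_mono[OF that(2,3)] e by auto
  have eK: False if "prime_elem \<pi>" "\<pi> dvd e" "\<pi> dvd K" for \<pi>
  proof -
    have "\<pi> dvd G" using that e by auto
    with that have "\<pi> dvd d" by (simp add: d_def)
    with de that show False by blast
  qed
  have "no_common_component d e" "no_common_component e K"
    using de eK by (auto simp: no_common_component_def)
  note ncz = no_common_zeros_near_axis[OF this(1)] no_common_zeros_near_axis[OF this(2)]
  obtain \<delta>1 where \<delta>1: "\<delta>1 > 0"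
    "\<And>x y. 0 < \<bar>x\<bar> \<Longrightarrow> \<bar>x\<bar> < \<delta>1 \<Longrightarrow> plane_poly d (x, y) = 0 \<Longrightarrow> plane_poly e (x, y) \<noteq> 0"
    using ncz(1) nz by blast
  obtain \<delta>2 where \<delta>2: "\<delta>2 > 0"
    "\<And>x y. 0 < \<bar>x\<bar> \<Longrightarrow> \<bar>x\<bar> < \<delta>2 \<Longrightarrow> plane_poly e (x, y) = 0 \<Longrightarrow> plane_poly K (x, y) \<noteq> 0"
    using ncz(2) nz by blast
  show ?thesis
  proof (intro exI[of _ "min \<delta>1 \<delta>2"] conjI allI impI)
    show "min \<delta>1 \<delta>2 > 0" using \<delta>1 \<delta>2 by simp
    fix X \<phi> :: "real \<Rightarrow> real" and I
    assume *: "connected I \<and> continuous_on I X \<and> continuous_on I \<phi> \<and>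
      (\<forall>t\<in>I. 0 < \<bar>X t\<bar> \<and> \<bar>X t\<bar> < min \<delta>1 \<delta>2 \<and> plane_poly G (X t, \<phi> t) = 0)"
    then have I: "connected I" "continuous_on I X" "continuous_on I \<phi>"
      and G: "\<And>t. t \<in> I \<Longrightarrow> 0 < \<bar>X t\<bar> \<and> \<bar>X t\<bar> < min \<delta>1 \<delta>2 \<and> plane_poly G (X t, \<phi> t) = 0"
      by blast+
    define D where "D = {t \<in> I. plane_poly d (X t, \<phi> t) = 0}"
    define E where "E = {t \<in> I. plane_poly e (X t, \<phi> t) = 0}"
    have cont: "continuous_on I (\<lambda>t. plane_poly P (X t, \<phi> t))" for P
      by (intro continuous_intros I)
    have "closedin (top_of_set I) D" "closedin (top_of_set I) E"
      unfolding D_def E_def by (intro continuous_closedin_preimage_constant cont)+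
    moreover have "I \<subseteq> D \<union> E"
      using G by (auto simp: D_def E_def e plane_poly_mult)
    moreover have "D \<inter> E = {}" using G \<delta>1 by (auto simp: D_def E_def)
    ultimately have "D = {} \<or> E = {}"
      using I(1) unfolding connected_closedin by blast
    then show "(\<forall>t\<in>I. plane_poly K (X t, \<phi> t) = 0) \<or> (\<forall>t\<in>I. plane_poly K (X t, \<phi> t) \<noteq> 0)"
    proof
      assume "D = {}"
      with \<open>I \<subseteq> D \<union> E\<close> G \<delta>2 show ?thesis by (auto simp: E_def)
    next
      assume "E = {}"
      with \<open>I \<subseteq> D \<union> E\<close> show ?thesis by (auto simp: D_def k plane_poly_mult)
    qed
  qed
qed

section \<open>Positions in a finite linear order\<close>

lemma position_less:
  assumes "finite S" "strict_linear_order_on S r" "a \<in> S" "(a, b) \<in> r"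
  shows "position r S a < position r S b"
proof -
  have "trans r" "irrefl r" using assms(2) by (auto simp: strict_linear_order_on_def)
  then have "{c \<in> S. (c, a) \<in> r} \<subset> {c \<in> S. (c, b) \<in> r}"
    using assms(3,4) by (auto simp: irrefl_def dest: transD)
  then have "card {c \<in> S. (c, a) \<in> r} < card {c \<in> S. (c, b) \<in> r}"
    using assms(1) by (intro psubset_card_mono) auto
  then show ?thesis by (simp add: position_def)
qed

lemma position_less_iff:
  assumes "finite S" "strict_linear_order_on S r" "a \<in> S" "b \<in> S"
  shows "position r S a < position r S b \<longleftrightarrow> (a, b) \<in> r"
proof -
  have "a = b \<or> (a, b) \<in> r \<or> (b, a) \<in> r"
    using assms(2-4) by (auto simp: strict_linear_order_on_def total_on_def)
  then show ?thesis
    using position_less[OF assms(1,2,3), of b] position_less[OF assms(1,2,4), of a] assms(2)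
    by (auto simp: strict_linear_order_on_def irrefl_def)
qed

lemma bij_betw_position:
  assumes "finite S" "strict_linear_order_on S r"
  shows "bij_betw (position r S) S {1..card S}"
proof -
  have inj: "inj_on (position r S) S"
  proof (rule inj_onI)
    fix a b assume ab: "a \<in> S" "b \<in> S" "position r S a = position r S b"
    have "a = b \<or> (a, b) \<in> r \<or> (b, a) \<in> r"
      using assms(2) ab by (auto simp: strict_linear_order_on_def total_on_def)
    with ab show "a = b"
      using position_less[OF assms ab(1), of b] position_less[OF assms ab(2), of a] by auto
  qed
  have "position r S ` S \<subseteq> {1..card S}"
  proof (clarify, simp, intro conjI)
    fix a assume a: "a \<in> S"
    show "Suc 0 \<le> position r S a" by (simp add: position_def)
    have "{b \<in> S. (b, a) \<in> r} \<subset> S"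
      using a assms(2) by (auto simp: strict_linear_order_on_def irrefl_def)
    with assms(1) have "card {b \<in> S. (b, a) \<in> r} < card S" by (rule psubset_card_mono)
    then show "position r S a \<le> card S" by (simp add: position_def)
  qed
  then have "position r S ` S = {1..card S}"
    by (intro card_subset_eq) (simp_all add: card_image[OF inj])
  with inj show ?thesis by (simp add: bij_betw_def)
qed

lemma strict_linear_order_on_less: "strict_linear_order_on S {(a, b). a < (b::'a::linorder)}"
  by (auto simp: strict_linear_order_on_def trans_def irrefl_def total_on_def)

section \<open>Continuous dependence of simple roots\<close>

lemma nonzero_tube:
  fixes g :: "real \<Rightarrow> real \<Rightarrow> real"
  assumes "continuous_on UNIV (\<lambda>(x, y). g x y)" "compact K" "\<And>u. u \<in> K \<Longrightarrow> g x0 u \<noteq> 0"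
  shows "\<forall>\<^sub>F x in nhds x0. \<forall>u\<in>K. g x u \<noteq> 0"
proof -
  let ?W = "(\<lambda>(x, y). g x y) -` (- {0})"
  have "open ?W" by (rule open_vimage[OF _ assms(1)]) auto
  moreover have "{x0} \<times> K \<subseteq> ?W" using assms(3) by auto
  ultimately obtain X where "x0 \<in> X" "open X" "X \<times> K \<subseteq> ?W"
    using Elementary_Topology.tube_lemma[OF assms(2), of ?W x0] by blast
  then show ?thesis unfolding eventually_nhds by (intro exI[of _ X]) force
qed

text \<open>
  A continuously differentiable function of two variables together with its partial derivatives.
  The instances below are polynomials, possibly reflected in the vertical axis or with the two
  coordinates interchanged.
\<close>
locale plane_function =
  fixes g gx gy :: "real \<Rightarrow> real \<Rightarrow> real"
  assumes has_gx: "((\<lambda>x. g x y) has_real_derivative gx x y) (at x)"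
    and has_gy: "((\<lambda>y. g x y) has_real_derivative gy x y) (at y)"
    and cont_g: "continuous_on UNIV (\<lambda>(x, y). g x y)"
    and cont_gx: "continuous_on UNIV (\<lambda>(x, y). gx x y)"
    and cont_gy: "continuous_on UNIV (\<lambda>(x, y). gy x y)"
begin

lemma isCont_slice_x: "isCont (\<lambda>x. g x y) x"
  using has_gx by (rule DERIV_isCont)

lemma continuous_on_slice_y: "continuous_on S (\<lambda>y. g x y)"
  by (meson DERIV_isCont has_gy continuous_at_imp_continuous_on)

text \<open>
  Near a simple root \<open>g x0\<close> is strictly monotone and takes values of opposite signs at \<open>y0 - h\<close>
  and \<open>y0 + h\<close>; both properties survive a small change of \<open>x0\<close>.  Every small \<open>h\<close> is allowed, so
  that finitely many roots can be treated with a common \<open>h\<close>.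
\<close>
lemma persistent_simple_root:
  assumes "g x0 y0 = 0" "gy x0 y0 \<noteq> 0"
  shows "\<forall>\<^sub>F h in at_right 0. \<forall>\<^sub>F x in nhds x0.
    \<exists>u. y0 - h < u \<and> u < y0 + h \<and> g x u = 0 \<and> (\<forall>v. y0 - h \<le> v \<and> v \<le> y0 + h \<and> g x v = 0 \<longrightarrow> v = u)"
proof -
  define s where "s = sgn (gy x0 y0)"
  have s: "s * gy x0 y0 > 0" "s \<noteq> 0" using assms(2) by (auto simp: s_def sgn_if)
  have "open ((\<lambda>(x, y). s * gy x y) -` {0<..})"
    by (rule open_vimage) (use cont_gy in \<open>auto intro!: continuous_intros simp: case_prod_unfold\<close>)
  then have "\<forall>\<^sub>F p in nhds (x0, y0). 0 < s * gy (fst p) (snd p)"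
    using s by (auto simp: eventually_nhds case_prod_unfold)
  then have "\<forall>\<^sub>F p in nhds x0 \<times>\<^sub>F nhds y0. 0 < s * gy (fst p) (snd p)" by (simp add: nhds_prod)
  then obtain Px Py where P: "eventually Px (nhds x0)" "eventually Py (nhds y0)"
    "\<And>x y. Px x \<Longrightarrow> Py y \<Longrightarrow> 0 < s * gy x y"
    by (auto simp: eventually_prod_filter)
  obtain h0 where h0: "h0 > 0" "\<And>y. \<bar>y - y0\<bar> < h0 \<Longrightarrow> Py y"
    using P(2) by (auto simp: eventually_nhds_metric dist_real_def)
  have "\<forall>\<^sub>F x in nhds x0. \<exists>u. y0 - h < u \<and> u < y0 + h \<and> g x u = 0 \<and>
      (\<forall>v. y0 - h \<le> v \<and> v \<le> y0 + h \<and> g x v = 0 \<longrightarrow> v = u)" if h: "0 < h" "h < h0" for h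
  proof -
    have mono: "s * g x u < s * g x v" if "Px x" "y0 - h \<le> u" "u < v" "v \<le> y0 + h" for x u v
      using that(3)
    proof (rule DERIV_pos_imp_increasing)
      fix y assume "u \<le> y" "y \<le> v"
      then have "Py y" using that h by (intro h0(2)) auto
      then show "\<exists>D. ((\<lambda>y. s * g x y) has_real_derivative D) (at y) \<and> D > 0"
        using P(3) that(1) by (intro exI[of _ "s * gy x y"]) (auto intro: DERIV_cmult has_gy)
    qed
    have "Px x0" using P(1) eventually_nhds_x_imp_x by blast
    from mono[OF this, of "y0 - h" y0] mono[OF this, of y0 "y0 + h"] h assms(1)
    have neg: "s * g x0 (y0 - h) < 0" and pos: "0 < s * g x0 (y0 + h)" by auto
    have lim: "((\<lambda>x. s * g x y) \<longlongrightarrow> s * g x0 y) (nhds x0)" for y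
      using isCont_slice_x[where x = x0 and y = y]
      by (intro tendsto_intros) (simp add: isCont_def tendsto_nhds_iff)
    have "\<forall>\<^sub>F x in nhds x0. s * g x (y0 - h) < 0" "\<forall>\<^sub>F x in nhds x0. 0 < s * g x (y0 + h)"
      using order_tendstoD(2)[OF lim neg] order_tendstoD(1)[OF lim pos] by auto
    with P(1) show ?thesis
    proof eventually_elim
      case (elim x)
      have "\<exists>u. y0 - h \<le> u \<and> u \<le> y0 + h \<and> s * g x u = 0"
        using elim h by (intro IVT') (auto intro!: continuous_intros continuous_on_slice_y)
      then obtain u where u: "y0 - h \<le> u" "u \<le> y0 + h" "s * g x u = 0" by blast
      then have "y0 - h < u" "u < y0 + h" using elim by (auto simp: less_le)
      moreover have "v = u" if "y0 - h \<le> v" "v \<le> y0 + h" "g x v = 0" for v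
        using mono[OF elim(1), of u v] mono[OF elim(1), of v u] that u by force
      moreover have "g x u = 0" using u(3) s(2) by simp
      ultimately show ?case by blast
    qed
  qed
  then show ?thesis using h0(1) by (auto simp: eventually_at_right_field)
qed

definition zeros :: "real \<Rightarrow> real \<Rightarrow> real \<Rightarrow> real set" where
  "zeros c d x = {y \<in> {c..d}. g x y = 0}"

text \<open>
  Near each root of \<open>g x0\<close> there is exactly one root of \<open>g x\<close>.  The rest of the interval is a
  compact set without roots of \<open>g x0\<close>, hence without roots of \<open>g x\<close> for \<open>x\<close> near \<open>x0\<close>.
\<close>
lemma zeros_move_continuously:
  assumes fin: "finite (zeros c d x0)"
    and simple: "\<And>y. y \<in> zeros c d x0 \<Longrightarrow> gy x0 y \<noteq> 0"
    and ends: "g x0 c \<noteq> 0" "g x0 d \<noteq> 0"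
    and \<eta>: "\<eta> > 0"
  shows "\<forall>\<^sub>F x in nhds x0. \<exists>m. bij_betw m (zeros c d x0) (zeros c d x) \<and>
     (\<forall>y\<in>zeros c d x0. \<forall>y'\<in>zeros c d x0. y < y' \<longrightarrow> m y < m y') \<and>
     (\<forall>y\<in>zeros c d x0. \<bar>m y - y\<bar> < \<eta>)"
proof -
  let ?Z = "zeros c d x0"
  have 1: "\<forall>\<^sub>F h in at_right 0. \<forall>y\<in>?Z. \<forall>\<^sub>F x in nhds x0.
    \<exists>u. y - h < u \<and> u < y + h \<and> g x u = 0 \<and> (\<forall>v. y - h \<le> v \<and> v \<le> y + h \<and> g x v = 0 \<longrightarrow> v = u)"
    using fin persistent_simple_root simple by (intro eventually_ball_finite) (auto simp: zeros_def)
  have small: "\<forall>\<^sub>F h in at_right 0. h < k" if "k > 0" for k :: real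
    using that by (auto simp: eventually_at_right_field)
  have 2: "\<forall>\<^sub>F h in at_right 0. \<forall>y\<in>?Z. h < y - c \<and> h < d - y"
  proof -
    have "y - c > 0 \<and> d - y > 0" if "y \<in> ?Z" for y
    proof -
      have "y \<noteq> c" "y \<noteq> d" using that ends by (auto simp: zeros_def)
      with that show ?thesis by (auto simp: zeros_def)
    qed
    then show ?thesis using fin small by (intro eventually_ball_finite ballI eventually_conj) auto
  qed
  have 3: "\<forall>\<^sub>F h in at_right 0. \<forall>y\<in>?Z. \<forall>y'\<in>?Z. y < y' \<longrightarrow> h < (y' - y) / 2"
  proof (intro eventually_ball_finite fin ballI)
    fix y y' :: real
    show "\<forall>\<^sub>F h in at_right 0. y < y' \<longrightarrow> h < (y' - y) / 2"
      using small[of "(y' - y) / 2"] by (cases "y < y'") auto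
  qed
  have "\<forall>\<^sub>F h in at_right (0::real). h > 0" by (simp add: eventually_at_right_less)
  with 1 2 3 small[OF \<eta>] have "\<forall>\<^sub>F h in at_right 0.
    (\<forall>y\<in>?Z. \<forall>\<^sub>F x in nhds x0.
    \<exists>u. y - h < u \<and> u < y + h \<and> g x u = 0 \<and> (\<forall>v. y - h \<le> v \<and> v \<le> y + h \<and> g x v = 0 \<longrightarrow> v = u)) \<and>
    (\<forall>y\<in>?Z. h < y - c \<and> h < d - y) \<and> (\<forall>y\<in>?Z. \<forall>y'\<in>?Z. y < y' \<longrightarrow> h < (y' - y) / 2) \<and> h < \<eta> \<and> h > 0"
    by eventually_elim blast
  then obtain h where h1: "\<forall>y\<in>?Z. \<forall>\<^sub>F x in nhds x0.
    \<exists>u. y - h < u \<and> u < y + h \<and> g x u = 0 \<and> (\<forall>v. y - h \<le> v \<and> v \<le> y + h \<and> g x v = 0 \<longrightarrow> v = u)"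
    and h2: "\<And>y. y \<in> ?Z \<Longrightarrow> h < y - c \<and> h < d - y"
    and h3: "\<And>y y'. y \<in> ?Z \<Longrightarrow> y' \<in> ?Z \<Longrightarrow> y < y' \<Longrightarrow> h < (y' - y) / 2"
    and h: "h < \<eta>" "h > 0"
    using eventually_happens'[OF trivial_limit_at_right_real] by blast
  define K where "K = {c..d} - (\<Union>y\<in>?Z. {y - h<..<y + h})"
  have "compact K" unfolding K_def by (intro compact_diff) auto
  moreover have "g x0 u \<noteq> 0" if "u \<in> K" for u
  proof
    assume "g x0 u = 0"
    with that have "u \<in> ?Z" by (simp add: K_def zeros_def)
    with h(2) have "u \<in> (\<Union>y\<in>?Z. {y - h<..<y + h})" by (intro UN_I) auto
    with that show False unfolding K_def by blast
  qed
  ultimately have K: "\<forall>\<^sub>F x in nhds x0. \<forall>u\<in>K. g x u \<noteq> 0" using nonzero_tube[OF cont_g] by blast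
  have "\<forall>\<^sub>F x in nhds x0. \<forall>y\<in>?Z. \<exists>u. y - h < u \<and> u < y + h \<and> g x u = 0 \<and>
      (\<forall>v. y - h \<le> v \<and> v \<le> y + h \<and> g x v = 0 \<longrightarrow> v = u)"
    using h1 fin by (intro eventually_ball_finite)
  with K show ?thesis
  proof eventually_elim
    case (elim x)
    from bchoice[OF elim(2)] obtain m where
      m: "\<And>y. y \<in> ?Z \<Longrightarrow> y - h < m y \<and> m y < y + h \<and> g x (m y) = 0"
      and uniq: "\<And>y v. y \<in> ?Z \<Longrightarrow> y - h \<le> v \<Longrightarrow> v \<le> y + h \<Longrightarrow> g x v = 0 \<Longrightarrow> v = m y"
      by blast
    have mono: "m y < m y'" if "y \<in> ?Z" "y' \<in> ?Z" "y < y'" for y y'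
      using m[OF that(1)] m[OF that(2)] h3[OF that] by (simp add: field_simps)
    have "inj_on m ?Z"
      by (rule inj_onI) (metis linorder_neqE_linordered_idom mono less_irrefl)
    moreover have "m ` ?Z = zeros c d x"
    proof (intro equalityI subsetI)
      fix v assume "v \<in> m ` ?Z"
      then show "v \<in> zeros c d x" using m h2 by (force simp: zeros_def)
    next
      fix v assume v: "v \<in> zeros c d x"
      then have "v \<notin> K" using elim(1) by (auto simp: zeros_def)
      with v obtain y where "y \<in> ?Z" "y - h < v" "v < y + h" by (auto simp: K_def zeros_def)
      with uniq[of y v] v show "v \<in> m ` ?Z" by (auto simp: zeros_def)
    qed
    ultimately have "bij_betw m ?Z (zeros c d x)" by (simp add: bij_betw_def)
    moreover have "\<bar>m y - y\<bar> < \<eta>" if "y \<in> ?Z" for y using m[OF that] h(1) by auto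
    ultimately show ?case using mono by blast
  qed
qed

text \<open>
  The number of roots is locally constant, hence constant.  The branch \<open>\<phi> i\<close> selects the root of
  rank \<open>i\<close>; since roots move without changing their order, it moves continuously.
\<close>
lemma root_branches:
  assumes fin: "\<And>x. x \<in> {l<..<u} \<Longrightarrow> finite (zeros c d x)"
    and simple: "\<And>x y. x \<in> {l<..<u} \<Longrightarrow> y \<in> zeros c d x \<Longrightarrow> gy x y \<noteq> 0"
    and ends: "\<And>x. x \<in> {l<..<u} \<Longrightarrow> g x c \<noteq> 0 \<and> g x d \<noteq> 0"
  shows "\<exists>(n::nat) \<phi>. (\<forall>i\<in>{1..n}. continuous_on {l<..<u} (\<phi> i)) \<and>
     (\<forall>x\<in>{l<..<u}. (\<lambda>i. \<phi> i x) ` {1..n} = zeros c d x) \<and>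
     (\<forall>x\<in>{l<..<u}. \<forall>i\<in>{1..n}. \<forall>j\<in>{1..n}. i < j \<longrightarrow> \<phi> i x < \<phi> j x)"
proof (cases "l < u")
  case False
  then show ?thesis by (intro exI[of _ "0::nat"]) simp
next
  case True
  let ?I = "{l<..<u}"
  let ?r = "{(a, b). a < (b::real)}"
  define rank where "rank x = position ?r (zeros c d x)" for x
  define \<phi> where "\<phi> i x = inv_into (zeros c d x) (rank x) i" for i :: nat and x
  obtain x1 where x1: "x1 \<in> ?I" using dense[OF True] by auto
  define n where "n = card (zeros c d x1)"
  have card_n: "card (zeros c d x) = n" if "x \<in> ?I" for x
    unfolding n_def
  proof (rule connected_local_const[of ?I])
    show "connected ?I" by simp
    show "\<forall>a\<in>?I. \<forall>\<^sub>F b in at a within ?I. card (zeros c d a) = card (zeros c d b)"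
    proof
      fix a assume a: "a \<in> ?I"
      have "\<forall>\<^sub>F b in nhds a. card (zeros c d a) = card (zeros c d b)"
        using zeros_move_continuously[OF fin[OF a] simple[OF a], of 1] ends[OF a]
        by (auto elim!: eventually_mono dest: bij_betw_same_card)
      then show "\<forall>\<^sub>F b in at a within ?I. card (zeros c d a) = card (zeros c d b)"
        by (simp add: eventually_nhds_conv_at)
          (meson at_le eventually_at_filter filter_leD subset_UNIV)
    qed
  qed (use that x1 in auto)
  have bij: "bij_betw (rank x) (zeros c d x) {1..n}" if "x \<in> ?I" for x
    using bij_betw_position[OF fin[OF that] strict_linear_order_on_less] card_n[OF that]
    by (simp add: rank_def)
  have \<phi>_in: "\<phi> i x \<in> zeros c d x" "rank x (\<phi> i x) = i" if "x \<in> ?I" "i \<in> {1..n}" for i x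
    using bij[OF that(1)] that(2) unfolding \<phi>_def bij_betw_def
    by (auto intro: inv_into_into f_inv_into_f)
  have \<phi>_eqI: "\<phi> i x = y" if "x \<in> ?I" "y \<in> zeros c d x" "rank x y = i" for i x y
    using bij[OF that(1)] that unfolding \<phi>_def bij_betw_def by auto
  show ?thesis
  proof (intro exI[of _ n] exI[of _ \<phi>] conjI ballI impI)
    show "(\<lambda>i. \<phi> i x) ` {1..n} = zeros c d x" if x: "x \<in> ?I" for x
    proof (intro equalityI subsetI)
      fix y assume y: "y \<in> zeros c d x"
      with bij[OF x] have "rank x y \<in> {1..n}" by (auto simp: bij_betw_def)
      moreover have "\<phi> (rank x y) x = y" using \<phi>_eqI[OF x y] by simp
      ultimately show "y \<in> (\<lambda>i. \<phi> i x) ` {1..n}" by (metis imageI)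
    qed (use \<phi>_in x in auto)
    show "\<phi> i x < \<phi> j x" if "x \<in> ?I" "i \<in> {1..n}" "j \<in> {1..n}" "i < j" for x i j
      using position_less_iff[OF fin[OF that(1)] strict_linear_order_on_less \<phi>_in(1) \<phi>_in(1), of i j]
        \<phi>_in(2)[of x i] \<phi>_in(2)[of x j] that by (simp add: rank_def)
    show "continuous_on ?I (\<phi> i)" if i: "i \<in> {1..n}" for i
    proof (rule continuous_at_imp_continuous_on, rule ballI)
      fix x0 assume x0: "x0 \<in> ?I"
      have "(\<phi> i \<longlongrightarrow> \<phi> i x0) (nhds x0)"
      proof (rule tendstoI)
        fix \<eta> :: real assume "\<eta> > 0"
        from zeros_move_continuously[OF fin[OF x0] simple[OF x0] _ _ this] ends[OF x0]
        have "\<forall>\<^sub>F x in nhds x0. \<exists>m. bij_betw m (zeros c d x0) (zeros c d x) \<and>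
          (\<forall>y\<in>zeros c d x0. \<forall>y'\<in>zeros c d x0. y < y' \<longrightarrow> m y < m y') \<and>
          (\<forall>y\<in>zeros c d x0. \<bar>m y - y\<bar> < \<eta>)" by blast
        moreover have "\<forall>\<^sub>F x in nhds x0. x \<in> ?I"
          using x0 by (intro eventually_nhds_in_open) auto
        ultimately show "\<forall>\<^sub>F x in nhds x0. dist (\<phi> i x) (\<phi> i x0) < \<eta>"
        proof eventually_elim
          case (elim x)
          then obtain m where m: "bij_betw m (zeros c d x0) (zeros c d x)"
            "\<And>y y'. y \<in> zeros c d x0 \<Longrightarrow> y' \<in> zeros c d x0 \<Longrightarrow> y < y' \<Longrightarrow> m y < m y'"
            "\<And>y. y \<in> zeros c d x0 \<Longrightarrow> \<bar>m y - y\<bar> < \<eta>" by blast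
          let ?y = "\<phi> i x0"
          have y: "?y \<in> zeros c d x0" using \<phi>_in x0 i by blast
          have less: "m y < m y' \<longleftrightarrow> y < y'" if "y \<in> zeros c d x0" "y' \<in> zeros c d x0" for y y'
            using m(2) that by (metis linorder_less_linear order_less_asym)
          have img: "zeros c d x = m ` zeros c d x0" and inj: "inj_on m (zeros c d x0)"
            using m(1) by (auto simp: bij_betw_def)
          have "{b \<in> zeros c d x. b < m ?y} = m ` {b \<in> zeros c d x0. b < ?y}"
            unfolding img using less y by auto
          moreover have "inj_on m {b \<in> zeros c d x0. b < ?y}"
            by (rule inj_on_subset[OF inj]) auto
          ultimately have "rank x (m ?y) = rank x0 ?y"
            by (simp add: rank_def position_def card_image)
          also have "\<dots> = i" using \<phi>_in x0 i by blast
          finally have "\<phi> i x = m ?y" using y by (intro \<phi>_eqI elim) (auto simp: img)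
          then show ?case using m(3)[OF y] by (simp add: dist_real_def)
        qed
      qed
      then show "isCont (\<phi> i) x0" by (simp add: tendsto_nhds_iff isCont_def)
    qed
  qed
qed

end

section \<open>Real functions of one variable\<close>

lemma no_zero_same_sign:
  fixes h :: "real \<Rightarrow> real"
  assumes "\<And>S. continuous_on S h" "\<And>y. y \<in> {p<..<q} \<Longrightarrow> h y \<noteq> 0"
    and "y \<in> {p<..<q}" "z \<in> {p<..<q}" "0 < s * h z"
  shows "0 < s * h y"
proof (rule ccontr)
  assume "\<not> 0 < s * h y"
  moreover have "s \<noteq> 0" using assms(5) by auto
  ultimately have "0 \<in> closed_segment (s * h y) (s * h z)"
    using assms by (auto simp: closed_segment_eq_real_ivl)
  moreover have "continuous_on (closed_segment y z) (\<lambda>x. s * h x)"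
    by (intro continuous_intros assms(1))
  ultimately obtain x where x: "x \<in> closed_segment y z" "s * h x = 0"
    by (metis IVT'_closed_segment_real)
  then have "x \<in> {p<..<q}" using assms(3,4) by (auto simp: closed_segment_eq_real_ivl split: if_splits)
  with x \<open>s \<noteq> 0\<close> assms(2) show False by auto
qed

text \<open>
  With \<open>c\<close> and \<open>d\<close> counted as roots number \<open>0\<close> and \<open>n + 1\<close>, the sign of \<open>h\<close> between the roots \<open>i\<close> and
  \<open>i + 1\<close> is that of \<open>(- 1) ^ Suc i\<close>: it is negative to the right of \<open>c\<close> and flips at every simple
  root.  To the left of \<open>d\<close> it is positive, so \<open>n\<close> is odd.
\<close>
lemma simple_roots_alternate:
  fixes h h' :: "real \<Rightarrow> real" and r :: "nat \<Rightarrow> real"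
  assumes der: "\<And>y. (h has_real_derivative h' y) (at y)"
    and roots: "r ` {1..n} = {y \<in> {c..d}. h y = 0}"
    and mono: "\<And>i j. i \<in> {1..n} \<Longrightarrow> j \<in> {1..n} \<Longrightarrow> i < j \<Longrightarrow> r i < r j"
    and simple: "\<And>i. i \<in> {1..n} \<Longrightarrow> h' (r i) \<noteq> 0"
    and ends: "c < d" "h c < 0" "0 < h d"
  shows "odd n"
    and "\<And>i y. i \<in> {1..<n} \<Longrightarrow> r i < y \<Longrightarrow> y < r (Suc i) \<Longrightarrow> 0 < (-1) ^ Suc i * h y"
proof -
  define R where "R i = (if i = 0 then c else if i = Suc n then d else r i)" for i
  have cont: "continuous_on S h" for S
    by (meson DERIV_isCont der continuous_at_imp_continuous_on)
  have r_in: "c < r i" "r i < d" "h (r i) = 0" if "i \<in> {1..n}" for i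
  proof -
    have "r i \<in> {y \<in> {c..d}. h y = 0}" using that roots by blast
    then have "c \<le> r i" "r i \<le> d" "h (r i) = 0" by auto
    moreover from this have "r i \<noteq> c" "r i \<noteq> d" using ends by auto
    ultimately show "c < r i" "r i < d" "h (r i) = 0" by auto
  qed
  have R_less: "R i < R (Suc i)" if "i \<le> n" for i
    using that r_in mono[of i "Suc i"] ends(1) by (auto simp: R_def)
  have R_le: "c \<le> R i" "R i \<le> d" if "i \<le> Suc n" for i
    using that r_in[of i] ends(1) by (auto simp: R_def)
  have no_zero: "h y \<noteq> 0" if "i \<le> n" "y \<in> {R i<..<R (Suc i)}" for i y
  proof
    assume "h y = 0"
    moreover have "y \<in> {c..d}" using that R_le[of i] R_le[of "Suc i"] by auto
    ultimately obtain j where j: "j \<in> {1..n}" "y = r j" using roots by blast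
    show False
    proof (cases "j \<le> i")
      case True
      then have "r j \<le> R i" using that j mono[of j i] by (cases "j = i") (auto simp: R_def)
      with j that show False by auto
    next
      case False
      then have "R (Suc i) \<le> r j" using that j mono[of "Suc i" j] by (cases "j = Suc i") (auto simp: R_def)
      with j that show False by auto
    qed
  qed
  have sign: "\<forall>y\<in>{R i<..<R (Suc i)}. 0 < (-1) ^ Suc i * h y" if "i \<le> n" for i
    using that
  proof (induction i)
    case 0
    show ?case
    proof (rule ccontr)
      assume "\<not> ?thesis"
      then obtain y where y: "R 0 < y" "y < R (Suc 0)" "h y \<ge> 0" by force
      then have "\<exists>z\<ge>c. z \<le> y \<and> h z = 0"
        using ends(2) cont by (intro IVT') (auto simp: R_def)
      then obtain z where z: "c \<le> z" "z \<le> y" "h z = 0" by blast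
      then have "z \<in> {R 0<..<R (Suc 0)}" using ends(2) y by (auto simp: R_def less_le)
      with no_zero[of 0 z] z show False by simp
    qed
  next
    case (Suc i)
    define s :: real where "s = (-1) ^ Suc i"
    let ?y = "R (Suc i)"
    have IH: "0 < s * h z" if "R i < z" "z < ?y" for z using Suc that by (auto simp: s_def)
    have y: "h ?y = 0" "h' ?y \<noteq> 0" using Suc.prems r_in simple by (auto simp: R_def)
    have der_s: "((\<lambda>y. s * h y) has_real_derivative s * h' ?y) (at ?y)"
      by (intro DERIV_cmult der)
    \<comment> \<open>The left neighbourhood of the root forces the sign of the derivative there.\<close>
    have "\<not> 0 < s * h' ?y"
    proof
      assume "0 < s * h' ?y"
      then obtain e where e: "e > 0" "\<And>k. 0 < k \<Longrightarrow> k < e \<Longrightarrow> s * h (?y - k) < s * h ?y"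
        using DERIV_pos_inc_left[OF der_s] by blast
      have "0 < min e (?y - R i)" using e(1) R_less[of i] Suc.prems by simp
      then obtain k where "0 < k" "k < min e (?y - R i)" using dense by blast
      then have "0 < k" "k < e" "R i < ?y - k" "?y - k < ?y" by auto
      with e(2)[of k] IH[of "?y - k"] y show False by auto
    qed
    moreover have "s * h' ?y \<noteq> 0" using y(2) by (simp add: s_def)
    ultimately have "s * h' ?y < 0" by linarith
    then obtain e where e: "e > 0" "\<And>k. 0 < k \<Longrightarrow> k < e \<Longrightarrow> s * h (?y + k) < s * h ?y"
      using DERIV_neg_dec_right[OF der_s] by blast
    have "0 < min e (R (Suc (Suc i)) - ?y)" using e(1) R_less[of "Suc i"] Suc.prems by simp
    then obtain k where "0 < k" "k < min e (R (Suc (Suc i)) - ?y)" using dense by blast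
    then have k: "0 < k" "k < e" "?y + k < R (Suc (Suc i))" "?y < ?y + k" by auto
    with e(2)[of k] y have pos: "0 < (-1) ^ Suc (Suc i) * h (?y + k)" by (simp add: s_def)
    show ?case
      by (intro ballI, rule no_zero_same_sign[OF cont no_zero[OF Suc.prems] _ _ pos]) (use k in auto)
  qed
  show "0 < (-1) ^ Suc i * h y" if "i \<in> {1..<n}" "r i < y" "y < r (Suc i)" for i y
  proof -
    have "R i = r i" "R (Suc i) = r (Suc i)" using that(1) by (auto simp: R_def)
    with sign[of i] that show ?thesis by auto
  qed
  show "odd n"
  proof (rule ccontr)
    assume "\<not> odd n"
    then have neg: "h y < 0" if "y \<in> {R n<..<d}" for y using sign[of n] that by (auto simp: R_def)
    have "R n < d" using R_less[of n] by (auto simp: R_def)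
    then obtain y where y: "R n < y" "y < d" using dense by blast
    then have "\<exists>z\<ge>y. z \<le> d \<and> h z = 0"
      using neg[of y] ends(3) cont by (intro IVT') auto
    then obtain z where z: "y \<le> z" "z \<le> d" "h z = 0" by blast
    then have "z < d" using ends(3) by (auto simp: less_le)
    with neg[of z] y z show False by auto
  qed
qed

lemma mean_value_between:
  fixes h h' :: "real \<Rightarrow> real"
  assumes "\<And>y. (h has_real_derivative h' y) (at y)"
  shows "\<exists>z. \<bar>z - a\<bar> \<le> \<bar>b - a\<bar> \<and> h b - h a = (b - a) * h' z"
proof -
  consider "a < b" | "a = b" | "b < a" by linarith
  then show ?thesis
  proof cases
    case 1
    from MVT2[OF 1 assms] obtain z where "a < z" "z < b" "h b - h a = (b - a) * h' z" by blast
    then show ?thesis by (intro exI[of _ z]) auto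
  next
    case 3
    from MVT2[OF 3 assms] obtain z where "b < z" "z < a" "h a - h b = (a - b) * h' z" by blast
    then show ?thesis by (intro exI[of _ z]) (auto simp: algebra_simps)
  qed auto
qed

text \<open>
  By the mean value theorem in each variable, the vanishing increment of \<open>g\<close> along the graph is
  \<open>(\<phi> x - \<phi> x0) * gy x (\<xi> x) + (x - x0) * gx (\<zeta> x) (\<phi> x0)\<close>; as \<open>\<phi>\<close> is continuous, the
  intermediate points converge.
\<close>
lemma (in plane_function) implicit_derivative:
  assumes cont: "isCont \<phi> x0" and level: "\<forall>\<^sub>F x in nhds x0. g x (\<phi> x) = k"
    and gy: "gy x0 (\<phi> x0) \<noteq> 0"
  shows "(\<phi> has_real_derivative - gx x0 (\<phi> x0) / gy x0 (\<phi> x0)) (at x0)"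
proof -
  let ?y = "\<phi> x0"
  have "\<exists>\<xi>. \<forall>x. \<bar>\<xi> x - ?y\<bar> \<le> \<bar>\<phi> x - ?y\<bar> \<and> g x (\<phi> x) - g x ?y = (\<phi> x - ?y) * gy x (\<xi> x)"
    using mean_value_between[OF has_gy] by (intro choice) blast
  then obtain \<xi> where \<xi>: "\<And>x. \<bar>\<xi> x - ?y\<bar> \<le> \<bar>\<phi> x - ?y\<bar>"
    "\<And>x. g x (\<phi> x) - g x ?y = (\<phi> x - ?y) * gy x (\<xi> x)" by blast
  have "\<exists>\<zeta>. \<forall>x. \<bar>\<zeta> x - x0\<bar> \<le> \<bar>x - x0\<bar> \<and> g x ?y - g x0 ?y = (x - x0) * gx (\<zeta> x) ?y"
    using mean_value_between[OF has_gx] by (intro choice) blast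
  then obtain \<zeta> where \<zeta>: "\<And>x. \<bar>\<zeta> x - x0\<bar> \<le> \<bar>x - x0\<bar>"
    "\<And>x. g x ?y - g x0 ?y = (x - x0) * gx (\<zeta> x) ?y" by blast
  have \<phi>_lim: "(\<phi> \<longlongrightarrow> ?y) (at x0)" using cont by (simp add: isCont_def)
  have "((\<lambda>x. \<xi> x - ?y) \<longlongrightarrow> 0) (at x0)"
    by (rule Lim_null_comparison[of _ "\<lambda>x. \<bar>\<phi> x - ?y\<bar>"])
      (use \<xi>(1) tendsto_rabs_zero[OF LIM_zero[OF \<phi>_lim]] in auto)
  then have \<xi>_lim: "(\<xi> \<longlongrightarrow> ?y) (at x0)" by (rule LIM_zero_cancel)
  have "((\<lambda>x. \<zeta> x - x0) \<longlongrightarrow> 0) (at x0)"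
    by (rule Lim_null_comparison[of _ "\<lambda>x. \<bar>x - x0\<bar>"])
      (use \<zeta>(1) tendsto_rabs_zero[OF LIM_zero[OF tendsto_ident_at]] in auto)
  then have \<zeta>_lim: "(\<zeta> \<longlongrightarrow> x0) (at x0)" by (rule LIM_zero_cancel)
  have cts: "isCont (\<lambda>(x, y). gx x y) (x0, ?y)" "isCont (\<lambda>(x, y). gy x y) (x0, ?y)"
    using cont_gx cont_gy by (simp_all add: continuous_on_eq_continuous_at)
  have A: "((\<lambda>x. gx (\<zeta> x) ?y) \<longlongrightarrow> gx x0 ?y) (at x0)"
    using isCont_tendsto_compose[OF cts(1) tendsto_Pair[OF \<zeta>_lim tendsto_const[of ?y]]] by simp
  have B: "((\<lambda>x. gy x (\<xi> x)) \<longlongrightarrow> gy x0 ?y) (at x0)"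
    using isCont_tendsto_compose[OF cts(2) tendsto_Pair[OF tendsto_ident_at \<xi>_lim]] by simp
  have k: "g x0 ?y = k" using level eventually_nhds_x_imp_x by blast
  have "\<forall>\<^sub>F x in at x0. gy x (\<xi> x) \<noteq> 0" using tendsto_imp_eventually_ne[OF B gy] .
  moreover have "\<forall>\<^sub>F x in at x0. g x (\<phi> x) = k" using level by (simp add: eventually_nhds_conv_at)
  moreover have "\<forall>\<^sub>F x in at x0. x \<noteq> x0" by (simp add: eventually_at_filter)
  ultimately have "\<forall>\<^sub>F x in at x0. - gx (\<zeta> x) ?y / gy x (\<xi> x) = (\<phi> x - ?y) / (x - x0)"
  proof eventually_elim
    case (elim x)
    have "(\<phi> x - ?y) * gy x (\<xi> x) + (x - x0) * gx (\<zeta> x) ?y = 0"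
      using \<xi>(2)[of x] \<zeta>(2)[of x] elim k by simp
    with elim show ?case by (simp add: field_simps)
  qed
  moreover have "((\<lambda>x. - gx (\<zeta> x) ?y / gy x (\<xi> x)) \<longlongrightarrow> - gx x0 ?y / gy x0 ?y) (at x0)"
    by (intro tendsto_divide tendsto_minus A B gy)
  ultimately show ?thesis
    unfolding has_field_derivative_iff by (simp add: tendsto_cong)
qed

text \<open>
  If \<open>h'\<close> vanished identically, \<open>h\<close> would stay at \<open>0\<close>.  Otherwise \<open>h\<close> is injective by the mean
  value theorem, and a continuous injective function that starts at its minimum is increasing.
\<close>
lemma strict_mono_of_derivative_dichotomy:
  fixes h h' :: "real \<Rightarrow> real"
  assumes cont: "continuous_on {0..a} h" and h0: "h 0 = 0"
    and pos: "\<And>x. 0 < x \<Longrightarrow> x \<le> a \<Longrightarrow> 0 < h x"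
    and der: "\<And>x. 0 < x \<Longrightarrow> x < a \<Longrightarrow> (h has_real_derivative h' x) (at x)"
    and dich: "(\<forall>x\<in>{0<..<a}. h' x = 0) \<or> (\<forall>x\<in>{0<..<a}. h' x \<noteq> 0)"
  shows "strict_mono_on {0..a} h" and "\<And>x. 0 < x \<Longrightarrow> x < a \<Longrightarrow> 0 < h' x"
proof -
  have mvt: "\<exists>z. u < z \<and> z < v \<and> h v - h u = (v - u) * h' z" if "0 \<le> u" "u < v" "v \<le> a" for u v
  proof -
    have "\<exists>l z. u < z \<and> z < v \<and> (h has_real_derivative l) (at z) \<and> h v - h u = (v - u) * l"
    proof (rule MVT)
      show "continuous_on {u..v} h" using cont by (rule continuous_on_subset) (use that in auto)
      show "h differentiable at x" if "u < x" "x < v" for x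
        using der[of x] that \<open>0 \<le> u\<close> \<open>v \<le> a\<close> real_differentiable_def by auto
    qed fact
    then obtain l z where z: "u < z" "z < v" "(h has_real_derivative l) (at z)" "h v - h u = (v - u) * l"
      by blast
    with der[of z] that have "l = h' z" by (auto intro: DERIV_unique)
    with z show ?thesis by blast
  qed
  have nz: "h' x \<noteq> 0" if x: "0 < x" "x < a" for x
  proof -
    from mvt[of 0 a] x obtain z where "0 < z" "z < a" "h a = a * h' z" using h0 by auto
    with pos[of a] x have "h' z \<noteq> 0" by auto
    with dich \<open>0 < z\<close> \<open>z < a\<close> x show ?thesis by auto
  qed
  have inj: "h u \<noteq> h v" if uv: "0 \<le> u" "u < v" "v \<le> a" for u v
  proof -
    from mvt[OF uv] obtain z where "u < z" "z < v" "h v - h u = (v - u) * h' z" by blast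
    with nz[of z] uv show ?thesis by auto
  qed
  have less: "h u < h v" if uv: "0 \<le> u" "u < v" "v \<le> a" for u v
  proof (rule ccontr)
    assume "\<not> h u < h v"
    with inj[OF uv] have vu: "h v < h u" by simp
    have "\<exists>w\<ge>0. w \<le> u \<and> h w = h v"
      using vu pos[of v] uv h0
      by (intro IVT') (auto intro: continuous_on_subset[OF cont])
    then obtain w where "0 \<le> w" "w \<le> u" "h w = h v" by blast
    with inj[of w v] uv show False by auto
  qed
  then show "strict_mono_on {0..a} h" by (auto intro: strict_mono_onI)
  show "0 < h' x" if x: "0 < x" "x < a" for x
  proof (rule ccontr)
    assume "\<not> 0 < h' x"
    with nz[OF x] have "h' x < 0" by simp
    then obtain e where e: "e > 0" "\<And>k. 0 < k \<Longrightarrow> k < e \<Longrightarrow> h (x + k) < h x"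
      using DERIV_neg_dec_right[OF der[OF x]] by blast
    have "0 < min e (a - x)" using e(1) x by simp
    then obtain k where "0 < k" "k < min e (a - x)" using dense by blast
    then have "0 < k" "k < e" "x + k \<le> a" by auto
    with e(2)[of k] less[of x "x + k"] x show False by auto
  qed
qed

section \<open>Branches of the polar curve\<close>

text \<open>
  The factor \<open>s = - 1\<close> reflects the plane in the vertical axis, so that the left half-plane can be
  treated like the right one.
\<close>
lemma plane_function_plane_poly:
  "plane_function (\<lambda>x y. plane_poly P (s * x, y)) (\<lambda>x y. s * plane_poly (pderiv_x P) (s * x, y))
     (\<lambda>x y. plane_poly (pderiv P) (s * x, y))"
proof
  fix x y
  have "((\<lambda>x. s * x) has_real_derivative s) (at x)" by (auto intro!: derivative_eq_intros)
  from plane_poly_chain[OF this DERIV_const, of P y]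
  show "((\<lambda>x. plane_poly P (s * x, y)) has_real_derivative s * plane_poly (pderiv_x P) (s * x, y)) (at x)"
    by (simp add: mult.commute)
  show "((\<lambda>y. plane_poly P (s * x, y)) has_real_derivative plane_poly (pderiv P) (s * x, y)) (at y)"
    by (rule plane_poly_partial_y)
qed (auto simp: case_prod_unfold intro!: continuous_intros)

text \<open>
  The signs on the lower and the upper side confine the roots of \<open>f\<^sub>y(x, \<cdot>)\<close> to the interior of
  the box, and the condition on the vertical axis makes their branches run into the origin.
\<close>
locale polar_box =
  fixes F :: "real poly poly" and a b :: real
  assumes a_pos: "0 < a" and b_pos: "0 < b"
    and f_0: "plane_poly F (0, 0) = 0"
    and f_pos: "\<And>x y. \<bar>x\<bar> \<le> a \<Longrightarrow> \<bar>y\<bar> \<le> b \<Longrightarrow> (x, y) \<noteq> (0, 0) \<Longrightarrow> 0 < plane_poly F (x, y)"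
    and polar_axis: "\<And>y. \<bar>y\<bar> \<le> b \<Longrightarrow> plane_poly (pderiv F) (0, y) = 0 \<longleftrightarrow> y = 0"
    and top: "\<And>x. \<bar>x\<bar> \<le> a \<Longrightarrow> 0 < plane_poly (pderiv F) (x, b)"
    and bottom: "\<And>x. \<bar>x\<bar> \<le> a \<Longrightarrow> plane_poly (pderiv F) (x, - b) < 0"
    and simple_roots: "\<And>x y. 0 < \<bar>x\<bar> \<Longrightarrow> \<bar>x\<bar> \<le> a \<Longrightarrow> plane_poly (pderiv F) (x, y) = 0 \<Longrightarrow>
       plane_poly (pderiv (pderiv F)) (x, y) \<noteq> 0"

lemma polar_box_shrink:
  assumes "polar_box F a b" "0 < a'" "a' \<le> a"
  shows "polar_box F a' b"
proof -
  interpret polar_box F a b by fact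
  show ?thesis
  proof
    fix x y
    show "0 < plane_poly F (x, y)" if "\<bar>x\<bar> \<le> a'" "\<bar>y\<bar> \<le> b" "(x, y) \<noteq> (0, 0)"
      by (rule f_pos) (use that assms(3) in auto)
    show "0 < plane_poly (pderiv F) (x, b)" "plane_poly (pderiv F) (x, - b) < 0" if "\<bar>x\<bar> \<le> a'"
      using top[of x] bottom[of x] that assms(3) by auto
    show "plane_poly (pderiv (pderiv F)) (x, y) \<noteq> 0"
      if "0 < \<bar>x\<bar>" "\<bar>x\<bar> \<le> a'" "plane_poly (pderiv F) (x, y) = 0"
      using simple_roots[of x y] that assms(3) by auto
  qed (fact assms(2) b_pos f_0 polar_axis)+
qed

text \<open>
  As \<open>f(0, \<cdot>)\<close> is not constant, \<open>f\<^sub>y(0, \<cdot>)\<close> has no zero \<open>y \<noteq> 0\<close> with \<open>\<bar>y\<bar> \<le> b\<close> for a small \<open>b\<close>;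
  its signs there follow from the mean value theorem between \<open>0\<close> and \<open>\<plusminus>b\<close>, because
  \<open>f(0, \<plusminus>b) > f(0, 0)\<close>.  The signs at \<open>\<plusminus>b\<close> persist for small \<open>\<bar>x\<bar>\<close>.
\<close>
lemma polar_box_exists:
  assumes min: "strict_local_min (plane_poly F) (0, 0)" and f0: "plane_poly F (0, 0) = 0"
    and sf: "squarefree (pderiv F)"
  shows "\<exists>a b. polar_box F a b"
proof -
  let ?f = "plane_poly F" and ?G = "pderiv F"
  obtain d where d: "d > 0" "\<And>p. p \<noteq> (0, 0) \<Longrightarrow> dist p (0, 0) < d \<Longrightarrow> 0 < ?f p"
    using min f0 by (auto simp: strict_local_min_def eventually_at)
  have f_pos: "0 < ?f (x, y)" if "\<bar>x\<bar> + \<bar>y\<bar> < d" "(x, y) \<noteq> (0, 0)" for x y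
    using d(2)[OF that(2)] that(1) sqrt_sum_squares_le_sum_abs[of x y]
    by (simp add: dist_Pair_Pair dist_real_def)
  have mv: "\<exists>z. z \<noteq> 0 \<and> \<bar>z\<bar> < \<bar>y\<bar> \<and> 0 < z * y \<and> 0 < y * plane_poly ?G (0, z)" if "y \<noteq> 0" "\<bar>y\<bar> < d" for y
  proof -
    have pos: "0 < ?f (0, y)" using f_pos[of 0 y] that by simp
    show ?thesis
    proof (cases "y > 0")
      case True
      then obtain z where "0 < z" "z < y" "?f (0, y) - ?f (0, 0) = (y - 0) * plane_poly ?G (0, z)"
        using MVT2[of 0 y "\<lambda>y. ?f (0, y)" "\<lambda>y. plane_poly ?G (0, y)"] plane_poly_partial_y by blast
      with pos f0 show ?thesis by (intro exI[of _ z]) auto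
    next
      case False
      with that have "y < 0" by simp
      then obtain z where "y < z" "z < 0" "?f (0, 0) - ?f (0, y) = (0 - y) * plane_poly ?G (0, z)"
        using MVT2[of y 0 "\<lambda>y. ?f (0, y)" "\<lambda>y. plane_poly ?G (0, y)"] plane_poly_partial_y by blast
      with pos f0 show ?thesis by (intro exI[of _ z]) (auto simp: mult_neg_neg)
    qed
  qed
  have "d / 2 \<noteq> 0" "\<bar>d / 2\<bar> < d" using d(1) by auto
  from mv[OF this] have "\<exists>z. plane_poly ?G (0, z) \<noteq> 0" by (metis less_irrefl mult_zero_right)
  then have "finite {y. plane_poly ?G (0, y) = 0}" using finite_vertical_roots by blast
  then obtain e where e: "e > 0" "\<And>y. plane_poly ?G (0, y) = 0 \<Longrightarrow> y \<noteq> 0 \<Longrightarrow> \<not> \<bar>y\<bar> < e"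
    using finite_avoided_near_0 by force
  define b where "b = min e d / 2"
  have b: "0 < b" "b < e" "b < d" using e(1) d(1) by (auto simp: b_def)
  have cont_y: "continuous_on S (\<lambda>y. plane_poly ?G (0, y))" for S by (intro continuous_intros)
  have cont_x: "((\<lambda>x. plane_poly ?G (x, y)) \<longlongrightarrow> plane_poly ?G (0, y)) (nhds 0)" for y
    using DERIV_isCont[OF plane_poly_partial_x[of ?G y 0]]
    by (simp add: isCont_def tendsto_nhds_iff)
  have "0 < plane_poly ?G (0, b)"
  proof -
    obtain z where "0 < z" "z < b" "0 < plane_poly ?G (0, z)"
      using mv[of b] b by (auto simp: zero_less_mult_iff)
    with no_zero_same_sign[OF cont_y, of 0 e b z 1] e b show ?thesis by force
  qed
  then have top: "\<forall>\<^sub>F x in nhds 0. 0 < plane_poly ?G (x, b)" using order_tendstoD(1)[OF cont_x] by blast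
  have "plane_poly ?G (0, - b) < 0"
  proof -
    obtain z where z: "\<bar>z\<bar> < b" "z * b < 0" "b * plane_poly ?G (0, z) < 0"
      using mv[of "- b"] b by auto
    then have "- b < z" "z < 0" "plane_poly ?G (0, z) < 0" using b(1) by (auto simp: mult_less_0_iff)
    with no_zero_same_sign[OF cont_y, of "- e" 0 "- b" z "- 1"] e b show ?thesis by force
  qed
  then have bottom: "\<forall>\<^sub>F x in nhds 0. plane_poly ?G (x, - b) < 0" using order_tendstoD(2)[OF cont_x] by blast
  have G00: "plane_poly ?G (0, 0) = 0"
  proof (rule DERIV_local_min)
    show "((\<lambda>y. ?f (0, y)) has_real_derivative plane_poly ?G (0, 0)) (at 0)" by (rule plane_poly_partial_y)
    show "0 < d" by fact
    show "\<forall>y. \<bar>0 - y\<bar> < d \<longrightarrow> ?f (0, 0) \<le> ?f (0, y)"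
    proof (intro allI impI)
      fix y :: real assume "\<bar>0 - y\<bar> < d"
      then show "?f (0, 0) \<le> ?f (0, y)" using f_pos[of 0 y] f0 by (cases "y = 0") auto
    qed
  qed
  obtain k where k: "k > 0" "\<And>x. \<bar>x\<bar> < k \<Longrightarrow> 0 < plane_poly ?G (x, b) \<and> plane_poly ?G (x, - b) < 0"
    using eventually_conj[OF top bottom] by (auto simp: eventually_nhds_metric dist_real_def)
  obtain m where m: "m > 0" "\<And>x y. 0 < \<bar>x\<bar> \<Longrightarrow> \<bar>x\<bar> < m \<Longrightarrow> plane_poly ?G (x, y) = 0 \<Longrightarrow>
      plane_poly (pderiv ?G) (x, y) \<noteq> 0"
    using squarefree_simple_roots_near_axis[OF sf] by blast
  have "0 < min (d - b) (min k m)" using b k m by simp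
  then obtain a where a: "0 < a" "a < min (d - b) (min k m)" using dense by blast
  have "polar_box F a b"
  proof
    show "0 < ?f (x, y)" if "\<bar>x\<bar> \<le> a" "\<bar>y\<bar> \<le> b" "(x, y) \<noteq> (0, 0)" for x y
      using that a by (intro f_pos) auto
    show "plane_poly ?G (0, y) = 0 \<longleftrightarrow> y = 0" if "\<bar>y\<bar> \<le> b" for y
      using e(2)[of y] that b G00 by auto
  qed (use a b f0 k m in auto)
  then show ?thesis by blast
qed

text \<open>
  The branches of the polar curve in the half-plane \<open>s * x > 0\<close>, parametrized by \<open>\<bar>x\<bar>\<close> and numbered
  from bottom to top.  The value \<open>\<phi> i 0 = 0\<close> extends the branches continuously to the origin.
\<close>
locale polar_side =
  fixes F :: "real poly poly" and s a b :: real and n :: nat and \<phi> :: "nat \<Rightarrow> real \<Rightarrow> real"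
  assumes s: "s = 1 \<or> s = - 1"
    and branch_cont: "\<And>i. i \<in> {1..n} \<Longrightarrow> continuous_on {0..a} (\<phi> i)"
    and branch_0: "\<And>i. i \<in> {1..n} \<Longrightarrow> \<phi> i 0 = 0"
    and branch_bound: "\<And>i x. i \<in> {1..n} \<Longrightarrow> 0 \<le> x \<Longrightarrow> x \<le> a \<Longrightarrow> \<bar>\<phi> i x\<bar> < b"
    and polar_iff: "\<And>x y. 0 < x \<Longrightarrow> x \<le> a \<Longrightarrow> \<bar>y\<bar> \<le> b \<Longrightarrow>
          plane_poly (pderiv F) (s * x, y) = 0 \<longleftrightarrow> (\<exists>i\<in>{1..n}. y = \<phi> i x)"
    and branch_less: "\<And>i j x. i \<in> {1..n} \<Longrightarrow> j \<in> {1..n} \<Longrightarrow> i < j \<Longrightarrow> 0 < x \<Longrightarrow> x \<le> a \<Longrightarrow> \<phi> i x < \<phi> j x"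
    and odd_branches: "odd n"
    and alternate: "\<And>i x y. i \<in> {1..<n} \<Longrightarrow> 0 < x \<Longrightarrow> x \<le> a \<Longrightarrow> \<phi> i x < y \<Longrightarrow> y < \<phi> (Suc i) x \<Longrightarrow>
          0 < (- 1) ^ Suc i * plane_poly (pderiv F) (s * x, y)"
    and radius_mono: "\<And>i. i \<in> {1..n} \<Longrightarrow> strict_mono_on {0..a} (\<lambda>x. x\<^sup>2 + (\<phi> i x)\<^sup>2)"
    and f_mono: "\<And>i. i \<in> {1..n} \<Longrightarrow> strict_mono_on {0..a} (\<lambda>x. plane_poly F (s * x, \<phi> i x))"
    and fx_pos: "\<And>i x. i \<in> {1..n} \<Longrightarrow> 0 < x \<Longrightarrow> x \<le> a \<Longrightarrow> 0 < s * plane_poly (pderiv_x F) (s * x, \<phi> i x)"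

text \<open>
  The branches tend to \<open>0\<close> because \<open>f\<^sub>y(0, \<cdot>)\<close> has no zero on the compact set \<open>e \<le> \<bar>y\<bar> \<le> b\<close>.  Along
  a branch the derivatives of \<open>f\<close> and of \<open>x\<^sup>2 + \<phi>\<^sup>2\<close> are, up to nonvanishing factors, the values of
  the polynomials \<open>f\<^sub>x\<close> and \<open>x f\<^sub>y\<^sub>y - y f\<^sub>x\<^sub>y\<close>, so the dichotomy for branches applies to both; and
  both functions start at \<open>0\<close> and are positive afterwards.
\<close>
lemma polar_side_exists:
  assumes box: "polar_box F a0 b" and sf: "squarefree (pderiv F)" and s: "s = 1 \<or> s = - 1"
  shows "\<exists>a1>0. a1 \<le> a0 \<and> (\<exists>n \<phi>. \<forall>a. 0 < a \<and> a < a1 \<longrightarrow> polar_side F s a b n \<phi>)"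
proof -
  interpret polar_box F a0 b by fact
  let ?G = "pderiv F"
  interpret G: plane_function "\<lambda>x y. plane_poly ?G (s * x, y)" "\<lambda>x y. s * plane_poly (pderiv_x ?G) (s * x, y)"
     "\<lambda>x y. plane_poly (pderiv ?G) (s * x, y)" by (rule plane_function_plane_poly)
  have ss: "s * s = 1" and abs_s: "\<bar>s * x\<bar> = \<bar>x\<bar>" for x using s by (auto simp: abs_mult)
  have top_s: "0 < plane_poly ?G (s * x, b)" and bot_s: "plane_poly ?G (s * x, - b) < 0"
    if "x \<in> {0<..<a0}" for x using top[of "s * x"] bottom[of "s * x"] that abs_s by auto
  have simple_s: "plane_poly (pderiv ?G) (s * x, y) \<noteq> 0"
    if "x \<in> {0<..<a0}" "plane_poly ?G (s * x, y) = 0" for x y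
    using simple_roots[of "s * x" y] that abs_s by auto
  have "\<exists>(n::nat) \<phi>0. (\<forall>i\<in>{1..n}. continuous_on {0<..<a0} (\<phi>0 i)) \<and>
     (\<forall>x\<in>{0<..<a0}. (\<lambda>i. \<phi>0 i x) ` {1..n} = G.zeros (- b) b x) \<and>
     (\<forall>x\<in>{0<..<a0}. \<forall>i\<in>{1..n}. \<forall>j\<in>{1..n}. i < j \<longrightarrow> \<phi>0 i x < \<phi>0 j x)"
  proof (rule G.root_branches)
    fix x assume x: "x \<in> {0<..<a0}"
    show "finite (G.zeros (- b) b x)"
      using finite_vertical_roots[of ?G "s * x" b] top_s[OF x]
      by (auto simp: G.zeros_def elim: rev_finite_subset)
    show "plane_poly ?G (s * x, - b) \<noteq> 0 \<and> plane_poly ?G (s * x, b) \<noteq> 0"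
      using top_s[OF x] bot_s[OF x] by auto
    show "plane_poly (pderiv ?G) (s * x, y) \<noteq> 0" if "y \<in> G.zeros (- b) b x" for y
      using simple_s[OF x] that by (simp add: G.zeros_def)
  qed
  then obtain n :: nat and \<phi>0 where P: "\<forall>i\<in>{1..n}. continuous_on {0<..<a0} (\<phi>0 i)"
     "\<forall>x\<in>{0<..<a0}. (\<lambda>i. \<phi>0 i x) ` {1..n} = G.zeros (- b) b x"
     "\<forall>x\<in>{0<..<a0}. \<forall>i\<in>{1..n}. \<forall>j\<in>{1..n}. i < j \<longrightarrow> \<phi>0 i x < \<phi>0 j x"
    by (elim exE conjE)
  note cont0 = P(1)[rule_format] and img = P(2)[rule_format] and less = P(3)[rule_format]
  define \<phi> where "\<phi> i x = (if x = 0 then 0 else \<phi>0 i x)" for i x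
  have root: "\<phi> i x \<in> {- b..b}" "plane_poly ?G (s * x, \<phi> i x) = 0" if "i \<in> {1..n}" "0 < x" "x < a0" for i x
  proof -
    have "\<phi> i x \<in> G.zeros (- b) b x" using img[of x] that by (auto simp: \<phi>_def)
    then show "\<phi> i x \<in> {- b..b}" "plane_poly ?G (s * x, \<phi> i x) = 0" by (auto simp: G.zeros_def)
  qed
  have bound: "\<bar>\<phi> i x\<bar> < b" if "i \<in> {1..n}" "0 < x" "x < a0" for i x
    using root[OF that] top_s[of x] bot_s[of x] that by (force simp: abs_less_iff less_le)
  have cont_pos: "continuous_on {0<..<a0} (\<phi> i)" if "i \<in> {1..n}" for i
    using cont0[OF that] by (rule continuous_on_eq) (simp add: \<phi>_def)
  have lim: "(\<phi> i \<longlongrightarrow> 0) (at_right 0)" if i: "i \<in> {1..n}" for i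
  proof (rule tendstoI)
    fix e :: real assume "e > 0"
    let ?K = "{- b..b} - {- e<..<e}"
    have "\<forall>\<^sub>F x in nhds 0. \<forall>u\<in>?K. plane_poly ?G (s * x, u) \<noteq> 0"
      using polar_axis \<open>e > 0\<close> by (intro nonzero_tube G.cont_g compact_diff) auto
    then have "\<forall>\<^sub>F x in at_right 0. \<forall>u\<in>?K. plane_poly ?G (s * x, u) \<noteq> 0"
      by (rule filter_leD[rotated]) (simp add: at_within_le_nhds)
    moreover have "\<forall>\<^sub>F x in at_right 0. x \<in> {0<..<a0}"
      using a_pos by (intro eventually_at_right_real)
    ultimately show "\<forall>\<^sub>F x in at_right 0. dist (\<phi> i x) 0 < e"
    proof eventually_elim
      case (elim x)
      with root[OF i, of x] have "\<phi> i x \<notin> ?K" "\<phi> i x \<in> {- b..b}" by auto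
      then show ?case by auto
    qed
  qed
  have cont: "continuous_on {0..<a0} (\<phi> i)" if i: "i \<in> {1..n}" for i
  proof -
    have "continuous (at x within {0..<a0}) (\<phi> i)" if x: "x \<in> {0..<a0}" for x
    proof (cases "x = 0")
      case True
      have "at 0 within {0..<a0} = at_right 0"
        using a_pos by (intro at_within_nhd[of _ "{..<a0}"]) auto
      with True lim[OF i] show ?thesis by (simp add: continuous_within \<phi>_def[of _ 0])
    next
      case False
      with x have "isCont (\<phi> i) x"
        using cont_pos[OF i] by (simp add: continuous_on_eq_continuous_at)
      then show ?thesis by (rule continuous_at_imp_continuous_at_within)
    qed
    then show ?thesis by (simp add: continuous_on_eq_continuous_within)
  qed
  have der: "(\<phi> i has_real_derivative - (s * plane_poly (pderiv_x ?G) (s * x, \<phi> i x)) /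
      plane_poly (pderiv ?G) (s * x, \<phi> i x)) (at x)" if i: "i \<in> {1..n}" and x: "0 < x" "x < a0" for i x
  proof (rule G.implicit_derivative)
    show "isCont (\<phi> i) x" using cont_pos[OF i] x by (simp add: continuous_on_eq_continuous_at)
    have "\<forall>\<^sub>F x in nhds x. x \<in> {0<..<a0}" using x by (intro eventually_nhds_in_open) auto
    then show "\<forall>\<^sub>F x in nhds x. plane_poly ?G (s * x, \<phi> i x) = 0"
      by eventually_elim (use root[OF i] in auto)
    show "plane_poly (pderiv ?G) (s * x, \<phi> i x) \<noteq> 0" using simple_s[of x] root(2)[OF i x] x by auto
  qed
  \<comment> \<open>The zeros of \<open>K\<close> on the polar curve are its points of tangency with circles around the origin.\<close>
  define K where "K = smult [:0, 1:] (pderiv ?G) - pCons 0 (pderiv_x ?G)"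
  have K: "plane_poly K (x, y) = x * plane_poly (pderiv ?G) (x, y) - y * plane_poly (pderiv_x ?G) (x, y)" for x y
    by (simp add: K_def plane_poly_diff plane_poly_smult plane_poly_pCons)
  obtain \<delta>1 where \<delta>1: "\<delta>1 > 0" "\<forall>X \<phi> (I :: real set).
     connected I \<and> continuous_on I X \<and> continuous_on I \<phi> \<and>
     (\<forall>t\<in>I. 0 < \<bar>X t\<bar> \<and> \<bar>X t\<bar> < \<delta>1 \<and> plane_poly ?G (X t, \<phi> t) = 0) \<longrightarrow>
     (\<forall>t\<in>I. plane_poly K (X t, \<phi> t) = 0) \<or> (\<forall>t\<in>I. plane_poly K (X t, \<phi> t) \<noteq> 0)"
    using squarefree_branch_dichotomy[OF sf, of "K"] by (elim exE conjE)
  obtain \<delta>2 where \<delta>2: "\<delta>2 > 0" "\<forall>X \<phi> (I :: real set).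
     connected I \<and> continuous_on I X \<and> continuous_on I \<phi> \<and>
     (\<forall>t\<in>I. 0 < \<bar>X t\<bar> \<and> \<bar>X t\<bar> < \<delta>2 \<and> plane_poly ?G (X t, \<phi> t) = 0) \<longrightarrow>
     (\<forall>t\<in>I. plane_poly (pderiv_x F) (X t, \<phi> t) = 0) \<or> (\<forall>t\<in>I. plane_poly (pderiv_x F) (X t, \<phi> t) \<noteq> 0)"
    using squarefree_branch_dichotomy[OF sf, of "(pderiv_x F)"] by (elim exE conjE)
  define a1 where "a1 = min a0 (min \<delta>1 \<delta>2)"
  have a1: "0 < a1" "a1 \<le> a0" "a1 \<le> \<delta>1" "a1 \<le> \<delta>2" using a_pos \<delta>1(1) \<delta>2(1) by (auto simp: a1_def)
  have dich: "(\<forall>t\<in>{0<..<a}. plane_poly K (s * t, \<phi> i t) = 0) \<or> (\<forall>t\<in>{0<..<a}. plane_poly K (s * t, \<phi> i t) \<noteq> 0)" (is ?P)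
    "(\<forall>t\<in>{0<..<a}. plane_poly (pderiv_x F) (s * t, \<phi> i t) = 0) \<or> (\<forall>t\<in>{0<..<a}. plane_poly (pderiv_x F) (s * t, \<phi> i t) \<noteq> 0)" (is ?Q)
    if "i \<in> {1..n}" "a < a1" for i a
  proof -
    have I: "connected {0<..<a}" "continuous_on {0<..<a} (\<lambda>t. s * t)" "continuous_on {0<..<a} (\<phi> i)"
      using that a1 by (auto intro!: continuous_intros intro: continuous_on_subset[OF cont_pos])
    have 1: "\<forall>t\<in>{0<..<a}. 0 < \<bar>s * t\<bar> \<and> \<bar>s * t\<bar> < \<delta>1 \<and> plane_poly ?G (s * t, \<phi> i t) = 0"
      and 2: "\<forall>t\<in>{0<..<a}. 0 < \<bar>s * t\<bar> \<and> \<bar>s * t\<bar> < \<delta>2 \<and> plane_poly ?G (s * t, \<phi> i t) = 0"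
      using that a1 root(2) by (auto simp: abs_s)
    show ?P by (rule \<delta>1(2)[rule_format, OF conjI[OF I(1) conjI[OF I(2) conjI[OF I(3) 1]]]])
    show ?Q by (rule \<delta>2(2)[rule_format, OF conjI[OF I(1) conjI[OF I(2) conjI[OF I(3) 2]]]])
  qed
  have rad: "strict_mono_on {0..a} (\<lambda>x. x\<^sup>2 + (\<phi> i x)\<^sup>2)" if i: "i \<in> {1..n}" and a: "a < a1" for i a
  proof (rule strict_mono_of_derivative_dichotomy)
    show "continuous_on {0..a} (\<lambda>x. x\<^sup>2 + (\<phi> i x)\<^sup>2)"
      using a a1 by (intro continuous_intros continuous_on_subset[OF cont[OF i]]) auto
    show "0\<^sup>2 + (\<phi> i 0)\<^sup>2 = 0" by (simp add: \<phi>_def)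
    show "0 < x\<^sup>2 + (\<phi> i x)\<^sup>2" if "0 < x" for x using that by (intro add_pos_nonneg) auto
    show "((\<lambda>x. x\<^sup>2 + (\<phi> i x)\<^sup>2) has_real_derivative
        2 * s * plane_poly K (s * x, \<phi> i x) / plane_poly (pderiv ?G) (s * x, \<phi> i x)) (at x)"
      if x: "0 < x" "x < a" for x
    proof -
      let ?A = "plane_poly (pderiv_x ?G) (s * x, \<phi> i x)" and ?B = "plane_poly (pderiv ?G) (s * x, \<phi> i x)"
      have B: "?B \<noteq> 0" using simple_s[of x] root(2)[OF i, of x] x a a1 by auto
      have d: "(\<phi> i has_real_derivative - (s * ?A) / ?B) (at x)" using der[OF i, of x] x a a1 by auto
      have "((\<lambda>x. x\<^sup>2 + (\<phi> i x)\<^sup>2) has_real_derivative 2 * x + 2 * \<phi> i x * (- (s * ?A) / ?B)) (at x)"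
        by (auto intro!: derivative_eq_intros d)
      moreover have "2 * x + 2 * \<phi> i x * (- (s * ?A) / ?B) = 2 * s * plane_poly K (s * x, \<phi> i x) / ?B"
      proof -
        have "2 * s * plane_poly K (s * x, \<phi> i x) = 2 * (s * s) * x * ?B - 2 * s * \<phi> i x * ?A"
          by (simp add: K algebra_simps)
        then show ?thesis using B by (simp add: ss field_simps)
      qed
      ultimately show ?thesis by simp
    qed
    show "(\<forall>x\<in>{0<..<a}. 2 * s * plane_poly K (s * x, \<phi> i x) / plane_poly (pderiv ?G) (s * x, \<phi> i x) = 0) \<or>
      (\<forall>x\<in>{0<..<a}. 2 * s * plane_poly K (s * x, \<phi> i x) / plane_poly (pderiv ?G) (s * x, \<phi> i x) \<noteq> 0)"
    proof -
      have "plane_poly (pderiv ?G) (s * x, \<phi> i x) \<noteq> 0" if "x \<in> {0<..<a}" for x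
        using simple_s[of x] root(2)[OF i, of x] that a a1 by auto
      moreover have "s \<noteq> 0" using s by auto
      ultimately show ?thesis using dich(1)[OF i a] by auto
    qed
  qed
  have f: "strict_mono_on {0..a} (\<lambda>x. plane_poly F (s * x, \<phi> i x))"
    "\<And>x. 0 < x \<Longrightarrow> x < a \<Longrightarrow> 0 < s * plane_poly (pderiv_x F) (s * x, \<phi> i x)"
    if i: "i \<in> {1..n}" and a: "a < a1" for i a
  proof -
    let ?h = "\<lambda>x. plane_poly F (s * x, \<phi> i x)" and ?h' = "\<lambda>x. s * plane_poly (pderiv_x F) (s * x, \<phi> i x)"
    have 1: "continuous_on {0..a} ?h"
      using a a1 by (intro continuous_intros continuous_on_subset[OF cont[OF i]]) auto
    have 2: "?h 0 = 0" by (simp add: \<phi>_def f_0)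
    have 3: "0 < ?h x" if "0 < x" "x \<le> a" for x
      using that a a1 bound[OF i, of x] s by (intro f_pos) (auto simp: abs_s)
    have 4: "(?h has_real_derivative ?h' x) (at x)" if x: "0 < x" "x < a" for x
    proof -
      have "((\<lambda>x. s * x) has_real_derivative s) (at x)" by (auto intro!: derivative_eq_intros)
      from plane_poly_chain[OF this der[OF i, of x], of F] x a a1 root(2)[OF i, of x]
      show ?thesis by (simp add: mult.commute)
    qed
    have 5: "(\<forall>x\<in>{0<..<a}. ?h' x = 0) \<or> (\<forall>x\<in>{0<..<a}. ?h' x \<noteq> 0)"
      using dich(2)[OF i a] s by auto
    show "strict_mono_on {0..a} ?h" "\<And>x. 0 < x \<Longrightarrow> x < a \<Longrightarrow> 0 < ?h' x"
      using strict_mono_of_derivative_dichotomy[OF 1 2 3 4 5] by blast+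
  qed
  have alt: "odd n" "\<And>i y. i \<in> {1..<n} \<Longrightarrow> \<phi> i x < y \<Longrightarrow> y < \<phi> (Suc i) x \<Longrightarrow> 0 < (- 1) ^ Suc i * plane_poly ?G (s * x, y)"
    if x: "0 < x" "x < a0" for x
  proof -
    let ?h = "\<lambda>y. plane_poly ?G (s * x, y)"
    have 1: "(?h has_real_derivative plane_poly (pderiv ?G) (s * x, y)) (at y)" for y by (rule plane_poly_partial_y)
    have 2: "(\<lambda>i. \<phi> i x) ` {1..n} = {y \<in> {- b..b}. ?h y = 0}"
      using img[of x] x by (simp add: \<phi>_def G.zeros_def)
    have 3: "\<phi> i x < \<phi> j x" if "i \<in> {1..n}" "j \<in> {1..n}" "i < j" for i j
      using less[of x i j] that x by (simp add: \<phi>_def)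
    have 4: "plane_poly (pderiv ?G) (s * x, \<phi> i x) \<noteq> 0" if "i \<in> {1..n}" for i
      using simple_s[of x] root(2)[OF that x] x by auto
    show "odd n" "\<And>i y. i \<in> {1..<n} \<Longrightarrow> \<phi> i x < y \<Longrightarrow> y < \<phi> (Suc i) x \<Longrightarrow> 0 < (- 1) ^ Suc i * ?h y"
      using simple_roots_alternate[of ?h _ "\<lambda>i. \<phi> i x" n "- b" b, OF 1 2 3 4] b_pos bot_s[of x] top_s[of x] x by auto
  qed
  have "polar_side F s a b n \<phi>" if a: "0 < a" "a < a1" for a
  proof
    show "s = 1 \<or> s = - 1" by fact
    \<comment> \<open>Derivatives are controlled on open intervals only; \<open>a'\<close> provides room beyond \<open>a\<close>.\<close>
    obtain a' where a': "a < a'" "a' < a1" using dense[OF a(2)] by blast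
    fix i assume i: "i \<in> {1..n}"
    show "continuous_on {0..a} (\<phi> i)"
      using a a1 by (intro continuous_on_subset[OF cont[OF i]]) auto
    show "\<phi> i 0 = 0" by (simp add: \<phi>_def)
    show "strict_mono_on {0..a} (\<lambda>x. x\<^sup>2 + (\<phi> i x)\<^sup>2)" using rad[OF i] a by simp
    show "strict_mono_on {0..a} (\<lambda>x. plane_poly F (s * x, \<phi> i x))" using f(1)[OF i] a by simp
    fix x assume x: "x \<le> a"
    show "\<bar>\<phi> i x\<bar> < b" if "0 \<le> x"
      using bound[OF i, of x] that x a a1 b_pos by (cases "x = 0") (auto simp: \<phi>_def)
    show "0 < s * plane_poly (pderiv_x F) (s * x, \<phi> i x)" if "0 < x"
      using f(2)[OF i a'(2), of x] that x a' by simp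
    show "\<phi> i x < \<phi> j x" if "j \<in> {1..n}" "i < j" "0 < x" for j
      using less[of x i j] i that x a a1 by (simp add: \<phi>_def)
  next
    show "odd n" using alt(1)[of a] a a1 by simp
    fix x y assume x: "0 < x" "x \<le> a"
    show "plane_poly ?G (s * x, y) = 0 \<longleftrightarrow> (\<exists>i\<in>{1..n}. y = \<phi> i x)" if "\<bar>y\<bar> \<le> b"
    proof -
      have "y \<in> (\<lambda>i. \<phi> i x) ` {1..n} \<longleftrightarrow> plane_poly ?G (s * x, y) = 0"
        using img[of x] x a a1 that by (auto simp: \<phi>_def G.zeros_def)
      then show ?thesis by auto
    qed
    show "0 < (- 1) ^ Suc i * plane_poly ?G (s * x, y)" if "i \<in> {1..<n}" "\<phi> i x < y" "y < \<phi> (Suc i) x" for i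
      using alt(2)[of x i y] that x a a1 by simp
  qed
  with a1 show ?thesis by blast
qed

section \<open>Vertical descent\<close>

lemma open_square:
  fixes S :: "(real \<times> real) set"
  assumes "open S" "(x0, y0) \<in> S"
  shows "\<exists>h>0. \<forall>x y. \<bar>x - x0\<bar> < h \<and> \<bar>y - y0\<bar> < h \<longrightarrow> (x, y) \<in> S"
proof -
  obtain A B where AB: "open A" "open B" "x0 \<in> A" "y0 \<in> B" "A \<times> B \<subseteq> S"
    using assms by (elim open_prod_elim) auto
  obtain h1 where "h1 > 0" "\<And>x. \<bar>x - x0\<bar> < h1 \<Longrightarrow> x \<in> A"
    using AB(1,3) by (auto simp: open_dist dist_real_def)
  moreover obtain h2 where "h2 > 0" "\<And>y. \<bar>y - y0\<bar> < h2 \<Longrightarrow> y \<in> B"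
    using AB(2,4) by (auto simp: open_dist dist_real_def)
  ultimately show ?thesis using AB(5) by (intro exI[of _ "min h1 h2"]) auto
qed

lemma descent_left:
  fixes h h' :: "real \<Rightarrow> real"
  assumes der: "\<And>y. (h has_real_derivative h' y) (at y)" and cont: "\<And>S. continuous_on S h'"
    and "c \<le> y" "h' c < 0" "0 \<le> h' y"
  shows "\<exists>z. c \<le> z \<and> z \<le> y \<and> h' z = 0 \<and> (\<forall>t. z \<le> t \<and> t \<le> y \<longrightarrow> h t \<le> h y)"
proof -
  let ?Z = "{t \<in> {c..y}. h' t = 0}"
  have "\<exists>t\<ge>c. t \<le> y \<and> h' t = 0" using assms by (intro IVT') auto
  then have ne: "?Z \<noteq> {}" by auto
  have "closed ?Z" using cont by (intro continuous_closed_preimage_constant) auto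
  then have "compact ({c..y} \<inter> ?Z)" by (rule compact_Int_closed[OF compact_Icc])
  also have "{c..y} \<inter> ?Z = ?Z" by auto
  finally have "compact ?Z" .
  \<comment> \<open>Up to the last critical point before \<open>y\<close> the function decreases when moving left.\<close>
  from compact_attains_sup[OF this ne] obtain z where
    z: "c \<le> z" "z \<le> y" "h' z = 0" and max: "\<And>t. c \<le> t \<Longrightarrow> t \<le> y \<Longrightarrow> h' t = 0 \<Longrightarrow> t \<le> z"
    by auto
  have nonneg: "0 \<le> h' t" if t: "z \<le> t" "t \<le> y" for t
  proof (rule ccontr)
    assume neg: "\<not> 0 \<le> h' t"
    then have "\<exists>u\<ge>t. u \<le> y \<and> h' u = 0" using assms t by (intro IVT') auto
    then obtain u where "t \<le> u" "u \<le> y" "h' u = 0" by blast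
    with max[of u] t z neg have "t = z" by auto
    with z neg show False by simp
  qed
  have "h t \<le> h y" if "z \<le> t" "t \<le> y" for t
    by (rule DERIV_nonneg_imp_nondecreasing) (use that nonneg der in force)+
  with z show ?thesis by blast
qed

text \<open>
  Walking from \<open>y\<close> in the direction in which \<open>h\<close> decreases, one meets a zero of \<open>h'\<close> before
  leaving \<open>{c..d}\<close>, since at both ends \<open>h\<close> decreases towards the interior.
\<close>
lemma descent_to_critical_point:
  fixes h h' :: "real \<Rightarrow> real"
  assumes der: "\<And>y. (h has_real_derivative h' y) (at y)" and cont: "\<And>S. continuous_on S h'"
    and "c \<le> y" "y \<le> d" "h' c < 0" "0 < h' d"
  shows "\<exists>z\<in>{c..d}. h' z = 0 \<and> (\<forall>t\<in>closed_segment z y. h t \<le> h y)"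
proof (cases "0 \<le> h' y")
  case True
  from descent_left[OF der cont \<open>c \<le> y\<close> \<open>h' c < 0\<close> True] obtain z where
    "c \<le> z" "z \<le> y" "h' z = 0" "\<forall>t. z \<le> t \<and> t \<le> y \<longrightarrow> h t \<le> h y" by blast
  with assms show ?thesis by (intro bexI[of _ z]) (auto simp: closed_segment_eq_real_ivl)
next
  case False
  have "((\<lambda>y. h (- y)) has_real_derivative - h' (- y)) (at y)" for y
  proof -
    have "((\<lambda>y. - y) has_real_derivative - 1) (at y)" by (auto intro!: derivative_eq_intros)
    from DERIV_chain2[OF der this] show ?thesis by simp
  qed
  moreover have "continuous_on S (\<lambda>y. - h' (- y))" for S
    by (intro continuous_intros continuous_on_compose2[OF cont[of UNIV]]) auto
  ultimately have "\<exists>z. - d \<le> z \<and> z \<le> - y \<and> - h' (- z) = 0 \<and> (\<forall>t. z \<le> t \<and> t \<le> - y \<longrightarrow> h (- t) \<le> h (- (- y)))"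
    by (rule descent_left) (use assms False in auto)
  then obtain z where z: "- d \<le> z" "z \<le> - y" "h' (- z) = 0" "\<And>t. z \<le> t \<Longrightarrow> t \<le> - y \<Longrightarrow> h (- t) \<le> h y"
    by auto
  have "h t \<le> h y" if "t \<in> closed_segment (- z) y" for t
    using z(4)[of "- t"] that z(2) by (auto simp: closed_segment_eq_real_ivl split: if_splits)
  with z assms show ?thesis by (intro bexI[of _ "- z"]) auto
qed

section \<open>Local shape of a level curve\<close>

text \<open>
  All statements are local at one point, so \<open>C\<close> need only agree with the level set of \<open>\<epsilon>\<close> there.
\<close>
context
  fixes F :: "real poly poly" and C W :: "(real \<times> real) set" and \<epsilon> x0 y0 :: real
  assumes W: "open W" "(x0, y0) \<in> W"
    and level: "C \<inter> W = {p \<in> W. plane_poly F p = \<epsilon>}"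
    and p: "plane_poly F (x0, y0) = \<epsilon>"
begin

text \<open>
  Near the point \<open>C\<close> contains a graph over the \<open>x\<close>-axis, hence points on both sides of the vertical
  line.
\<close>
lemma not_extremal_if_graph:
  assumes "plane_poly (pderiv F) (x0, y0) \<noteq> 0"
  shows "\<not> right_crest C (x0, y0)" "\<not> right_valley C (x0, y0)"
proof -
  interpret g: plane_function "\<lambda>x y. plane_poly (F - [:[:\<epsilon>:]:]) (1 * x, y)"
     "\<lambda>x y. 1 * plane_poly (pderiv_x (F - [:[:\<epsilon>:]:])) (1 * x, y)"
     "\<lambda>x y. plane_poly (pderiv (F - [:[:\<epsilon>:]:])) (1 * x, y)" by (rule plane_function_plane_poly)
  have both: "\<exists>q\<in>C \<inter> U. fst q < x0" "\<exists>q\<in>C \<inter> U. x0 < fst q" if U: "open U" "(x0, y0) \<in> U" for U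
  proof -
    obtain h0 where h0: "h0 > 0" "\<And>x y. \<bar>x - x0\<bar> < h0 \<Longrightarrow> \<bar>y - y0\<bar> < h0 \<Longrightarrow> (x, y) \<in> U \<inter> W"
      using open_square[OF open_Int[OF U(1) W(1)], of x0 y0] U(2) W(2) by auto
    have "\<forall>\<^sub>F h in at_right 0. \<forall>\<^sub>F x in nhds x0. \<exists>u. y0 - h < u \<and> u < y0 + h \<and> plane_poly F (x, u) = \<epsilon>"
    proof (rule eventually_mono[OF g.persistent_simple_root[of x0 y0]])
      show "plane_poly (F - [:[:\<epsilon>:]:]) (1 * x0, y0) = 0"
        using p by (simp add: plane_poly_diff plane_poly_const)
      show "plane_poly (pderiv (F - [:[:\<epsilon>:]:])) (1 * x0, y0) \<noteq> 0"
        using assms by (simp add: pderiv_diff)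
    qed (erule eventually_mono, auto simp: plane_poly_diff plane_poly_const)
    moreover have "\<forall>\<^sub>F h in at_right 0. h < h0" using h0(1) by (auto simp: eventually_at_right_field)
    ultimately have "\<forall>\<^sub>F h in at_right 0. h < h0 \<and> (\<forall>\<^sub>F x in nhds x0. \<exists>u. y0 - h < u \<and> u < y0 + h \<and> plane_poly F (x, u) = \<epsilon>)"
      by eventually_elim blast
    then obtain h where h: "h < h0" "\<forall>\<^sub>F x in nhds x0. \<exists>u. y0 - h < u \<and> u < y0 + h \<and> plane_poly F (x, u) = \<epsilon>"
      using eventually_happens'[OF trivial_limit_at_right_real] by blast
    then obtain k where k: "k > 0" "\<And>x. \<bar>x - x0\<bar> < k \<Longrightarrow> \<exists>u. y0 - h < u \<and> u < y0 + h \<and> plane_poly F (x, u) = \<epsilon>"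
      by (auto simp: eventually_nhds_metric dist_real_def)
    have ex: "\<exists>q\<in>C \<inter> U. fst q = x" if x: "\<bar>x - x0\<bar> < k" "\<bar>x - x0\<bar> < h0" for x
    proof -
      obtain u where u: "y0 - h < u" "u < y0 + h" "plane_poly F (x, u) = \<epsilon>" using k(2)[OF x(1)] by blast
      then have UW: "(x, u) \<in> U \<inter> W" using x(2) h(1) by (intro h0(2)) auto
      with u(3) level have "(x, u) \<in> C" by blast
      with UW show ?thesis by force
    qed
    define m where "m = min k h0 / 2"
    have m: "0 < m" "m < k" "m < h0" using k(1) h0(1) by (auto simp: m_def)
    show "\<exists>q\<in>C \<inter> U. fst q < x0" using ex[of "x0 - m"] m by force
    show "\<exists>q\<in>C \<inter> U. x0 < fst q" using ex[of "x0 + m"] m by force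
  qed
  show "\<not> right_crest C (x0, y0)"
  proof
    assume "right_crest C (x0, y0)"
    then obtain U where U: "open U" "(x0, y0) \<in> U" "\<forall>q\<in>C \<inter> U - {(x0, y0)}. x0 < fst q"
      by (auto simp: right_crest_def)
    with both(1)[OF U(1,2)] show False by force
  qed
  show "\<not> right_valley C (x0, y0)"
  proof
    assume "right_valley C (x0, y0)"
    then obtain U where U: "open U" "(x0, y0) \<in> U" "\<forall>q\<in>C \<inter> U - {(x0, y0)}. fst q < x0"
      by (auto simp: right_valley_def)
    with both(2)[OF U(1,2)] show False by force
  qed
qed

text \<open>
  On the vertical line \<open>x = x0\<close> the function has a strict local extremum with value \<open>\<epsilon>\<close>, a minimum
  if \<open>f\<^sub>y\<^sub>y > 0\<close> and a maximum if \<open>f\<^sub>y\<^sub>y < 0\<close>.  As \<open>f\<close> increases with \<open>x\<close>, the value \<open>\<epsilon>\<close> is taken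
  nearby only to the left of the line in the first case, and only to the right in the second.
\<close>
lemma extremal_if_nondegenerate:
  assumes "0 < x0" and fx: "0 < plane_poly (pderiv_x F) (x0, y0)" and fy: "plane_poly (pderiv F) (x0, y0) = 0"
    and fyy: "plane_poly (pderiv (pderiv F)) (x0, y0) \<noteq> 0"
  shows "right_crest C (x0, y0) \<or> right_valley C (x0, y0)"
proof -
  define s where "s = sgn (plane_poly (pderiv (pderiv F)) (x0, y0))"
  have s: "s = 1 \<or> s = - 1" "s * plane_poly (pderiv (pderiv F)) (x0, y0) > 0"
    using fyy by (auto simp: s_def sgn_if)
  let ?fy = "\<lambda>y. s * plane_poly (pderiv F) (x0, y)"
  have der: "(?fy has_real_derivative s * plane_poly (pderiv (pderiv F)) (x0, y0)) (at y0)"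
    by (intro DERIV_cmult plane_poly_partial_y)
  obtain d1 where d1: "d1 > 0" "\<And>k. 0 < k \<Longrightarrow> k < d1 \<Longrightarrow> 0 < ?fy (y0 + k)"
    using DERIV_pos_inc_right[OF der s(2)] fy by auto
  obtain d2 where d2: "d2 > 0" "\<And>k. 0 < k \<Longrightarrow> k < d2 \<Longrightarrow> ?fy (y0 - k) < 0"
    using DERIV_pos_inc_left[OF der s(2)] fy by auto
  have der_f: "((\<lambda>y. s * plane_poly F (x0, y)) has_real_derivative ?fy y) (at y)" for y
    by (intro DERIV_cmult plane_poly_partial_y)
  have cont_f: "continuous_on S (\<lambda>y. s * plane_poly F (x0, y))" for S by (intro continuous_intros)
  have vert: "s * \<epsilon> < s * plane_poly F (x0, y)" if y: "\<bar>y - y0\<bar> < min d1 d2" "y \<noteq> y0" for y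
  proof (cases "y0 < y")
    case True
    have "s * plane_poly F (x0, y0) < s * plane_poly F (x0, y)"
    proof (rule DERIV_pos_imp_increasing_open[OF True _ cont_f])
      fix t assume "y0 < t" "t < y"
      then show "\<exists>D. ((\<lambda>y. s * plane_poly F (x0, y)) has_real_derivative D) (at t) \<and> 0 < D"
        using d1(2)[of "t - y0"] y der_f[of t] by auto
    qed
    then show ?thesis using p by simp
  next
    case False
    with y have less: "y < y0" by simp
    have "s * plane_poly F (x0, y0) < s * plane_poly F (x0, y)"
    proof (rule DERIV_neg_imp_decreasing_open[OF less _ cont_f])
      fix t assume "y < t" "t < y0"
      then show "\<exists>D. ((\<lambda>y. s * plane_poly F (x0, y)) has_real_derivative D) (at t) \<and> D < 0"
        using d2(2)[of "y0 - t"] y der_f[of t] by auto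
    qed
    then show ?thesis using p by simp
  qed
  have "open (W \<inter> plane_poly (pderiv_x F) -` {0<..})"
    using W(1) by (intro open_Int open_vimage continuous_on_plane_poly) auto
  then obtain h where h: "h > 0" "\<And>x y. \<bar>x - x0\<bar> < h \<Longrightarrow> \<bar>y - y0\<bar> < h \<Longrightarrow>
     (x, y) \<in> W \<and> 0 < plane_poly (pderiv_x F) (x, y)"
    using open_square[of "W \<inter> plane_poly (pderiv_x F) -` {0<..}" x0 y0] W(2) fx by auto
  have incr: "plane_poly F (u, y) < plane_poly F (v, y)"
    if "u < v" "\<bar>u - x0\<bar> < h" "\<bar>v - x0\<bar> < h" "\<bar>y - y0\<bar> < h" for u v y
    using that(1)
  proof (rule DERIV_pos_imp_increasing)
    fix x assume "u \<le> x" "x \<le> v"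
    then show "\<exists>D. ((\<lambda>x. plane_poly F (x, y)) has_real_derivative D) (at x) \<and> 0 < D"
      using h(2)[of x y] that plane_poly_partial_x[of F y x] by (intro exI[of _ "plane_poly (pderiv_x F) (x, y)"]) auto
  qed
  define m where "m = min h (min d1 d2)"
  have m: "m > 0" "m \<le> h" "m \<le> min d1 d2" using h(1) d1(1) d2(1) by (auto simp: m_def)
  define U where "U = {x0 - m<..<x0 + m} \<times> {y0 - m<..<y0 + m}"
  have U: "open U" "(x0, y0) \<in> U" using m(1) by (auto simp: U_def open_Times)
  have side: "0 < s * (x0 - fst q)" if q: "q \<in> C \<inter> U - {(x0, y0)}" for q
  proof (rule ccontr)
    assume neg: "\<not> ?thesis"
    obtain x y where xy: "q = (x, y)" by fastforce
    have near: "\<bar>x - x0\<bar> < h" "\<bar>y - y0\<bar> < h" "\<bar>y - y0\<bar> < min d1 d2" "\<bar>x0 - x0\<bar> < h"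
      using q m h(1) by (auto simp: xy U_def)
    have "(x, y) \<in> W" using h(2) near by blast
    with q level have fq: "plane_poly F (x, y) = \<epsilon>" by (auto simp: xy)
    have 1: "s * \<epsilon> \<le> s * plane_poly F (x0, y)" "y \<noteq> y0 \<Longrightarrow> s * \<epsilon> < s * plane_poly F (x0, y)"
      using vert[OF near(3)] p by (cases "y = y0"; force)+
    have 2: "s * plane_poly F (x0, y) < s * plane_poly F (x, y)" if "x \<noteq> x0"
      using s(1) incr[of x0 x y] incr[of x x0 y] near neg that by (auto simp: xy)
    show False
      using 1 2 fq q by (cases "x = x0") (auto simp: xy)
  qed
  have mem: "(x0, y0) \<in> C" using W(2) p level by blast
  from s(1) show ?thesis
  proof
    assume "s = 1"
    then have "\<forall>q\<in>C \<inter> U - {(x0, y0)}. fst q < x0" using side by simp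
    then have "right_valley C (x0, y0)"
      unfolding right_valley_def fst_conv using mem U \<open>0 < x0\<close> by blast
    then show ?thesis ..
  next
    assume "s = - 1"
    then have "\<forall>q\<in>C \<inter> U - {(x0, y0)}. x0 < fst q" using side by simp
    then have "right_crest C (x0, y0)"
      unfolding right_crest_def fst_conv using mem U \<open>0 < x0\<close> by blast
    then show ?thesis ..
  qed
qed

text \<open>
  Near the point \<open>C\<close> is the graph \<open>x = \<psi>(y)\<close> of an implicit function, with
  \<open>\<psi>' = - f\<^sub>y / f\<^sub>x\<close>, which vanishes at \<open>y0\<close>.
\<close>
lemma vertical_tangent_if_polar:
  assumes fx: "plane_poly (pderiv_x F) (x0, y0) \<noteq> 0" and fy: "plane_poly (pderiv F) (x0, y0) = 0"
  shows "vertical_tangent C (x0, y0)"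
proof -
  interpret g: plane_function "\<lambda>y x. plane_poly F (x, y) - \<epsilon>"
     "\<lambda>y x. plane_poly (pderiv F) (x, y)" "\<lambda>y x. plane_poly (pderiv_x F) (x, y)"
    by standard (auto simp: case_prod_unfold intro!: continuous_intros derivative_eq_intros
        plane_poly_partial_x plane_poly_partial_y)
  obtain h0 where h0: "h0 > 0" "\<And>x y. \<bar>x - x0\<bar> < h0 \<Longrightarrow> \<bar>y - y0\<bar> < h0 \<Longrightarrow>
      (x, y) \<in> W \<and> plane_poly (pderiv_x F) (x, y) \<noteq> 0"
  proof -
    have "open (W \<inter> plane_poly (pderiv_x F) -` (- {0}))"
      using W(1) by (intro open_Int open_vimage continuous_on_plane_poly) auto
    from open_square[OF this, of x0 y0] show ?thesis using W(2) fx that by auto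
  qed
  have "\<forall>\<^sub>F h in at_right 0. h < h0" using h0(1) by (auto simp: eventually_at_right_field)
  moreover have "\<forall>\<^sub>F h in at_right (0::real). h > 0" by (simp add: eventually_at_right_less)
  moreover have "\<forall>\<^sub>F h in at_right 0. \<forall>\<^sub>F y in nhds y0. \<exists>u. x0 - h < u \<and> u < x0 + h \<and>
      plane_poly F (u, y) - \<epsilon> = 0 \<and> (\<forall>v. x0 - h \<le> v \<and> v \<le> x0 + h \<and> plane_poly F (v, y) - \<epsilon> = 0 \<longrightarrow> v = u)"
    by (rule g.persistent_simple_root) (use p fx in auto)
  ultimately have "\<forall>\<^sub>F h in at_right 0. h < h0 \<and> h > 0 \<and> (\<forall>\<^sub>F y in nhds y0. \<exists>u. x0 - h < u \<and> u < x0 + h \<and>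
      plane_poly F (u, y) - \<epsilon> = 0 \<and> (\<forall>v. x0 - h \<le> v \<and> v \<le> x0 + h \<and> plane_poly F (v, y) - \<epsilon> = 0 \<longrightarrow> v = u))"
    by eventually_elim blast
  from eventually_happens'[OF trivial_limit_at_right_real this]
  obtain h where h: "h < h0" "h > 0" and "\<forall>\<^sub>F y in nhds y0. \<exists>u. x0 - h < u \<and> u < x0 + h \<and>
      plane_poly F (u, y) - \<epsilon> = 0 \<and> (\<forall>v. x0 - h \<le> v \<and> v \<le> x0 + h \<and> plane_poly F (v, y) - \<epsilon> = 0 \<longrightarrow> v = u)"
    by (elim exE conjE)
  then obtain k0 where k0: "k0 > 0" "\<forall>y. \<bar>y - y0\<bar> < k0 \<longrightarrow> (\<exists>u. x0 - h < u \<and> u < x0 + h \<and>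
      plane_poly F (u, y) - \<epsilon> = 0 \<and> (\<forall>v. x0 - h \<le> v \<and> v \<le> x0 + h \<and> plane_poly F (v, y) - \<epsilon> = 0 \<longrightarrow> v = u))"
    unfolding eventually_nhds_metric dist_real_def by (elim exE conjE)
  define k where "k = min k0 h0"
  let ?J = "{y0 - k<..<y0 + k}"
  have k: "k > 0" "\<And>y. y \<in> ?J \<Longrightarrow> \<bar>y - y0\<bar> < k0 \<and> \<bar>y - y0\<bar> < h0"
    using k0(1) h0(1) by (auto simp: k_def)
  have zeros: "\<exists>u. g.zeros (x0 - h) (x0 + h) y = {u} \<and> x0 - h < u \<and> u < x0 + h" if "y \<in> ?J" for y
  proof -
    have "\<bar>y - y0\<bar> < k0" using k(2)[OF that] by simp
    from k0(2)[rule_format, OF this] obtain u where u: "x0 - h < u" "u < x0 + h" "plane_poly F (u, y) - \<epsilon> = 0"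
      "\<forall>v. x0 - h \<le> v \<and> v \<le> x0 + h \<and> plane_poly F (v, y) - \<epsilon> = 0 \<longrightarrow> v = u" by (elim exE conjE)
    then have "g.zeros (x0 - h) (x0 + h) y = {u}" unfolding g.zeros_def by (intro equalityI subsetI) simp_all
    with u show ?thesis by blast
  qed
  have "\<exists>(n::nat) \<phi>. (\<forall>i\<in>{1..n}. continuous_on ?J (\<phi> i)) \<and>
     (\<forall>y\<in>?J. (\<lambda>i. \<phi> i y) ` {1..n} = g.zeros (x0 - h) (x0 + h) y) \<and>
     (\<forall>y\<in>?J. \<forall>i\<in>{1..n}. \<forall>j\<in>{1..n}. i < j \<longrightarrow> \<phi> i y < \<phi> j y)"
  proof (rule g.root_branches)
    fix y assume y: "y \<in> ?J"
    obtain u where u: "g.zeros (x0 - h) (x0 + h) y = {u}" "x0 - h < u" "u < x0 + h" using zeros[OF y] by blast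
    then show "finite (g.zeros (x0 - h) (x0 + h) y)" by simp
    have "x0 - h \<notin> g.zeros (x0 - h) (x0 + h) y" "x0 + h \<notin> g.zeros (x0 - h) (x0 + h) y" using u by auto
    then show "plane_poly F (x0 - h, y) - \<epsilon> \<noteq> 0 \<and> plane_poly F (x0 + h, y) - \<epsilon> \<noteq> 0"
      using h(2) by (auto simp: g.zeros_def)
    show "plane_poly (pderiv_x F) (x, y) \<noteq> 0" if "x \<in> g.zeros (x0 - h) (x0 + h) y" for x
    proof -
      have "\<bar>x - x0\<bar> < h0" using that h unfolding g.zeros_def by (simp add: abs_less_iff)
      with h0(2)[of x y] k(2)[OF y] show ?thesis by blast
    qed
  qed
  \<comment> \<open>There is exactly one root for every \<open>y\<close>, so the branch number \<open>1\<close> is the implicit function.\<close>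
  then obtain n :: nat and \<phi> where \<phi>: "\<forall>i\<in>{1..n}. continuous_on ?J (\<phi> i)"
     "\<forall>y\<in>?J. (\<lambda>i. \<phi> i y) ` {1..n} = g.zeros (x0 - h) (x0 + h) y" by (elim exE conjE)
  define \<psi> where "\<psi> = \<phi> 1"
  have n: "1 \<in> {1..n}"
  proof -
    have y0: "y0 \<in> ?J" using k(1) by simp
    have "g.zeros (x0 - h) (x0 + h) y0 \<noteq> {}" using zeros[OF y0] by auto
    with \<phi>(2) y0 have "{1..n} \<noteq> {}" by force
    then show ?thesis by simp
  qed
  have \<psi>_cont: "continuous_on ?J \<psi>" using \<phi>(1) n by (simp add: \<psi>_def)
  have \<psi>: "g.zeros (x0 - h) (x0 + h) y = {\<psi> y}" "x0 - h < \<psi> y" "\<psi> y < x0 + h" if y: "y \<in> ?J" for y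
  proof -
    have "\<psi> y \<in> g.zeros (x0 - h) (x0 + h) y" using \<phi>(2) y n by (force simp: \<psi>_def)
    with zeros[OF y] show "g.zeros (x0 - h) (x0 + h) y = {\<psi> y}" "x0 - h < \<psi> y" "\<psi> y < x0 + h" by auto
  qed
  have root: "plane_poly F (x, y) = \<epsilon> \<longleftrightarrow> x = \<psi> y" if "y \<in> ?J" "x0 - h < x" "x < x0 + h" for x y
  proof -
    have "x \<in> g.zeros (x0 - h) (x0 + h) y \<longleftrightarrow> plane_poly F (x, y) = \<epsilon>"
      using that by (auto simp: g.zeros_def)
    then show ?thesis using \<psi>(1)[OF that(1)] by simp
  qed
  have fx_nz: "plane_poly (pderiv_x F) (\<psi> y, y) \<noteq> 0" if y: "y \<in> ?J" for y
    using h0(2)[of "\<psi> y" y] \<psi>(2,3)[OF y] h k(2)[OF y] by auto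
  define D where "D y = - plane_poly (pderiv F) (\<psi> y, y) / plane_poly (pderiv_x F) (\<psi> y, y)" for y
  have der: "(\<psi> has_real_derivative D y) (at y)" if y: "y \<in> ?J" for y
    unfolding D_def
  proof (rule g.implicit_derivative)
    show "isCont \<psi> y" using \<psi>_cont y by (simp add: continuous_on_eq_continuous_at)
    have "\<forall>\<^sub>F t in nhds y. t \<in> ?J" using y by (intro eventually_nhds_in_open) auto
    then show "\<forall>\<^sub>F t in nhds y. plane_poly F (\<psi> t, t) - \<epsilon> = 0"
      by eventually_elim (use root \<psi> in auto)
  qed (rule fx_nz[OF y])
  have D_cont: "continuous_on ?J D"
    unfolding D_def using fx_nz by (intro continuous_intros \<psi>_cont) auto
  define c where "c t = (\<psi> (y0 + t), y0 + t)" for t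
  let ?I = "{- k<..<k}"
  have shift: "y0 + t \<in> ?J" if "t \<in> ?I" for t using that by auto
  have c_der: "(c has_vector_derivative (D (y0 + t), 1)) (at t)" if t: "t \<in> ?I" for t
  proof -
    have 1: "((\<lambda>t. y0 + t) has_real_derivative 1) (at t)" by (auto intro!: derivative_eq_intros)
    have "((\<lambda>t. \<psi> (y0 + t)) has_real_derivative D (y0 + t)) (at t)"
      using DERIV_chain2[OF der[OF shift[OF t]] 1] by simp
    with 1 show ?thesis
      unfolding c_def has_real_derivative_iff_has_vector_derivative by (intro has_vector_derivative_Pair)
  qed
  have "local_parametrization C (x0, y0) k c"
    unfolding local_parametrization_def
  proof (intro conjI)
    have "\<psi> y0 = x0" using root[of y0 x0] k(1) h(2) p by simp
    then show "c 0 = (x0, y0)" by (simp add: c_def)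
    show "c C1_differentiable_on ?I"
      unfolding C1_differentiable_on_def
    proof (intro exI conjI ballI)
      show "(c has_vector_derivative (D (y0 + t), 1)) (at t)" if "t \<in> ?I" for t using c_der[OF that] .
      show "continuous_on ?I (\<lambda>t. (D (y0 + t), 1))"
        by (intro continuous_intros continuous_on_compose2[OF D_cont]) (use shift in auto)
    qed
    show "\<forall>t\<in>?I. vector_derivative c (at t) \<noteq> 0"
      using vector_derivative_at[OF c_der] by (auto simp: zero_prod_def)
    let ?U = "{x0 - h<..<x0 + h} \<times> ?J"
    have UW: "?U \<subseteq> W" using h0(2) h k(2) by (auto simp: abs_less_iff)
    have "homeomorphism ?I (C \<inter> ?U) c (\<lambda>q. snd q - y0)"
    proof (rule homeomorphismI)
      show "continuous_on ?I c"
        using c_der by (meson continuous_at_imp_continuous_on has_vector_derivative_continuous)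
      show "continuous_on (C \<inter> ?U) (\<lambda>q. snd q - y0)" by (intro continuous_intros)
      show "c ` ?I \<subseteq> C \<inter> ?U"
      proof
        fix q assume "q \<in> c ` ?I"
        then obtain t where t: "t \<in> ?I" "q = c t" by blast
        note shift = shift[OF t(1)]
        have U: "c t \<in> ?U" using \<psi>(2,3)[OF shift] shift by (simp add: c_def)
        have "plane_poly F (c t) = \<epsilon>"
          using root[OF shift] \<psi>(2,3)[OF shift] by (simp add: c_def)
        with U UW have "c t \<in> {p \<in> W. plane_poly F p = \<epsilon>}" by auto
        then have "c t \<in> C" unfolding level[symmetric] by simp
        with U t(2) show "q \<in> C \<inter> ?U" by simp
      qed
      show "(\<lambda>q. snd q - y0) ` (C \<inter> ?U) \<subseteq> ?I" by auto
      show "c (snd q - y0) = q" if q: "q \<in> C \<inter> ?U" for q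
      proof -
        have "q \<in> C \<inter> W" using q UW by blast
        then have "plane_poly F q = \<epsilon>" unfolding level by simp
        with q root[of "snd q" "fst q"] show ?thesis by (cases q) (auto simp: c_def)
      qed
    qed (simp add: c_def)
    moreover have "open ?U" "(x0, y0) \<in> ?U" using h(2) k(1) by (auto simp: open_Times)
    ultimately show "\<exists>U k'. open U \<and> (x0, y0) \<in> U \<and> homeomorphism ?I (C \<inter> U) c k'" by blast
  qed (rule k(1))
  moreover have "fst (vector_derivative c (at 0)) = 0"
  proof -
    have "\<psi> y0 = x0" using root[of y0 x0] k(1) h(2) p by simp
    then have "D y0 = 0" using fy by (simp add: D_def)
    then show ?thesis using vector_derivative_at[OF c_der[of 0]] k(1) by simp
  qed
  ultimately show ?thesis unfolding vertical_tangent_def by blast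
qed

end

section \<open>Half-branches of the polar curve\<close>

text \<open>
  In the right half-plane \<open>Arg\<close> takes values in \<open>(-\<pi>/2, \<pi>/2)\<close>, where the sine is increasing.
\<close>
lemma Arg_less_on_circle:
  assumes "0 < x" "0 < x'" "x\<^sup>2 + y\<^sup>2 = x'\<^sup>2 + y'\<^sup>2" "y < y'"
  shows "Arg (Complex x y) < Arg (Complex x' y')"
proof (rule ccontr)
  let ?p = "Complex x y" and ?q = "Complex x' y'"
  assume "\<not> Arg ?p < Arg ?q"
  moreover have "\<bar>Arg ?p\<bar> < pi / 2" "\<bar>Arg ?q\<bar> < pi / 2"
    using Arg_Re_pos[of ?p] Arg_Re_pos[of ?q] assms(1,2) by auto
  ultimately have "sin (Arg ?q) \<le> sin (Arg ?p)" by (intro sin_monotone_2pi_le) auto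
  moreover have "norm ?p = norm ?q" using assms(3) by (simp add: cmod_def)
  moreover have "norm ?p > 0" using assms(1) by (simp add: complex_eq_iff)
  moreover have "sin (Arg z) = Im z / norm z" if "z \<noteq> 0" for z
  proof -
    have "Im z = norm z * sin (Arg z)" by (metis Im_rcis rcis_cmod_Arg)
    with that show ?thesis by simp
  qed
  ultimately show False using assms by (simp add: complex_eq_iff divide_le_cancel)
qed

context polar_side
begin

lemma s_square: "s * s = 1"
  using s by auto

definition arc :: "real \<Rightarrow> nat \<Rightarrow> (real \<times> real) set" where
  "arc r i = {(s * x, \<phi> i x) | x. 0 < x \<and> x \<le> a \<and> x\<^sup>2 + (\<phi> i x)\<^sup>2 < r\<^sup>2}"

lemma radius_less_iff:
  assumes "i \<in> {1..n}" "0 \<le> x" "x \<le> a" "0 \<le> x'" "x' \<le> a"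
  shows "x\<^sup>2 + (\<phi> i x)\<^sup>2 < x'\<^sup>2 + (\<phi> i x')\<^sup>2 \<longleftrightarrow> x < x'"
  using strict_mono_on_less[OF radius_mono[OF assms(1)], of x x'] assms by auto

lemma f_less_iff:
  assumes "i \<in> {1..n}" "0 \<le> x" "x \<le> a" "0 \<le> x'" "x' \<le> a"
  shows "plane_poly F (s * x, \<phi> i x) < plane_poly F (s * x', \<phi> i x') \<longleftrightarrow> x < x'"
  using strict_mono_on_less[OF f_mono[OF assms(1)], of x x'] assms by auto

text \<open>
  The distance to the origin increases along the branch, so the part inside the disc of radius \<open>r\<close>
  is an initial piece; it ends inside the box because \<open>r \<le> a\<close>.
\<close>
lemma arc_end:
  assumes i: "i \<in> {1..n}" and r: "0 < r" "r \<le> a"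
  shows "\<exists>\<xi>. 0 < \<xi> \<and> \<xi> \<le> a \<and> \<xi>\<^sup>2 + (\<phi> i \<xi>)\<^sup>2 = r\<^sup>2 \<and> arc r i = (\<lambda>x. (s * x, \<phi> i x)) ` {0<..<\<xi>}"
proof -
  have "r\<^sup>2 \<le> a\<^sup>2" using r by (intro power_mono) auto
  then have "r\<^sup>2 \<le> a\<^sup>2 + (\<phi> i a)\<^sup>2" by (simp add: add_increasing2)
  then have "\<exists>\<xi>\<ge>0. \<xi> \<le> a \<and> \<xi>\<^sup>2 + (\<phi> i \<xi>)\<^sup>2 = r\<^sup>2"
    using r branch_0[OF i] by (intro IVT') (auto intro!: continuous_intros branch_cont[OF i])
  then obtain \<xi> where \<xi>: "0 \<le> \<xi>" "\<xi> \<le> a" "\<xi>\<^sup>2 + (\<phi> i \<xi>)\<^sup>2 = r\<^sup>2" by blast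
  have "\<xi> \<noteq> 0" using \<xi>(3) branch_0[OF i] r(1) by auto
  with \<xi>(1) have pos: "0 < \<xi>" by simp
  have less: "x\<^sup>2 + (\<phi> i x)\<^sup>2 < r\<^sup>2 \<longleftrightarrow> x < \<xi>" if "0 < x" "x \<le> a" for x
    using radius_less_iff[OF i, of x \<xi>] that \<xi> by simp
  have "arc r i = (\<lambda>x. (s * x, \<phi> i x)) ` {0<..<\<xi>}"
  proof (intro equalityI subsetI)
    fix p assume "p \<in> arc r i"
    then obtain x where x: "0 < x" "x \<le> a" "x\<^sup>2 + (\<phi> i x)\<^sup>2 < r\<^sup>2" "p = (s * x, \<phi> i x)"
      by (auto simp: arc_def)
    with less[of x] have "x \<in> {0<..<\<xi>}" by simp
    with x(4) show "p \<in> (\<lambda>x. (s * x, \<phi> i x)) ` {0<..<\<xi>}" by blast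
  next
    fix p assume "p \<in> (\<lambda>x. (s * x, \<phi> i x)) ` {0<..<\<xi>}"
    then obtain x where x: "0 < x" "x < \<xi>" "p = (s * x, \<phi> i x)" by auto
    with less[of x] \<xi>(2) show "p \<in> arc r i" unfolding arc_def by auto
  qed
  with pos \<xi> show ?thesis by blast
qed

lemma arc_nonempty:
  assumes "i \<in> {1..n}" "0 < r" "r \<le> a"
  shows "arc r i \<noteq> {}"
  using arc_end[OF assms] by auto

lemma arc_side: "p \<in> arc r i \<Longrightarrow> 0 < s * fst p"
  using s_square by (auto simp: arc_def mult.assoc[symmetric])

lemma half_branch_arc:
  assumes i: "i \<in> {1..n}" and r: "0 < r" "r \<le> a"
  shows "half_branch (arc r i)"
proof -
  obtain \<xi> where \<xi>: "0 < \<xi>" "\<xi> \<le> a" "arc r i = (\<lambda>x. (s * x, \<phi> i x)) ` {0<..<\<xi>}"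
    using arc_end[OF assms] by blast
  define h where "h t = (s * (\<xi> * t), \<phi> i (\<xi> * t))" for t
  define k where "k p = s * fst p / \<xi>" for p :: "real \<times> real"
  have h0: "h 0 = (0, 0)" by (simp add: h_def branch_0[OF i])
  have img: "h ` {0..<1} = insert (0, 0) (arc r i)"
  proof -
    have "{0..<1::real} = insert 0 {0<..<1}" by auto
    moreover have "h ` {0<..<1} = (\<lambda>x. (s * x, \<phi> i x)) ` ((\<lambda>t. \<xi> * t) ` {0<..<1})"
      by (simp add: h_def image_image)
    moreover have "(\<lambda>t. \<xi> * t) ` {0<..<1} = {0<..<\<xi>}"
    proof (intro equalityI subsetI)
      fix x assume "x \<in> {0<..<\<xi>}"
      then show "x \<in> (\<lambda>t. \<xi> * t) ` {0<..<1}" by (intro image_eqI[of _ _ "x / \<xi>"]) auto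
    qed (use \<xi>(1) in auto)
    ultimately show ?thesis using h0 \<xi>(3) by simp
  qed
  have "continuous_on {0..<1} h"
  proof -
    have "\<xi> * t \<le> a" if "0 \<le> t" "t < 1" for t
      using that \<xi> mult_left_le[of t \<xi>] by linarith
    then show ?thesis
      unfolding h_def using \<xi>(1)
      by (intro continuous_intros continuous_on_compose2[OF branch_cont[OF i]]) auto
  qed
  moreover have "continuous_on (h ` {0..<1}) k"
    unfolding k_def using \<xi>(1) by (intro continuous_intros) auto
  moreover have "k (h t) = t" for t
    using \<xi>(1) s_square by (simp add: k_def h_def mult.assoc[symmetric])
  ultimately have "homeomorphism {0..<1} (h ` {0..<1}) h k"
    by (intro homeomorphismI) auto
  then have "homeomorphism {0..<1} (insert (0, 0) (arc r i)) h k" unfolding img .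
  moreover have "(0, 0) \<notin> arc r i" using arc_side by force
  ultimately show ?thesis using h0 unfolding half_branch_def by blast
qed

lemma disjnt_arcs:
  assumes "i \<in> {1..n}" "j \<in> {1..n}" "i \<noteq> j"
  shows "disjnt (arc r i) (arc r j)"
proof -
  have "s \<noteq> 0" using s by auto
  moreover have "\<phi> i x \<noteq> \<phi> j x" if "0 < x" "x \<le> a" for x
    using branch_less[OF assms(1,2), of x] branch_less[OF assms(2,1), of x] assms(3) that
    by (cases "i < j") auto
  ultimately show ?thesis by (auto simp: disjnt_def arc_def)
qed

lemma inj_on_arc:
  assumes "0 < r" "r \<le> a"
  shows "inj_on (arc r) {1..n}"
proof (rule inj_onI)
  fix i j assume "i \<in> {1..n}" "j \<in> {1..n}" "arc r i = arc r j"
  then show "i = j" using disjnt_arcs[of i j r] arc_nonempty[of i r] assms by (auto simp: disjnt_def)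
qed

lemma polar_in_disc_iff:
  assumes "0 < r" "r \<le> a" "r \<le> b" "0 < x"
  shows "(s * x, y) \<in> polar_curve F \<and> x\<^sup>2 + y\<^sup>2 < r\<^sup>2 \<longleftrightarrow> (\<exists>i\<in>{1..n}. (s * x, y) \<in> arc r i)"
proof
  assume *: "(s * x, y) \<in> polar_curve F \<and> x\<^sup>2 + y\<^sup>2 < r\<^sup>2"
  then have "x\<^sup>2 < r\<^sup>2" "\<bar>y\<bar>\<^sup>2 < r\<^sup>2"
    using zero_le_power2[of x] zero_le_power2[of y] by (simp, linarith)+
  then have "x < r" "\<bar>y\<bar> < r" using assms(1) by (meson power2_less_imp_less less_imp_le)+
  then have "x \<le> a" "\<bar>y\<bar> \<le> b" using assms by auto
  moreover have "plane_poly (pderiv F) (s * x, y) = 0" using * by (simp add: polar_curve_def)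
  ultimately obtain i where "i \<in> {1..n}" "y = \<phi> i x" using polar_iff[of x y] assms(4) by auto
  with * assms(4) \<open>x \<le> a\<close> show "\<exists>i\<in>{1..n}. (s * x, y) \<in> arc r i" by (auto simp: arc_def)
next
  assume "\<exists>i\<in>{1..n}. (s * x, y) \<in> arc r i"
  then obtain i where i: "i \<in> {1..n}" "(s * x, y) \<in> arc r i" by blast
  then have xy: "x \<le> a" "y = \<phi> i x" "x\<^sup>2 + y\<^sup>2 < r\<^sup>2" using s by (auto simp: arc_def)
  moreover have "plane_poly (pderiv F) (s * x, y) = 0"
    using polar_iff[of x y] branch_bound[OF i(1), of x] i(1) xy assms(4) by auto
  ultimately show "(s * x, y) \<in> polar_curve F \<and> x\<^sup>2 + y\<^sup>2 < r\<^sup>2" by (simp add: polar_curve_def)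
qed

lemma branch_connects_to_origin:
  assumes i: "i \<in> {1..n}" and x: "0 < x" "x \<le> a"
  shows "\<exists>T. connected T \<and> (0, 0) \<in> T \<and> (s * x, \<phi> i x) \<in> T \<and>
     (\<forall>p\<in>T. \<bar>fst p\<bar> \<le> a \<and> \<bar>snd p\<bar> \<le> b \<and> plane_poly F p \<le> plane_poly F (s * x, \<phi> i x))"
proof (intro exI conjI ballI)
  let ?T = "(\<lambda>t. (s * t, \<phi> i t)) ` {0..x}"
  show "connected ?T"
    using x by (intro connected_continuous_image continuous_intros
        continuous_on_subset[OF branch_cont[OF i]]) auto
  show "(0, 0) \<in> ?T" using x branch_0[OF i] by (intro image_eqI[of _ _ 0]) auto
  show "(s * x, \<phi> i x) \<in> ?T" using x by auto
  fix p assume "p \<in> ?T"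
  then obtain t where t: "0 \<le> t" "t \<le> x" "p = (s * t, \<phi> i t)" by auto
  show "\<bar>fst p\<bar> \<le> a" using t x s by auto
  show "\<bar>snd p\<bar> \<le> b" using t x branch_bound[OF i, of t] by simp
  show "plane_poly F p \<le> plane_poly F (s * x, \<phi> i x)"
    using f_less_iff[OF i, of x t] t x by (simp add: linorder_not_less[symmetric])
qed

text \<open>
  On the right half of the circle of radius \<open>\<rho>\<close>, parametrized by the ordinate \<open>t\<close>, the height
  \<open>g t\<close> above the branch \<open>i\<close> has a single zero, at the point of that branch on the circle, since
  the distance to the origin is injective along the branch.  It is negative at the lowest point of
  the circle and positive at the point of the branch \<open>j\<close>, which lies above the branch \<open>i\<close>; so the
  zero comes first.
\<close>
lemma trig_less_arc:
  assumes "s = 1" "0 < a" and ij: "i \<in> {1..n}" "j \<in> {1..n}" "i < j"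
  shows "trig_less (arc r i) (arc r j)"
  unfolding trig_less_def
proof (intro exI[of _ a] conjI ballI)
  show "0 < a" by fact
  fix \<rho> p q assume \<rho>: "\<rho> \<in> {0<..<a}" and p: "p \<in> arc r i \<inter> sphere (0, 0) \<rho>" and q: "q \<in> arc r j \<inter> sphere (0, 0) \<rho>"
  have sphere: "x\<^sup>2 + y\<^sup>2 = \<rho>\<^sup>2" if "(x, y) \<in> sphere (0, 0) \<rho>" for x y :: real
    using that \<rho> by (auto simp: dist_Pair_Pair dist_real_def)
  obtain x where x: "0 < x" "x \<le> a" "p = (s * x, \<phi> i x)"
    using p by (auto simp: arc_def)
  define y where "y = \<phi> i x"
  have xy: "p = (x, y)" "0 < x" "x \<le> a" "y = \<phi> i x" "x\<^sup>2 + y\<^sup>2 = \<rho>\<^sup>2"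
    using x p sphere[of x y] \<open>s = 1\<close> by (simp_all add: y_def)
  obtain x' where x': "0 < x'" "x' \<le> a" "q = (s * x', \<phi> j x')"
    using q by (auto simp: arc_def)
  define y' where "y' = \<phi> j x'"
  have xy': "q = (x', y')" "0 < x'" "x' \<le> a" "y' = \<phi> j x'" "x'\<^sup>2 + y'\<^sup>2 = \<rho>\<^sup>2"
    using x' q sphere[of x' y'] \<open>s = 1\<close> by (simp_all add: y'_def)
  define g where "g t = t - \<phi> i (sqrt (\<rho>\<^sup>2 - t\<^sup>2))" for t
  have range: "\<rho>\<^sup>2 - t\<^sup>2 \<ge> 0" "sqrt (\<rho>\<^sup>2 - t\<^sup>2) \<le> a" if "- \<rho> \<le> t" "t \<le> \<rho>" for t
  proof -
    have "\<bar>t\<bar> \<le> \<rho>" using that by auto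
    then show "\<rho>\<^sup>2 - t\<^sup>2 \<ge> 0" using abs_le_square_iff[of t \<rho>] \<rho> by simp
    have "sqrt (\<rho>\<^sup>2 - t\<^sup>2) \<le> sqrt (\<rho>\<^sup>2)" by (intro real_sqrt_le_mono) auto
    then show "sqrt (\<rho>\<^sup>2 - t\<^sup>2) \<le> a" using \<rho> by simp
  qed
  have cont: "continuous_on {- \<rho>..\<rho>} g"
    unfolding g_def by (intro continuous_intros continuous_on_compose2[OF branch_cont[OF ij(1)]]) (use range in auto)
  have zero: "t = y" if t: "- \<rho> \<le> t" "t \<le> \<rho>" "g t = 0" for t
  proof -
    let ?u = "sqrt (\<rho>\<^sup>2 - t\<^sup>2)"
    have u: "0 \<le> ?u" "?u \<le> a" "\<phi> i ?u = t" "?u\<^sup>2 + t\<^sup>2 = \<rho>\<^sup>2" using range t by (auto simp: g_def)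
    have "?u = x"
      using radius_less_iff[OF ij(1), of ?u x] radius_less_iff[OF ij(1), of x ?u] u xy by auto
    with u xy show ?thesis by simp
  qed
  have y': "- \<rho> \<le> y'" "y' \<le> \<rho>" "sqrt (\<rho>\<^sup>2 - y'\<^sup>2) = x'"
  proof -
    have "y'\<^sup>2 \<le> \<rho>\<^sup>2" using xy'(5) zero_le_power2[of x'] by linarith
    then have "\<bar>y'\<bar> \<le> \<rho>" using abs_le_square_iff[of y' \<rho>] \<rho> by simp
    then show "- \<rho> \<le> y'" "y' \<le> \<rho>" by auto
    have "\<rho>\<^sup>2 - y'\<^sup>2 = x'\<^sup>2" using xy'(5) by simp
    then show "sqrt (\<rho>\<^sup>2 - y'\<^sup>2) = x'" using xy'(2) by simp
  qed
  have pos: "0 < g y'" using branch_less[OF ij] xy' y' by (simp add: g_def)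
  have "g (- \<rho>) < 0" using \<rho> branch_0[OF ij(1)] by (simp add: g_def)
  then have "\<exists>t\<ge>- \<rho>. t \<le> y' \<and> g t = 0"
    using pos y' by (intro IVT' continuous_on_subset[OF cont]) auto
  then obtain t where t: "- \<rho> \<le> t" "t \<le> y'" "g t = 0" by blast
  with zero[of t] y' have "y \<le> y'" by simp
  moreover have "y \<noteq> y'" using zero[of t] t y' pos by auto
  ultimately have "y < y'" by simp
  then show "Arg (Complex (fst p) (snd p)) < Arg (Complex (fst q) (snd q))"
    using Arg_less_on_circle[of x x' y y'] xy xy' by simp
qed

end

locale polar_picture =
  polar_box F a b + right: polar_side F 1 a b n \<phi> + left: polar_side F "- 1" a b m \<psi>
  for F a b n \<phi> m \<psi>
begin

definition half_branches :: "real \<Rightarrow> (real \<times> real) set set" where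
  "half_branches r = right.arc r ` {1..n} \<union> left.arc r ` {1..m}"

lemma polar_half_branches_arcs:
  assumes r: "0 < r" "r \<le> a" "r \<le> b"
  shows "polar_half_branches F (ball (0, 0) r) (half_branches r)"
  unfolding polar_half_branches_def
proof (intro conjI)
  show "finite (half_branches r)" by (simp add: half_branches_def)
  have rl: "disjnt (right.arc r i) (left.arc r j)" for i j
    unfolding disjnt_def using right.arc_side left.arc_side by force
  show "disjoint (half_branches r)"
    unfolding pairwise_def half_branches_def
    using right.disjnt_arcs left.disjnt_arcs rl disjnt_sym by (smt (verit) UnE imageE)
  show "\<forall>B\<in>half_branches r. half_branch B"
    using right.half_branch_arc left.half_branch_arc r by (auto simp: half_branches_def)
  have ball: "(x, y) \<in> ball (0, 0) r \<longleftrightarrow> x\<^sup>2 + y\<^sup>2 < r\<^sup>2" for x y :: real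
    using r(1) real_sqrt_less_iff[of "x\<^sup>2 + y\<^sup>2" "r\<^sup>2"] by (simp add: dist_Pair_Pair dist_real_def)
  show "\<Union> (half_branches r) = polar_curve F \<inter> ball (0, 0) r - {(0, 0)}"
  proof (rule set_eqI)
    fix p :: "real \<times> real"
    obtain x y where p: "p = (x, y)" by fastforce
    consider "x = 0" | "0 < x" | "x < 0" by linarith
    then show "p \<in> \<Union> (half_branches r) \<longleftrightarrow> p \<in> polar_curve F \<inter> ball (0, 0) r - {(0, 0)}"
    proof cases
      case 1
      have "p \<notin> \<Union> (half_branches r)"
        using right.arc_side[of p r] left.arc_side[of p r] 1 by (auto simp: half_branches_def p)
      moreover have "p \<notin> polar_curve F \<inter> ball (0, 0) r - {(0, 0)}"
      proof
        assume *: "p \<in> polar_curve F \<inter> ball (0, 0) r - {(0, 0)}"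
        then have "\<bar>y\<bar>\<^sup>2 < r\<^sup>2" using ball 1 by (auto simp: p)
        then have "\<bar>y\<bar> < r" using r(1) by (meson power2_less_imp_less less_imp_le)
        with * polar_axis[of y] r 1 show False by (auto simp: p polar_curve_def)
      qed
      ultimately show ?thesis by simp
    next
      case 2
      have "p \<in> \<Union> (half_branches r) \<longleftrightarrow> (\<exists>i\<in>{1..n}. p \<in> right.arc r i)"
        using left.arc_side[of p r] 2 by (auto simp: half_branches_def p)
      also have "\<dots> \<longleftrightarrow> p \<in> polar_curve F \<and> x\<^sup>2 + y\<^sup>2 < r\<^sup>2"
        using right.polar_in_disc_iff[OF r 2, of y] by (simp add: p)
      finally show ?thesis using ball 2 by (auto simp: p)
    next
      case 3
      have "p \<in> \<Union> (half_branches r) \<longleftrightarrow> (\<exists>i\<in>{1..m}. p \<in> left.arc r i)"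
        using right.arc_side[of p r] 3 by (auto simp: half_branches_def p)
      also have "\<dots> \<longleftrightarrow> p \<in> polar_curve F \<and> x\<^sup>2 + y\<^sup>2 < r\<^sup>2"
        using left.polar_in_disc_iff[OF r, of "- x" y] 3 by (simp add: p)
      finally show ?thesis using ball 3 by (auto simp: p)
    qed
  qed
qed

lemma right_half_branches_arcs:
  assumes "0 < r" "r \<le> a"
  shows "right_half_branches (half_branches r) = right.arc r ` {1..n}"
proof -
  have "\<exists>p\<in>left.arc r j. fst p \<le> 0" if "j \<in> {1..m}" for j
    using left.arc_nonempty[OF that assms] left.arc_side by force
  then show ?thesis
    unfolding right_half_branches_def half_branches_def using right.arc_side by force
qed

text \<open>
  Off the origin a zero of \<open>f\<^sub>y\<close> in the box lies on a branch, and \<open>f\<^sub>x \<noteq> 0\<close> along the branches.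
\<close>
lemma no_critical_point:
  assumes "\<bar>x\<bar> \<le> a" "\<bar>y\<bar> \<le> b" "(x, y) \<noteq> (0, 0)" "plane_poly (pderiv F) (x, y) = 0"
  shows "plane_poly (pderiv_x F) (x, y) \<noteq> 0"
proof -
  consider "x = 0" | "0 < x" | "x < 0" by linarith
  then show ?thesis
  proof cases
    case 1
    with assms polar_axis[of y] show ?thesis by simp
  next
    case 2
    with assms right.polar_iff[of x y] obtain i where "i \<in> {1..n}" "y = \<phi> i x" by auto
    with right.fx_pos[of i x] 2 assms show ?thesis by auto
  next
    case 3
    with assms left.polar_iff[of "- x" y] obtain i where "i \<in> {1..m}" "y = \<psi> i (- x)" by auto
    with left.fx_pos[of i "- x"] 3 assms show ?thesis by auto
  qed
qed

lemma polar_connects_to_origin: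
  assumes "\<bar>x\<bar> \<le> a" "\<bar>y\<bar> \<le> b" "plane_poly (pderiv F) (x, y) = 0"
  shows "\<exists>T. connected T \<and> (0, 0) \<in> T \<and> (x, y) \<in> T \<and>
     (\<forall>p\<in>T. \<bar>fst p\<bar> \<le> a \<and> \<bar>snd p\<bar> \<le> b \<and> plane_poly F p \<le> plane_poly F (x, y))"
proof -
  consider "x = 0" | "0 < x" | "x < 0" by linarith
  then show ?thesis
  proof cases
    case 1
    with assms polar_axis[of y] have "y = 0" by simp
    with 1 a_pos b_pos show ?thesis by (intro exI[of _ "{(0, 0)}"]) auto
  next
    case 2
    with assms right.polar_iff[of x y] obtain i where "i \<in> {1..n}" "y = \<phi> i x" by auto
    with right.branch_connects_to_origin[of i x] 2 assms show ?thesis by simp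
  next
    case 3
    with assms left.polar_iff[of "- x" y] obtain i where "i \<in> {1..m}" "y = \<psi> i (- x)" by auto
    with left.branch_connects_to_origin[of i "- x"] 3 assms show ?thesis by simp
  qed
qed

end

section \<open>Small levels\<close>

locale small_level = polar_picture F a b n \<phi> m \<psi> for F a b n \<phi> m \<psi> +
  fixes \<epsilon> :: real
  assumes \<epsilon>_pos: "0 < \<epsilon>"
    and \<epsilon>_small: "\<And>x y. \<bar>x\<bar> \<le> a \<Longrightarrow> \<bar>y\<bar> \<le> b \<Longrightarrow> \<bar>x\<bar> = a \<or> \<bar>y\<bar> = b \<Longrightarrow> \<epsilon> < plane_poly F (x, y)"
begin

abbreviation "D \<equiv> level_region (plane_poly F) \<epsilon>"
abbreviation "C \<equiv> level_curve (plane_poly F) \<epsilon>"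

lemma f_nonneg: "\<bar>x\<bar> \<le> a \<Longrightarrow> \<bar>y\<bar> \<le> b \<Longrightarrow> 0 \<le> plane_poly F (x, y)"
  using f_pos[of x y] f_0 by (cases "(x, y) = (0, 0)") auto

text \<open>
  The component of the origin cannot leave the box, as \<open>f > \<epsilon>\<close> on its boundary.  Conversely a point
  of the box with \<open>f \<le> \<epsilon>\<close> is joined to the origin inside \<open>f \<le> \<epsilon>\<close> by a vertical descent to the polar
  curve followed by a branch.
\<close>
lemma level_region_iff:
  "(x, y) \<in> D \<longleftrightarrow> \<bar>x\<bar> \<le> a \<and> \<bar>y\<bar> \<le> b \<and> plane_poly F (x, y) \<le> \<epsilon>"
proof
  let ?S = "plane_poly F -` {0..\<epsilon>}"
  have O: "(0, 0) \<in> ?S" using \<epsilon>_pos f_0 by simp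
  assume *: "(x, y) \<in> D"
  then have le: "plane_poly F (x, y) \<le> \<epsilon>"
    unfolding level_region_def using connected_component_subset by fastforce
  let ?B = "{- a<..<a} \<times> {- b<..<b}"
  have "(x, y) \<in> ?B"
  proof (rule ccontr)
    assume "(x, y) \<notin> ?B"
    then have out: "D - ?B \<noteq> {}" using * by blast
    have "(0, 0) \<in> D \<inter> ?B"
      unfolding level_region_def using O a_pos b_pos by (auto simp: connected_component_refl)
    then have inn: "D \<inter> ?B \<noteq> {}" by blast
    have "connected D" unfolding level_region_def by (rule connected_connected_component)
    from connected_Int_frontier[OF this inn out] have "D \<inter> frontier ?B \<noteq> {}" .
    then obtain u v where uv: "(u, v) \<in> D" "(u, v) \<in> frontier ?B" by force
    have "frontier ?B = {- a..a} \<times> {- b..b} - ?B"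
      using a_pos b_pos by (simp add: frontier_def closure_Times interior_open open_Times)
    with uv(2) have "\<epsilon> < plane_poly F (u, v)" by (intro \<epsilon>_small) auto
    moreover have "plane_poly F (u, v) \<le> \<epsilon>"
      using uv(1) unfolding level_region_def using connected_component_subset by fastforce
    ultimately show False by simp
  qed
  with le show "\<bar>x\<bar> \<le> a \<and> \<bar>y\<bar> \<le> b \<and> plane_poly F (x, y) \<le> \<epsilon>" by auto
next
  assume *: "\<bar>x\<bar> \<le> a \<and> \<bar>y\<bar> \<le> b \<and> plane_poly F (x, y) \<le> \<epsilon>"
  have "\<exists>z\<in>{- b..b}. plane_poly (pderiv F) (x, z) = 0 \<and>
      (\<forall>t\<in>closed_segment z y. plane_poly F (x, t) \<le> plane_poly F (x, y))"
    using * top[of x] bottom[of x]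
    by (intro descent_to_critical_point plane_poly_partial_y) (auto intro!: continuous_intros)
  then obtain z where z: "- b \<le> z" "z \<le> b" "plane_poly (pderiv F) (x, z) = 0"
    "\<And>t. t \<in> closed_segment z y \<Longrightarrow> plane_poly F (x, t) \<le> plane_poly F (x, y)" by auto
  have "\<bar>x\<bar> \<le> a" "\<bar>z\<bar> \<le> b" using * z by auto
  from polar_connects_to_origin[OF this z(3)]
  obtain T where T: "connected T" "(0, 0) \<in> T" "(x, z) \<in> T"
    "\<forall>p\<in>T. \<bar>fst p\<bar> \<le> a \<and> \<bar>snd p\<bar> \<le> b \<and> plane_poly F p \<le> plane_poly F (x, z)"
    by (elim exE conjE)
  let ?V = "{x} \<times> closed_segment z y"
  have "connected (T \<union> ?V)"
    using T(3) by (intro connected_Un T(1) connected_Times) auto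
  moreover have "T \<union> ?V \<subseteq> plane_poly F -` {0..\<epsilon>}"
  proof
    fix p assume "p \<in> T \<union> ?V"
    then have "\<bar>fst p\<bar> \<le> a \<and> \<bar>snd p\<bar> \<le> b \<and> plane_poly F p \<le> \<epsilon>"
    proof
      assume "p \<in> T"
      moreover have "plane_poly F (x, z) \<le> \<epsilon>" using z(4)[of z] * by auto
      ultimately show ?thesis using T(4) by fastforce
    next
      assume "p \<in> ?V"
      then obtain t where t: "p = (x, t)" "t \<in> closed_segment z y" by auto
      then have "\<bar>t\<bar> \<le> b" using z(1,2) * by (auto simp: closed_segment_eq_real_ivl split: if_splits)
      with t z(4)[OF t(2)] * show ?thesis by auto
    qed
    then show "p \<in> plane_poly F -` {0..\<epsilon>}" using f_nonneg by (cases p) auto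
  qed
  moreover have "(0, 0) \<in> T \<union> ?V" "(x, y) \<in> T \<union> ?V" using T(2) by auto
  ultimately show "(x, y) \<in> D"
    unfolding level_region_def by (auto simp: connected_component_def)
qed

text \<open>
  A point of value \<open>\<epsilon>\<close> in the interior of the level region would be a local maximum, hence a critical
  point of \<open>f\<close> other than the origin.
\<close>
lemma level_curve_iff:
  "(x, y) \<in> C \<longleftrightarrow> \<bar>x\<bar> < a \<and> \<bar>y\<bar> < b \<and> plane_poly F (x, y) = \<epsilon>"
proof -
  have inside: "\<bar>x\<bar> < a \<and> \<bar>y\<bar> < b" if "(x, y) \<in> D"
    using that \<epsilon>_small[of x y] unfolding level_region_iff by (auto simp: less_le)
  have "(x, y) \<in> interior D \<longleftrightarrow> plane_poly F (x, y) < \<epsilon>" if D: "(x, y) \<in> D"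
  proof
    assume less: "plane_poly F (x, y) < \<epsilon>"
    let ?U = "({- a<..<a} \<times> {- b<..<b}) \<inter> plane_poly F -` {..<\<epsilon>}"
    have "open ?U" by (intro open_Int open_Times open_vimage continuous_on_plane_poly) auto
    moreover have "(x, y) \<in> ?U" using less inside[OF D] by auto
    moreover have "?U \<subseteq> D" using level_region_iff by force
    ultimately show "(x, y) \<in> interior D" by (rule interiorI)
  next
    assume int: "(x, y) \<in> interior D"
    show "plane_poly F (x, y) < \<epsilon>"
    proof (rule ccontr)
      assume "\<not> plane_poly F (x, y) < \<epsilon>"
      with D have eq: "plane_poly F (x, y) = \<epsilon>" by (simp add: level_region_iff)
      obtain h where h: "h > 0" "\<And>u v. \<bar>u - x\<bar> < h \<Longrightarrow> \<bar>v - y\<bar> < h \<Longrightarrow> (u, v) \<in> interior D"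
        using open_square[OF open_interior int] by auto
      have max: "plane_poly F (u, v) \<le> plane_poly F (x, y)" if "\<bar>u - x\<bar> < h" "\<bar>v - y\<bar> < h" for u v
        using h(2)[OF that] interior_subset[of D] level_region_iff[of u v] eq by auto
      have "plane_poly (pderiv F) (x, y) = 0"
        by (rule DERIV_local_max[OF plane_poly_partial_y h(1)]) (use max[of x] h(1) in \<open>auto simp: abs_minus_commute\<close>)
      moreover have "plane_poly (pderiv_x F) (x, y) = 0"
        by (rule DERIV_local_max[OF plane_poly_partial_x h(1)]) (use max[of _ y] h(1) in \<open>auto simp: abs_minus_commute\<close>)
      moreover have "(x, y) \<noteq> (0, 0)" using eq f_0 \<epsilon>_pos by auto
      ultimately show False using no_critical_point[of x y] D by (simp add: level_region_iff)
    qed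
  qed
  then show ?thesis
    unfolding level_curve_def using inside level_region_iff[of x y] by auto
qed

lemma level_curve_local:
  "C \<inter> ({- a<..<a} \<times> {- b<..<b}) = {p \<in> {- a<..<a} \<times> {- b<..<b}. plane_poly F p = \<epsilon>}"
proof (rule set_eqI)
  fix p :: "real \<times> real"
  obtain x y where "p = (x, y)" by fastforce
  then show "p \<in> C \<inter> ({- a<..<a} \<times> {- b<..<b}) \<longleftrightarrow> p \<in> {p \<in> {- a<..<a} \<times> {- b<..<b}. plane_poly F p = \<epsilon>}"
    using level_curve_iff[of x y] by (auto simp: abs_less_iff)
qed

lemma crossing_exists:
  assumes i: "i \<in> {1..n}"
  shows "\<exists>x. 0 < x \<and> x < a \<and> plane_poly F (x, \<phi> i x) = \<epsilon>"
proof -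
  have end1: "\<epsilon> < plane_poly F (a, \<phi> i a)"
    using right.branch_bound[OF i, of a] a_pos by (intro \<epsilon>_small) auto
  have "\<exists>x\<ge>0. x \<le> a \<and> plane_poly F (x, \<phi> i x) = \<epsilon>"
    using end1 \<epsilon>_pos f_0 right.branch_0[OF i] a_pos
    by (intro IVT') (auto intro!: continuous_intros right.branch_cont[OF i])
  then obtain x where x: "0 \<le> x" "x \<le> a" "plane_poly F (x, \<phi> i x) = \<epsilon>" by blast
  moreover have "x \<noteq> 0" using x(3) right.branch_0[OF i] f_0 \<epsilon>_pos by auto
  moreover have "x \<noteq> a" using x(3) end1 by auto
  ultimately show ?thesis by (intro exI[of _ x]) auto
qed

definition abscissa :: "nat \<Rightarrow> real" where
  "abscissa i = (SOME x. 0 < x \<and> x < a \<and> plane_poly F (x, \<phi> i x) = \<epsilon>)"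

definition P :: "nat \<Rightarrow> real \<times> real" where
  "P i = (abscissa i, \<phi> i (abscissa i))"

lemma abscissa:
  assumes "i \<in> {1..n}"
  shows "0 < abscissa i" "abscissa i < a" "plane_poly F (abscissa i, \<phi> i (abscissa i)) = \<epsilon>"
  using someI_ex[OF crossing_exists[OF assms]] by (auto simp: abscissa_def)

lemma less_abscissa_iff:
  assumes "i \<in> {1..n}" "0 \<le> x" "x \<le> a"
  shows "x < abscissa i \<longleftrightarrow> plane_poly F (x, \<phi> i x) < \<epsilon>" "abscissa i < x \<longleftrightarrow> \<epsilon> < plane_poly F (x, \<phi> i x)"
  using right.f_less_iff[OF assms(1), of x "abscissa i"] right.f_less_iff[OF assms(1), of "abscissa i" x] abscissa[OF assms(1)] assms
  by auto

lemma P_in: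
  assumes i: "i \<in> {1..n}"
  shows "P i \<in> C" "P i \<in> {- a<..<a} \<times> {- b<..<b}" "plane_poly (pderiv F) (P i) = 0"
    "0 < plane_poly (pderiv_x F) (P i)" "0 < fst (P i)"
proof -
  have b: "\<bar>\<phi> i (abscissa i)\<bar> < b" using right.branch_bound[OF i, of "abscissa i"] abscissa[OF i] by simp
  then show "P i \<in> C" "P i \<in> {- a<..<a} \<times> {- b<..<b}"
    using abscissa[OF i] by (auto simp: P_def level_curve_iff abs_less_iff)
  show "plane_poly (pderiv F) (P i) = 0"
    using right.polar_iff[of "abscissa i" "\<phi> i (abscissa i)"] abscissa[OF i] b i by (auto simp: P_def)
  show "0 < plane_poly (pderiv_x F) (P i)" "0 < fst (P i)"
    using right.fx_pos[OF i, of "abscissa i"] abscissa[OF i] by (auto simp: P_def)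
qed

lemma inj_on_P: "inj_on P {1..n}"
proof (rule inj_onI)
  fix i j assume ij: "i \<in> {1..n}" "j \<in> {1..n}" "P i = P j"
  then have "\<phi> i (abscissa i) = \<phi> j (abscissa i)" by (auto simp: P_def)
  with right.branch_less[of i j "abscissa i"] right.branch_less[of j i "abscissa i"] abscissa[OF ij(1)] ij(1,2)
  show "i = j" by (metis less_irrefl less_imp_le linorder_neqE_nat)
qed

lemma level_curve_Int_arc:
  assumes i: "i \<in> {1..n}" and r: "(abscissa i)\<^sup>2 + (\<phi> i (abscissa i))\<^sup>2 < r\<^sup>2"
  shows "C \<inter> right.arc r i = {P i}"
proof -
  have "x = abscissa i" if "0 < x" "x \<le> a" "plane_poly F (x, \<phi> i x) = \<epsilon>" for x
    using less_abscissa_iff[OF i, of x] that by force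
  then have "C \<inter> right.arc r i \<subseteq> {P i}" by (auto simp: right.arc_def level_curve_iff P_def)
  moreover have "P i \<in> C \<inter> right.arc r i"
    using P_in(1)[OF i] abscissa[OF i] r by (auto simp: right.arc_def P_def)
  ultimately show ?thesis by blast
qed

text \<open>
  Where \<open>f\<^sub>y \<noteq> 0\<close> the curve is a graph over the \<open>x\<close>-axis, so crests and valleys lie on the polar curve;
  on its branches \<open>f\<^sub>x > 0\<close> and \<open>f\<^sub>y\<^sub>y \<noteq> 0\<close>, so conversely every \<open>P i\<close> is one of them.
\<close>
lemma extremal_points: "{p. right_crest C p \<or> right_valley C p} = P ` {1..n}"
proof (intro equalityI subsetI)
  let ?W = "{- a<..<a} \<times> {- b<..<b}"
  have W: "open ?W" by (simp add: open_Times)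
  {
    fix p assume "p \<in> {p. right_crest C p \<or> right_valley C p}"
    then have p: "right_crest C p \<or> right_valley C p" by simp
    obtain x y where xy: "p = (x, y)" by fastforce
    have C: "(x, y) \<in> C" "0 < x" using p by (auto simp: right_crest_def right_valley_def xy)
    then have lev: "(x, y) \<in> ?W" "plane_poly F (x, y) = \<epsilon>" by (auto simp: level_curve_iff abs_less_iff)
    have "plane_poly (pderiv F) (x, y) = 0"
      using not_extremal_if_graph[OF W lev(1) level_curve_local lev(2)] p by (auto simp: xy)
    moreover have "x \<le> a" "\<bar>y\<bar> \<le> b" using lev(1) by auto
    ultimately obtain i where i: "i \<in> {1..n}" "y = \<phi> i x"
      using right.polar_iff[of x y] C(2) by auto
    then have "x = abscissa i" using less_abscissa_iff[OF i(1), of x] lev C(2) by force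
    with i show "p \<in> P ` {1..n}" by (auto simp: P_def xy)
  }
  fix p assume "p \<in> P ` {1..n}"
  then obtain i where i: "i \<in> {1..n}" "p = P i" by blast
  note Pi = P_in[OF i(1)]
  have "plane_poly (pderiv (pderiv F)) (abscissa i, \<phi> i (abscissa i)) \<noteq> 0"
    using simple_roots[of "abscissa i"] abscissa[OF i(1)] Pi(3) by (simp add: P_def)
  then have "right_crest C (P i) \<or> right_valley C (P i)"
    unfolding P_def using Pi abscissa[OF i(1)]
    by (intro extremal_if_nondegenerate[OF W _ level_curve_local]) (auto simp: P_def)
  with i(2) show "p \<in> {p. right_crest C p \<or> right_valley C p}" by simp
qed

lemma vertical_tangent_P:
  assumes i: "i \<in> {1..n}"
  shows "vertical_tangent C (P i)"
  unfolding P_def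
proof (rule vertical_tangent_if_polar[OF _ _ level_curve_local])
  show "open ({- a<..<a} \<times> {- b<..<b})" by (simp add: open_Times)
qed (use P_in[OF i] abscissa[OF i] in \<open>auto simp: P_def\<close>)

text \<open>
  Between the branches \<open>i\<close> and \<open>i + 1\<close> the sign of \<open>f\<^sub>y\<close> is that of \<open>(- 1) ^ Suc i\<close>.  Moving vertically
  from \<open>P i\<close> to the next branch thus makes \<open>f\<close> larger than \<open>\<epsilon>\<close> if \<open>i\<close> is odd and smaller if \<open>i\<close> is
  even; as \<open>f\<close> increases along the next branch, its level \<open>\<epsilon>\<close> lies to the left or to the right.
\<close>
lemma neighbouring_abscissae:
  assumes i: "i \<in> {1..<n}"
  shows "if odd i then abscissa (Suc i) < abscissa i else abscissa i < abscissa (Suc i)"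
proof -
  have i1: "i \<in> {1..n}" and i2: "Suc i \<in> {1..n}" using i by auto
  define x where "x = abscissa i"
  have x: "0 < x" "x \<le> a" "plane_poly F (x, \<phi> i x) = \<epsilon>" using abscissa[OF i1] by (auto simp: x_def)
  define s :: real where "s = (- 1) ^ Suc i"
  have less: "\<phi> i x < \<phi> (Suc i) x" using right.branch_less[OF i1 i2] x by simp
  have "s * plane_poly F (x, \<phi> i x) < s * plane_poly F (x, \<phi> (Suc i) x)"
  proof (rule DERIV_pos_imp_increasing_open[OF less])
    fix t assume "\<phi> i x < t" "t < \<phi> (Suc i) x"
    then have "0 < s * plane_poly (pderiv F) (x, t)" using right.alternate[OF i, of x t] x by (simp add: s_def)
    then show "\<exists>D. ((\<lambda>t. s * plane_poly F (x, t)) has_real_derivative D) (at t) \<and> 0 < D"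
      using DERIV_cmult[OF plane_poly_partial_y] by blast
  qed (intro continuous_intros)
  with x less_abscissa_iff[OF i2, of x] show ?thesis by (auto simp: s_def x_def)
qed

text \<open>
  The curve has a vertical tangent at every \<open>P i\<close>, so without vertical bitangents the abscissae are
  pairwise distinct and reading them from right to left is a linear order.  The permutation sends
  \<open>i\<close> to the position of \<open>P i\<close> in that order, which by \<open>neighbouring_abscissae\<close> goes up and down
  alternately.
\<close>
lemma snake_of_generic:
  assumes gen: "vertical_generic C"
  shows "\<exists>\<sigma>. associated_permutation (P ` {1..n}) {(P i, P j) | i j. i \<in> {1..n} \<and> j \<in> {1..n} \<and> i < j}
     (right_to_left (P ` {1..n})) \<sigma> \<and> snake n \<sigma> \<and> up_down n \<sigma>"
proof -
  let ?S = "P ` {1..n}" and ?r1 = "{(P i, P j) | i j. i \<in> {1..n} \<and> j \<in> {1..n} \<and> i < j}"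
  let ?r2 = "right_to_left ?S"
  have P_eq: "P i = P j \<longleftrightarrow> i = j" if "i \<in> {1..n}" "j \<in> {1..n}" for i j
    using inj_on_P that by (rule inj_on_eq_iff)
  have r1: "(P i, P j) \<in> ?r1 \<longleftrightarrow> i < j" if "i \<in> {1..n}" "j \<in> {1..n}" for i j
  proof
    assume "(P i, P j) \<in> ?r1"
    then obtain k l where "P i = P k" "P j = P l" "k \<in> {1..n}" "l \<in> {1..n}" "k < l" by blast
    with P_eq[of i k] P_eq[of j l] that show "i < j" by simp
  qed (use that in blast)
  have fst_neq: "fst (P i) \<noteq> fst (P j)" if "i \<in> {1..n}" "j \<in> {1..n}" "i \<noteq> j" for i j
    using gen vertical_tangent_P[OF that(1)] vertical_tangent_P[OF that(2)] P_eq[OF that(1,2)] that(3)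
    unfolding vertical_generic_def by blast
  have card: "card ?S = n" using inj_on_P by (simp add: card_image)
  have lin1: "strict_linear_order_on ?S ?r1"
    unfolding strict_linear_order_on_def
  proof (intro conjI)
    show "trans ?r1"
    proof (rule transI)
      fix p q t assume "(p, q) \<in> ?r1" "(q, t) \<in> ?r1"
      then obtain i j k l where "p = P i" "q = P j" "q = P k" "t = P l" "i < j" "k < l"
        "i \<in> {1..n}" "j \<in> {1..n}" "k \<in> {1..n}" "l \<in> {1..n}" by blast
      moreover from this have "j = k" using P_eq by metis
      ultimately show "(p, t) \<in> ?r1" using r1 by auto
    qed
    show "irrefl ?r1" using P_eq by (auto simp: irrefl_def)
    show "total_on ?S ?r1"
    proof (rule total_onI)
      fix p q assume "p \<in> ?S" "q \<in> ?S" "p \<noteq> q"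
      then obtain i j where ij: "p = P i" "q = P j" "i \<in> {1..n}" "j \<in> {1..n}" "i \<noteq> j" by blast
      from ij(5) have "i < j \<or> j < i" by linarith
      then show "(p, q) \<in> ?r1 \<or> (q, p) \<in> ?r1"
        unfolding ij(1,2) r1[OF ij(3,4)] r1[OF ij(4,3)] .
    qed
  qed
  have lin2: "strict_linear_order_on ?S ?r2"
    unfolding strict_linear_order_on_def
  proof (intro conjI)
    show "trans ?r2" by (rule transI) (auto simp: right_to_left_def)
    show "irrefl ?r2" by (auto simp: irrefl_def right_to_left_def)
    show "total_on ?S ?r2"
    proof (rule total_onI)
      fix p q assume "p \<in> ?S" "q \<in> ?S" "p \<noteq> q"
      then have "fst p \<noteq> fst q" using fst_neq by blast
      with \<open>p \<in> ?S\<close> \<open>q \<in> ?S\<close> show "(p, q) \<in> ?r2 \<or> (q, p) \<in> ?r2" by (auto simp: right_to_left_def)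
    qed
  qed
  define \<sigma> where "\<sigma> i = (if i \<in> {1..n} then position ?r2 ?S (P i) else i)" for i
  have pos1: "position ?r1 ?S (P i) = i" if i: "i \<in> {1..n}" for i
  proof -
    have "{p \<in> ?S. (p, P i) \<in> ?r1} = P ` {1..<i}"
    proof (intro equalityI subsetI)
      fix p assume "p \<in> {p \<in> ?S. (p, P i) \<in> ?r1}"
      then obtain j where "j \<in> {1..n}" "p = P j" "(P j, P i) \<in> ?r1" by blast
      with r1 i show "p \<in> P ` {1..<i}" by auto
    next
      fix p assume "p \<in> P ` {1..<i}"
      then obtain j where "j \<in> {1..<i}" "p = P j" by blast
      with r1[of j i] i show "p \<in> {p \<in> ?S. (p, P i) \<in> ?r1}" by auto
    qed
    moreover have "inj_on P {1..<i}" by (rule inj_on_subset[OF inj_on_P]) (use i in auto)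
    ultimately show ?thesis using i by (simp add: position_def card_image)
  qed
  have "bij_betw \<sigma> {1..n} {1..n}"
  proof -
    have "bij_betw (position ?r2 ?S \<circ> P) {1..n} {1..n}"
      using bij_betw_trans[of P "{1..n}" ?S "position ?r2 ?S" "{1..n}"] inj_on_P
        bij_betw_position[OF _ lin2] card by (simp add: bij_betw_def)
    then show ?thesis by (rule bij_betw_cong[THEN iffD1, rotated]) (simp add: \<sigma>_def)
  qed
  then have perm: "\<sigma> permutes {1..n}" by (rule bij_imp_permutes) (auto simp: \<sigma>_def)
  have \<sigma>_less: "\<sigma> i < \<sigma> j \<longleftrightarrow> abscissa j < abscissa i" if "i \<in> {1..n}" "j \<in> {1..n}" for i j
  proof -
    have "\<sigma> i < \<sigma> j \<longleftrightarrow> (P i, P j) \<in> ?r2"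
      using position_less_iff[OF _ lin2, of "P i" "P j"] that by (simp add: \<sigma>_def)
    then show ?thesis using that by (auto simp: right_to_left_def P_def)
  qed
  have ud: "up_down n \<sigma>"
    unfolding up_down_def
  proof (intro allI impI)
    fix i assume i: "1 \<le> i \<and> i < n"
    then show "if odd i then \<sigma> i < \<sigma> (i + 1) else \<sigma> (i + 1) < \<sigma> i"
      using neighbouring_abscissae[of i] \<sigma>_less[of i "Suc i"] \<sigma>_less[of "Suc i" i] by auto
  qed
  moreover have "snake n \<sigma>" using perm ud by (simp add: snake_def)
  moreover have "associated_permutation ?S ?r1 ?r2 \<sigma>"
    unfolding associated_permutation_def
  proof (intro conjI ballI)
    show "\<sigma> permutes {1..card ?S}" using perm card by simp
    fix p assume "p \<in> ?S"
    then obtain i where "i \<in> {1..n}" "p = P i" by blast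
    then show "\<sigma> (position ?r1 ?S p) = position ?r2 ?S p" using pos1 by (simp add: \<sigma>_def)
  qed (use lin1 lin2 in auto)
  ultimately show ?thesis by blast
qed

end

section \<open>The snake of a small level\<close>

lemma (in polar_box) boundary_positive:
  "\<exists>\<mu>>0. \<forall>x y. \<bar>x\<bar> \<le> a \<and> \<bar>y\<bar> \<le> b \<and> (\<bar>x\<bar> = a \<or> \<bar>y\<bar> = b) \<longrightarrow> \<mu> \<le> plane_poly F (x, y)"
proof -
  let ?B = "({- a, a} \<times> {- b..b}) \<union> ({- a..a} \<times> {- b, b})"
  have "compact ?B" by (intro compact_Un compact_Times) (auto simp: finite_imp_compact)
  moreover have "?B \<noteq> {}" using b_pos by auto
  ultimately obtain p where p: "p \<in> ?B" "\<And>q. q \<in> ?B \<Longrightarrow> plane_poly F p \<le> plane_poly F q"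
    using continuous_attains_inf[OF _ _ continuous_on_plane_poly] by metis
  obtain u v where uv: "p = (u, v)" by fastforce
  have "0 < plane_poly F p" unfolding uv
    using p(1) a_pos b_pos by (intro f_pos) (auto simp: uv)
  moreover have "plane_poly F p \<le> plane_poly F (x, y)" if "\<bar>x\<bar> \<le> a" "\<bar>y\<bar> \<le> b" "\<bar>x\<bar> = a \<or> \<bar>y\<bar> = b" for x y
    using that by (intro p(2)) (auto simp: abs_if split: if_splits)
  ultimately show ?thesis by blast
qed

text \<open>
  The two sides yield different bounds on \<open>a\<close>; any smaller \<open>a\<close> serves both.
\<close>
lemma polar_picture_exists:
  assumes "strict_local_min (plane_poly F) (0, 0)" "plane_poly F (0, 0) = 0" "squarefree (pderiv F)"
  shows "\<exists>a b n \<phi> m \<psi>. polar_picture F a b n \<phi> m \<psi>"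
proof -
  obtain a0 b where box: "polar_box F a0 b" using polar_box_exists[OF assms] by blast
  obtain a1 n \<phi> where R: "0 < a1" "a1 \<le> a0" "\<forall>a. 0 < a \<and> a < a1 \<longrightarrow> polar_side F 1 a b n \<phi>"
    using polar_side_exists[OF box assms(3), of 1] by auto
  obtain a2 m \<psi> where L: "0 < a2" "a2 \<le> a0" "\<forall>a. 0 < a \<and> a < a2 \<longrightarrow> polar_side F (- 1) a b m \<psi>"
    using polar_side_exists[OF box assms(3), of "- 1"] by auto
  obtain a where a: "0 < a" "a < min a1 a2" using dense[of 0 "min a1 a2"] R(1) L(1) by auto
  have "polar_picture F a b n \<phi> m \<psi>"
    using polar_box_shrink[OF box a(1)] R L a by (simp add: polar_picture_def)
  then show ?thesis by blast
qed

context polar_picture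
begin

text \<open>
  It suffices to take \<open>\<epsilon>\<close> below the values of \<open>f\<close> on the boundary of the box and at the ends \<open>\<xi> i\<close> of
  the arcs in the disc of radius \<open>r\<close>; the latter places every \<open>P i\<close> on its arc.
\<close>
lemma snake_for_small_levels:
  assumes r: "0 < r" "r \<le> a"
  shows "\<exists>\<epsilon>0>0. \<forall>\<epsilon>. 0 < \<epsilon> \<and> \<epsilon> < \<epsilon>0 \<and> vertical_generic (level_curve (plane_poly F) \<epsilon>) \<longrightarrow>
    (\<exists>P \<sigma>.
       (\<forall>i\<in>{1..n}. level_curve (plane_poly F) \<epsilon> \<inter> right.arc r i = {P i}) \<and>
       P ` {1..n} = {p. right_crest (level_curve (plane_poly F) \<epsilon>) p \<or> right_valley (level_curve (plane_poly F) \<epsilon>) p} \<and>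
       associated_permutation (P ` {1..n})
         {(P i, P j) | i j. i \<in> {1..n} \<and> j \<in> {1..n} \<and> i < j}
         (right_to_left (P ` {1..n})) \<sigma> \<and>
       snake n \<sigma> \<and> odd n \<and> up_down n \<sigma>)"
proof -
  obtain \<mu> where \<mu>: "0 < \<mu>" "\<forall>x y. \<bar>x\<bar> \<le> a \<and> \<bar>y\<bar> \<le> b \<and> (\<bar>x\<bar> = a \<or> \<bar>y\<bar> = b) \<longrightarrow> \<mu> \<le> plane_poly F (x, y)"
    using boundary_positive by blast
  have "\<exists>\<xi>. \<forall>i\<in>{1..n}. 0 < \<xi> i \<and> \<xi> i \<le> a \<and> (\<xi> i)\<^sup>2 + (\<phi> i (\<xi> i))\<^sup>2 = r\<^sup>2"
    using right.arc_end[OF _ r] by (intro bchoice) blast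
  then obtain \<xi> where \<xi>: "\<And>i. i \<in> {1..n} \<Longrightarrow> 0 < \<xi> i \<and> \<xi> i \<le> a \<and> (\<xi> i)\<^sup>2 + (\<phi> i (\<xi> i))\<^sup>2 = r\<^sup>2"
    by blast
  define M where "M = insert \<mu> ((\<lambda>i. plane_poly F (\<xi> i, \<phi> i (\<xi> i))) ` {1..n})"
  have "0 < plane_poly F (\<xi> i, \<phi> i (\<xi> i))" if "i \<in> {1..n}" for i
    using \<xi>[OF that] right.branch_bound[OF that, of "\<xi> i"] by (intro f_pos) auto
  then have M: "finite M" "\<forall>x\<in>M. 0 < x" using \<mu>(1) by (auto simp: M_def)
  show ?thesis
  proof (intro exI[of _ "Min M"] conjI allI impI)
    show "0 < Min M" using M by (simp add: M_def)
    fix \<epsilon> assume \<epsilon>: "0 < \<epsilon> \<and> \<epsilon> < Min M \<and> vertical_generic (level_curve (plane_poly F) \<epsilon>)"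
    then have below: "\<epsilon> < x" if "x \<in> M" for x using M(1) that Min_le[of M x] by linarith
    interpret small_level F a b n \<phi> m \<psi> \<epsilon>
    proof
      show "0 < \<epsilon>" using \<epsilon> by simp
      show "\<epsilon> < plane_poly F (x, y)" if "\<bar>x\<bar> \<le> a" "\<bar>y\<bar> \<le> b" "\<bar>x\<bar> = a \<or> \<bar>y\<bar> = b" for x y
        using below[of \<mu>] \<mu>(2)[rule_format, of x y] that by (simp add: M_def)
    qed
    have arcs: "C \<inter> right.arc r i = {P i}" if i: "i \<in> {1..n}" for i
    proof (rule level_curve_Int_arc[OF i])
      have "\<epsilon> < plane_poly F (\<xi> i, \<phi> i (\<xi> i))" using i by (intro below) (simp add: M_def)
      then have "abscissa i < \<xi> i" using less_abscissa_iff(2)[OF i, of "\<xi> i"] \<xi>[OF i] by simp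
      then show "(abscissa i)\<^sup>2 + (\<phi> i (abscissa i))\<^sup>2 < r\<^sup>2"
        using right.radius_less_iff[OF i, of "abscissa i" "\<xi> i"] \<xi>[OF i] abscissa[OF i] by simp
    qed
    obtain \<sigma> where \<sigma>: "associated_permutation (P ` {1..n}) {(P i, P j) | i j. i \<in> {1..n} \<and> j \<in> {1..n} \<and> i < j}
       (right_to_left (P ` {1..n})) \<sigma>" "snake n \<sigma>" "up_down n \<sigma>"
      using snake_of_generic[OF \<epsilon>[THEN conjunct2, THEN conjunct2]] by (elim exE conjE)
    show "\<exists>P \<sigma>.
       (\<forall>i\<in>{1..n}. C \<inter> right.arc r i = {P i}) \<and>
       P ` {1..n} = {p. right_crest C p \<or> right_valley C p} \<and>
       associated_permutation (P ` {1..n})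
         {(P i, P j) | i j. i \<in> {1..n} \<and> j \<in> {1..n} \<and> i < j}
         (right_to_left (P ` {1..n})) \<sigma> \<and>
       snake n \<sigma> \<and> odd n \<and> up_down n \<sigma>"
      by (intro exI[of _ P] exI[of _ \<sigma>] conjI ballI arcs extremal_points[symmetric] \<sigma> right.odd_branches)
  qed
qed

end

theorem theorem4p24:
  fixes f :: "real \<times> real \<Rightarrow> real" and F :: "real poly poly"
  assumes "f = plane_poly F"
    and "strict_local_min f (0, 0)"
    and "f (0, 0) = 0"
    and "squarefree (pderiv F)"
  shows "\<exists>r0>0. \<forall>r. 0 < r \<and> r < r0 \<longrightarrow>
    (\<exists>H n \<gamma>.
       polar_half_branches F (ball (0, 0) r) H \<and>
       n = card (right_half_branches H) \<and>
       bij_betw \<gamma> {1..n} (right_half_branches H) \<and>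
       (\<forall>i\<in>{1..n}. \<forall>j\<in>{1..n}. i < j \<longrightarrow> trig_less (\<gamma> i) (\<gamma> j)) \<and>
       (\<exists>\<epsilon>0>0. \<forall>\<epsilon>. 0 < \<epsilon> \<and> \<epsilon> < \<epsilon>0 \<and> vertical_generic (level_curve f \<epsilon>) \<longrightarrow>
          (\<exists>P \<sigma>.
             (\<forall>i\<in>{1..n}. level_curve f \<epsilon> \<inter> \<gamma> i = {P i}) \<and>
             P ` {1..n} = {p. right_crest (level_curve f \<epsilon>) p \<or> right_valley (level_curve f \<epsilon>) p} \<and>
             associated_permutation (P ` {1..n})
               {(P i, P j) | i j. i \<in> {1..n} \<and> j \<in> {1..n} \<and> i < j}
               (right_to_left (P ` {1..n})) \<sigma> \<and>
             snake n \<sigma> \<and> odd n \<and> up_down n \<sigma>)))"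
proof -
  obtain a b n \<phi> m \<psi> where "polar_picture F a b n \<phi> m \<psi>"
    using polar_picture_exists assms by blast
  then interpret polar_picture F a b n \<phi> m \<psi> .
  show ?thesis
    unfolding assms(1)
  proof (intro exI[of _ "min a b"] conjI allI impI)
    show "0 < min a b" using a_pos b_pos by simp
    fix r assume "0 < r \<and> r < min a b"
    then have r: "0 < r" "r \<le> a" "r \<le> b" by auto
    note right = right_half_branches_arcs[OF r(1,2)] and inj = right.inj_on_arc[OF r(1,2)]
    show "\<exists>H n \<gamma>.
       polar_half_branches F (ball (0, 0) r) H \<and>
       n = card (right_half_branches H) \<and>
       bij_betw \<gamma> {1..n} (right_half_branches H) \<and>
       (\<forall>i\<in>{1..n}. \<forall>j\<in>{1..n}. i < j \<longrightarrow> trig_less (\<gamma> i) (\<gamma> j)) \<and>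
       (\<exists>\<epsilon>0>0. \<forall>\<epsilon>. 0 < \<epsilon> \<and> \<epsilon> < \<epsilon>0 \<and> vertical_generic (level_curve (plane_poly F) \<epsilon>) \<longrightarrow>
          (\<exists>P \<sigma>.
             (\<forall>i\<in>{1..n}. level_curve (plane_poly F) \<epsilon> \<inter> \<gamma> i = {P i}) \<and>
             P ` {1..n} = {p. right_crest (level_curve (plane_poly F) \<epsilon>) p \<or> right_valley (level_curve (plane_poly F) \<epsilon>) p} \<and>
             associated_permutation (P ` {1..n})
               {(P i, P j) | i j. i \<in> {1..n} \<and> j \<in> {1..n} \<and> i < j}
               (right_to_left (P ` {1..n})) \<sigma> \<and>
             snake n \<sigma> \<and> odd n \<and> up_down n \<sigma>))"
    proof (intro exI[of _ "half_branches r"] exI[of _ n] exI[of _ "right.arc r"] conjI)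
      show "polar_half_branches F (ball (0, 0) r) (half_branches r)" using r by (rule polar_half_branches_arcs)
      show "n = card (right_half_branches (half_branches r))" unfolding right using card_image[OF inj] by simp
      show "bij_betw (right.arc r) {1..n} (right_half_branches (half_branches r))"
        unfolding right using inj by (rule inj_on_imp_bij_betw)
      show "\<forall>i\<in>{1..n}. \<forall>j\<in>{1..n}. i < j \<longrightarrow> trig_less (right.arc r i) (right.arc r j)"
        using right.trig_less_arc a_pos by blast
    qed (rule snake_for_small_levels[OF r(1,2)])
  qed
qed

end
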